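(* Suppose that $g\in\pi_1(M)$ does not fix a point in the flowspace $P$. Then $g$ acts on the universal circle $S^1_u$ with exactly two fixed points, in an attracting-repelling pair.
   Context: $M$ is a closed orientable hyperbolic $3$-manifold with universal cover $\widetilde{M}\cong\mathbb{H}^3$ and sphere at infinity $S^2_\infty=\partial_\infty\mathbb{H}^3$; $\pi_1(M)$ acts on $\widetilde{M}$ by deck transformations and this action extends to $S^2_\infty$. $\Phi$ is a quasigeodesic flow on $M$ (a continuous $\mathbb{R}$-action each of whose orbits lifts to a curve in $\widetilde M$ admitting a parametrization $\gamma:\mathbb{R}\to\widetilde{M}$ with $\frac1k d(\gamma(s),\gamma(t))-\epsilon\le|s-t|\le k\,d(\gamma(s),\gamma(t))+\epsilon$ for some constants $k>0,\epsilon\ge0$ possibly depending on the orbit), and $\widetilde{\Phi}$ is the lifted flow on $\widetilde{M}$, whose orbits are called flowlines. The flowspace $P$ is the orbit space of $\widetilde\Phi$ with the quotient topology and the induced $\pi_1(M)$-action; it is known to be homeomorphic to the plane, and the action is orientation-preserving. Each flowline has well-defined distinct positive and negative endpoints in $S^2_\infty$; $e^\pm:P\to S^2_\infty$ are the (continuous, $\pi_1(M)$-equivariant) maps sending $p$ to the positive/negative endpoint of the corresponding flowline, so $e^+(p)\ne e^-(p)$ for all $p$. Compactified flowspace. $\mathbf{P}=P\sqcup S^1_u$ is a fixed compactification of $P$ to a closed disc with interior $P$ and boundary circle $S^1_u$ such that: the action of $\pi_1(M)$ on $P$ extends uniquely to an action on $\mathbf{P}$; the maps $e^\pm$ extend uniquely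 to continuous $\pi_1(M)$-equivariant maps $\mathbf{e}^\pm:\mathbf{P}\to S^2_\infty$; $\mathbf{e}^+=\mathbf{e}^-$ on $S^1_u$; and $(\mathbf{e}^\pm)^{-1}(z)\cap S^1_u$ is totally disconnected for each $z\in S^2_\infty$. The universal circle is $S^1_u$ with the restricted action of $\pi_1(M)$. *)

theory Defs
  imports
    "HOL-Complex_Analysis.Complex_Analysis"
    "HOL-Algebra.Group_Action"
begin

section \<open>Hyperbolic space and its sphere at infinity\<close>

text \<open>Hyperbolic 3-space is the Poincare ball model of curvature -1, so that the sphere at infinity
  is the Euclidean unit sphere, and convergence to a point at infinity is Euclidean convergence
  in the closed ball.\<close>

abbreviation hyp_space :: "(real^3) set" where
  "hyp_space \<equiv> ball 0 1"

abbreviation sphere_inf :: "(real^3) set" where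
  "sphere_inf \<equiv> sphere 0 1"

definition hdist :: "real^3 \<Rightarrow> real^3 \<Rightarrow> real" where
  "hdist x y = arcosh (1 + 2 * (norm (x - y))\<^sup>2 / ((1 - (norm x)\<^sup>2) * (1 - (norm y)\<^sup>2)))"

definition orientation_preserving_isometry :: "(real^3 \<Rightarrow> real^3) \<Rightarrow> bool" where
  "orientation_preserving_isometry g \<longleftrightarrow>
     bij_betw g hyp_space hyp_space \<and>
     (\<forall>x\<in>hyp_space. \<forall>y\<in>hyp_space. hdist (g x) (g y) = hdist x y) \<and>
     (\<forall>x\<in>hyp_space. \<exists>L. (g has_derivative L) (at x) \<and> det (matrix L) > 0)"

text \<open>The extension of an isometry to the sphere at infinity.\<close>

definition boundary_action :: "(real^3 \<Rightarrow> real^3) \<Rightarrow> real^3 \<Rightarrow> real^3" where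
  "boundary_action g z = Lim (at z within hyp_space) g"


section \<open>Closed hyperbolic 3-manifolds\<close>

text \<open>The fundamental group is the group of deck transformations of the universal covering
  \<open>q\<close>. As in \<^const>\<open>BijGroup\<close>, its elements are extensional functions on hyperbolic space.\<close>

definition deck_transformations :: "(real^3 \<Rightarrow> 'm) \<Rightarrow> (real^3 \<Rightarrow> real^3) set" where
  "deck_transformations q =
     {g \<in> extensional hyp_space.
        homeomorphic_map (top_of_set hyp_space) (top_of_set hyp_space) g \<and>
        (\<forall>x\<in>hyp_space. q (g x) = q x)}"

definition deck_group :: "(real^3 \<Rightarrow> 'm) \<Rightarrow> (real^3 \<Rightarrow> real^3) monoid" where
  "deck_group q = (BijGroup hyp_space) \<lparr>carrier := deck_transformations q\<rparr>"

text \<open>The hyperbolic structure on \<open>M\<close> is the one for which \<open>q\<close> is a local isometry.\<close>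

definition closed_orientable_hyperbolic_3manifold ::
    "'m::t2_space set \<Rightarrow> (real^3 \<Rightarrow> 'm) \<Rightarrow> bool" where
  "closed_orientable_hyperbolic_3manifold M q \<longleftrightarrow>
     compact M \<and> covering_space hyp_space q M \<and>
     (\<forall>g\<in>carrier (deck_group q). orientation_preserving_isometry g)"

lemma deck_transformations_Bij: "deck_transformations q \<subseteq> Bij hyp_space"
  by (auto simp: deck_transformations_def Bij_def bij_betw_def homeomorphic_eq_everything_map)

lemma group_deck_group: "group (deck_group q)"
proof -
  interpret B: group "BijGroup hyp_space"
    by (rule group_BijGroup)
  have sub: "g \<in> Bij hyp_space" if "g \<in> deck_transformations q" for g
    using that deck_transformations_Bij by blast
  have "subgroup (deck_transformations q) (BijGroup hyp_space)"
  proof (rule B.subgroupI)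
    show "deck_transformations q \<subseteq> carrier (BijGroup hyp_space)"
      using deck_transformations_Bij by (simp add: BijGroup_def)
    have "restrict (\<lambda>x. x) hyp_space \<in> deck_transformations q"
      by (auto simp: deck_transformations_def intro!: homeomorphic_map_eq [OF homeomorphic_map_id [THEN iffD2, OF refl]])
    then show "deck_transformations q \<noteq> {}"
      by blast
  next
    fix g assume g: "g \<in> deck_transformations q"
    then obtain h where h: "homeomorphic_maps (top_of_set hyp_space) (top_of_set hyp_space) g h"
      by (auto simp: deck_transformations_def homeomorphic_map_maps)
    have gB: "bij_betw g hyp_space hyp_space"
      using sub [OF g] by (simp add: Bij_def)
    have hm: "h x \<in> hyp_space" "g (h x) = x" if "x \<in> hyp_space" for x
      using h that unfolding homeomorphic_maps_def continuous_map_def by auto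
    have inv: "inv\<^bsub>BijGroup hyp_space\<^esub> g = restrict (inv_into hyp_space g) hyp_space"
      using sub [OF g] by (rule inv_BijGroup)
    have eq: "inv_into hyp_space g x = h x" if "x \<in> hyp_space" for x
      using gB hm [OF that] by (metis bij_betw_def inv_into_f_f)
    have "homeomorphic_map (top_of_set hyp_space) (top_of_set hyp_space) h"
      using h homeomorphic_maps_sym homeomorphic_map_maps by blast
    then have "homeomorphic_map (top_of_set hyp_space) (top_of_set hyp_space)
        (restrict (inv_into hyp_space g) hyp_space)"
      by (rule homeomorphic_map_eq) (simp add: eq)
    moreover have "q (h x) = q x" if "x \<in> hyp_space" for x
      using g hm [OF that] by (force simp: deck_transformations_def)
    ultimately show "inv\<^bsub>BijGroup hyp_space\<^esub> g \<in> deck_transformations q"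
      unfolding inv by (auto simp: deck_transformations_def eq simp del: mem_ball)
  next
    fix g h assume g: "g \<in> deck_transformations q" and h: "h \<in> deck_transformations q"
    have mem: "h x \<in> hyp_space" if "x \<in> hyp_space" for x
      using sub [OF h] that Bij_imp_funcset by blast
    have "homeomorphic_map (top_of_set hyp_space) (top_of_set hyp_space) (g \<circ> h)"
      using g h by (auto simp: deck_transformations_def intro: homeomorphic_map_compose)
    then have "homeomorphic_map (top_of_set hyp_space) (top_of_set hyp_space)
        (compose hyp_space g h)"
      by (rule homeomorphic_map_eq) (simp add: compose_def)
    then have "compose hyp_space g h \<in> deck_transformations q"
      using g h mem by (auto simp: deck_transformations_def compose_def simp del: mem_ball)
    then show "g \<otimes>\<^bsub>BijGroup hyp_space\<^esub> h \<in> deck_transformations q"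
      using sub [OF g] sub [OF h] by (simp add: BijGroup_def)
  qed
  then show ?thesis
    unfolding deck_group_def by (rule B.subgroup_imp_group)
qed


section \<open>Quasigeodesic flows\<close>

definition continuous_flow_on ::
    "'a::topological_space set \<Rightarrow> (real \<Rightarrow> 'a \<Rightarrow> 'a) \<Rightarrow> bool" where
  "continuous_flow_on S \<Phi> \<longleftrightarrow>
     (\<forall>t. \<forall>x\<in>S. \<Phi> t x \<in> S) \<and>
     (\<forall>x\<in>S. \<Phi> 0 x = x) \<and>
     (\<forall>s t. \<forall>x\<in>S. \<Phi> (s + t) x = \<Phi> s (\<Phi> t x)) \<and>
     continuous_on (UNIV \<times> S) (\<lambda>(t, x). \<Phi> t x)"

definition quasigeodesic :: "(real \<Rightarrow> real^3) \<Rightarrow> bool" where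
  "quasigeodesic \<gamma> \<longleftrightarrow>
     (\<exists>k>0. \<exists>\<epsilon>\<ge>0. \<forall>s t. 1 / k * hdist (\<gamma> s) (\<gamma> t) - \<epsilon> \<le> \<bar>s - t\<bar> \<and>
                          \<bar>s - t\<bar> \<le> k * hdist (\<gamma> s) (\<gamma> t) + \<epsilon>)"

definition admits_quasigeodesic_parametrization :: "(real \<Rightarrow> real^3) \<Rightarrow> bool" where
  "admits_quasigeodesic_parametrization c \<longleftrightarrow>
     (\<exists>\<sigma>::real \<Rightarrow> real. continuous_on UNIV \<sigma> \<and> strict_mono \<sigma> \<and> surj \<sigma> \<and> quasigeodesic (c \<circ> \<sigma>))"

definition quasigeodesic_flow ::
    "'m::t2_space set \<Rightarrow> (real^3 \<Rightarrow> 'm) \<Rightarrow> (real \<Rightarrow> 'm \<Rightarrow> 'm) \<Rightarrow> bool" where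
  "quasigeodesic_flow M q \<Phi> \<longleftrightarrow>
     continuous_flow_on M \<Phi> \<and>
     (\<forall>x\<in>M. \<exists>c. continuous_on UNIV c \<and> range c \<subseteq> hyp_space \<and> (\<forall>t. q (c t) = \<Phi> t x) \<and>
                admits_quasigeodesic_parametrization c)"

definition lifted_flow ::
    "(real^3 \<Rightarrow> 'm::t2_space) \<Rightarrow> (real \<Rightarrow> 'm \<Rightarrow> 'm) \<Rightarrow> (real \<Rightarrow> real^3 \<Rightarrow> real^3) \<Rightarrow> bool" where
  "lifted_flow q \<Phi> \<Psi> \<longleftrightarrow>
     continuous_flow_on hyp_space \<Psi> \<and> (\<forall>t. \<forall>x\<in>hyp_space. q (\<Psi> t x) = \<Phi> t (q x))"


section \<open>The flowspace\<close>

definition quotient_topology :: "'a topology \<Rightarrow> ('a \<Rightarrow> 'b) \<Rightarrow> 'b topology" where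
  "quotient_topology X f =
     topology (\<lambda>U. U \<subseteq> f ` topspace X \<and> openin X {x \<in> topspace X. f x \<in> U})"

lemma openin_quotient_topology:
  "openin (quotient_topology X f) U \<longleftrightarrow>
     U \<subseteq> f ` topspace X \<and> openin X {x \<in> topspace X. f x \<in> U}"
proof -
  have "istopology (\<lambda>U. U \<subseteq> f ` topspace X \<and> openin X {x \<in> topspace X. f x \<in> U})"
    unfolding istopology_def
  proof (intro conjI allI impI)
    fix S T
    assume "S \<subseteq> f ` topspace X \<and> openin X {x \<in> topspace X. f x \<in> S}"
      and "T \<subseteq> f ` topspace X \<and> openin X {x \<in> topspace X. f x \<in> T}"
    moreover have "{x \<in> topspace X. f x \<in> S \<inter> T} =
        {x \<in> topspace X. f x \<in> S} \<inter> {x \<in> topspace X. f x \<in> T}"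
      by auto
    ultimately show "S \<inter> T \<subseteq> f ` topspace X" "openin X {x \<in> topspace X. f x \<in> S \<inter> T}"
      by auto
  next
    fix K
    assume K: "\<forall>U\<in>K. U \<subseteq> f ` topspace X \<and> openin X {x \<in> topspace X. f x \<in> U}"
    then show "\<Union>K \<subseteq> f ` topspace X"
      by blast
    have "{x \<in> topspace X. f x \<in> \<Union>K} = (\<Union>U\<in>K. {x \<in> topspace X. f x \<in> U})"
      by auto
    then show "openin X {x \<in> topspace X. f x \<in> \<Union>K}"
      using K by auto
  qed
  then show ?thesis
    by (simp add: quotient_topology_def topology_inverse')
qed

lemma topspace_quotient_topology [simp]:
  "topspace (quotient_topology X f) = f ` topspace X"
proof -
  have "{x \<in> topspace X. f x \<in> f ` topspace X} = topspace X"
    by auto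
  then have "openin (quotient_topology X f) (f ` topspace X)"
    by (simp add: openin_quotient_topology)
  moreover have "topspace (quotient_topology X f) \<subseteq> f ` topspace X"
    using openin_quotient_topology [of X f] openin_topspace by blast
  ultimately show ?thesis
    by (simp add: openin_subset subset_antisym)
qed

lemma quotient_map_quotient_topology: "quotient_map X (quotient_topology X f) f"
  by (simp add: quotient_map_def openin_quotient_topology)

definition flowline :: "(real \<Rightarrow> real^3 \<Rightarrow> real^3) \<Rightarrow> real^3 \<Rightarrow> (real^3) set" where
  "flowline \<Psi> x = range (\<lambda>t. \<Psi> t x)"

text \<open>A point of the flowspace is a flowline, considered as a subset of hyperbolic space; a deck
  transformation \<open>g\<close> sends it to its image under \<open>g\<close>.\<close>

definition flowspace :: "(real \<Rightarrow> real^3 \<Rightarrow> real^3) \<Rightarrow> (real^3) set topology" where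
  "flowspace \<Psi> = quotient_topology (top_of_set hyp_space) (flowline \<Psi>)"

text \<open>\<open>endpoint at_top\<close> and \<open>endpoint at_bot\<close> are the maps from the flowspace to the sphere at
  infinity giving the positive and the negative endpoint of a flowline.\<close>

definition endpoint ::
    "real filter \<Rightarrow> (real \<Rightarrow> real^3 \<Rightarrow> real^3) \<Rightarrow> (real^3) set \<Rightarrow> real^3" where
  "endpoint F \<Psi> l = (THE z. \<forall>x\<in>l. ((\<lambda>t. \<Psi> t x) \<longlongrightarrow> z) F)"

definition distinct_endpoints :: "(real \<Rightarrow> real^3 \<Rightarrow> real^3) \<Rightarrow> bool" where
  "distinct_endpoints \<Psi> \<longleftrightarrow>
     (\<forall>x\<in>hyp_space. \<exists>a\<in>sphere_inf. \<exists>b\<in>sphere_inf. a \<noteq> b \<and>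
        ((\<lambda>t. \<Psi> t x) \<longlongrightarrow> a) at_top \<and> ((\<lambda>t. \<Psi> t x) \<longlongrightarrow> b) at_bot)"

text \<open>A homeomorphism of the plane preserves orientation iff it has local degree 1.\<close>

definition orientation_preserving_plane_homeo :: "(complex \<Rightarrow> complex) \<Rightarrow> bool" where
  "orientation_preserving_plane_homeo f \<longleftrightarrow>
     homeomorphic_map euclidean euclidean f \<and>
     (\<forall>z. \<forall>r>0. winding_number (f \<circ> circlepath z r) (f z) = 1)"

definition orientation_preserving_action_on_plane ::
    "(real^3 \<Rightarrow> 'm) \<Rightarrow> (real \<Rightarrow> real^3 \<Rightarrow> real^3) \<Rightarrow> bool" where
  "orientation_preserving_action_on_plane q \<Psi> \<longleftrightarrow>
     (\<exists>\<phi> \<psi>. homeomorphic_maps (flowspace \<Psi>) (euclidean :: complex topology) \<phi> \<psi> \<and>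
        (\<forall>g\<in>carrier (deck_group q). orientation_preserving_plane_homeo (\<phi> \<circ> image g \<circ> \<psi>)))"


section \<open>The compactified flowspace and the universal circle\<close>

definition totally_disconnectedin :: "'a topology \<Rightarrow> 'a set \<Rightarrow> bool" where
  "totally_disconnectedin X S \<longleftrightarrow>
     S \<subseteq> topspace X \<and> (\<forall>C\<subseteq>S. connectedin X C \<longrightarrow> (\<exists>x. C \<subseteq> {x}))"

text \<open>The compactified flowspace is a space \<open>D\<close> with an embedding \<open>\<iota>\<close> of the flowspace.\<close>

definition universal_circle ::
    "(real \<Rightarrow> real^3 \<Rightarrow> real^3) \<Rightarrow> 'd topology \<Rightarrow> ((real^3) set \<Rightarrow> 'd) \<Rightarrow> 'd topology" where
  "universal_circle \<Psi> D \<iota> = subtopology D (topspace D - \<iota> ` topspace (flowspace \<Psi>))"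

text \<open>\<open>A\<close> is the extended action and \<open>E\<^sub>p\<close>, \<open>E\<^sub>m\<close> are the extended endpoint maps. They are determined
  by their restrictions to the flowspace, which is dense in the Hausdorff space \<open>D\<close>.\<close>

definition compactified_flowspace ::
    "(real^3 \<Rightarrow> 'm) \<Rightarrow> (real \<Rightarrow> real^3 \<Rightarrow> real^3) \<Rightarrow> 'd topology \<Rightarrow> ((real^3) set \<Rightarrow> 'd) \<Rightarrow>
     ((real^3 \<Rightarrow> real^3) \<Rightarrow> 'd \<Rightarrow> 'd) \<Rightarrow> ('d \<Rightarrow> real^3) \<Rightarrow> ('d \<Rightarrow> real^3) \<Rightarrow> bool" where
  "compactified_flowspace q \<Psi> D \<iota> A E\<^sub>p E\<^sub>m \<longleftrightarrow>
     embedding_map (flowspace \<Psi>) D \<iota> \<and>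
     (\<exists>h. homeomorphic_map D (top_of_set (cball (0::complex) 1)) h \<and>
          h ` \<iota> ` topspace (flowspace \<Psi>) = ball 0 1) \<and>
     group_action (deck_group q) (topspace D) A \<and>
     (\<forall>g\<in>carrier (deck_group q).
        homeomorphic_map D D (A g) \<and>
        (\<forall>l\<in>topspace (flowspace \<Psi>). A g (\<iota> l) = \<iota> (g ` l))) \<and>
     continuous_map D (top_of_set sphere_inf) E\<^sub>p \<and>
     continuous_map D (top_of_set sphere_inf) E\<^sub>m \<and>
     (\<forall>l\<in>topspace (flowspace \<Psi>).
        E\<^sub>p (\<iota> l) = endpoint at_top \<Psi> l \<and> E\<^sub>m (\<iota> l) = endpoint at_bot \<Psi> l) \<and>
     (\<forall>g\<in>carrier (deck_group q). \<forall>x\<in>topspace D.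
        E\<^sub>p (A g x) = boundary_action g (E\<^sub>p x) \<and> E\<^sub>m (A g x) = boundary_action g (E\<^sub>m x)) \<and>
     (\<forall>x\<in>topspace (universal_circle \<Psi> D \<iota>). E\<^sub>p x = E\<^sub>m x) \<and>
     (\<forall>z\<in>sphere_inf.
        totally_disconnectedin D {x \<in> topspace (universal_circle \<Psi> D \<iota>). E\<^sub>p x = z} \<and>
        totally_disconnectedin D {x \<in> topspace (universal_circle \<Psi> D \<iota>). E\<^sub>m x = z})"


section \<open>Attracting and repelling fixed points\<close>

definition attracting_fixed_point :: "'a topology \<Rightarrow> ('a \<Rightarrow> 'a) \<Rightarrow> 'a \<Rightarrow> bool" where
  "attracting_fixed_point X f a \<longleftrightarrow>
     a \<in> topspace X \<and> f a = a \<and>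
     (\<exists>U. openin X U \<and> a \<in> U \<and>
        (\<forall>V. openin X V \<and> a \<in> V \<longrightarrow> (\<exists>N. \<forall>n\<ge>N. (f ^^ n) ` U \<subseteq> V)))"

definition repelling_fixed_point :: "'a topology \<Rightarrow> ('a \<Rightarrow> 'a) \<Rightarrow> 'a \<Rightarrow> bool" where
  "repelling_fixed_point X f a \<longleftrightarrow> attracting_fixed_point X (inv_into (topspace X) f) a"

end

theory Submission
  imports Defs
begin

text \<open>A nontrivial deck transformation \<open>g\<close> minimizes its displacement, by compactness of
  \<open>M\<close>, so it is loxodromic and acts on the sphere at infinity with north-south dynamics from
  \<open>r\<close> to \<open>a\<close>. On the closed disc \<open>D\<close> all fixed points of \<open>g\<close> lie on the circle
  and are sent by \<open>E\<^sub>p = E\<^sub>m\<close> to \<open>a\<close> or \<open>r\<close>. Near a fixed point over \<open>a\<close> no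
  other backward orbit can stay: inside the disc this would force both endpoints of a flowline to be
  \<open>a\<close>, and on the circle it would trap generic points, whose images under \<open>E\<^sub>p\<close> must move to
  \<open>r\<close>. Hence fixed points over \<open>a\<close> attract and those over \<open>r\<close> repel in the whole disc, and
  there are finitely many.

  It remains to see that there is just one of each, which is an index computation. Move a repelling
  fixed point to infinity, so that \<open>g\<close> becomes a homeomorphism \<open>f\<close> of the closed upper
  half-plane with attracting or repelling fixed points on the real line, and follow the argument of
  \<open>f z - z\<close> along a path from the left end of the line to the right end. It drops by \<open>pi\<close> at
  each fixed point and by \<open>pi\<close> in total.\<close>

section \<open>Continuous logarithms of a displacement\<close>

text \<open>Circle dynamics alone would allow any number of alternating attracting and repelling
  points; the absence of fixed points inside the disc excludes this. Doubling the disc explains the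
  count: for an orientation-preserving map each sink or source has index 1, and the indices add up
  to 2. The obstacle is that a fixed point attracts only topologically: \<open>f\<close> need not
  map any round half disc into itself, so the displacement cannot be compared with
  \<open>a - z\<close> by convexity. Instead an iterate traps a half disc, from which a connected
  set \<open>N\<close> mapped into itself by \<open>f\<close> is built. For \<open>z\<close> outside
  \<open>N\<close> with \<open>f z\<close> in \<open>N\<close>, the points \<open>f z\<close> and
  \<open>a\<close> are joined within \<open>N\<close>, away from \<open>z\<close>, so
  \<open>(f z - z) / (a - z)\<close> has a canonical logarithm, and the displacement turns as
  \<open>a - z\<close> does. A repelling point at infinity makes large discs trapped, which gives
  the total turn in the same way. At repelling points the inverse \<open>f'\<close> is used: as
  \<open>f' z - z\<close> is the negative of the displacement of \<open>f\<close> at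
  \<open>f' z\<close>, the drop has the same sign as at attracting points.\<close>

lemma continuous_logs_differ_by_constant:
  fixes f g :: "'a::topological_space \<Rightarrow> complex"
  assumes "connected S" "continuous_on S f" "continuous_on S g"
    and eq: "\<And>x. x \<in> S \<Longrightarrow> exp (f x) = exp (g x)" and "x \<in> S" "y \<in> S"
  shows "f x - f y = g x - g y"
proof -
  have "(\<lambda>x. f x - g x) constant_on S"
  proof (rule continuous_discrete_range_constant [OF \<open>connected S\<close>])
    show "continuous_on S (\<lambda>x. f x - g x)"
      by (intro continuous_intros assms)
    fix u assume u: "u \<in> S"
    show "\<exists>e>0. \<forall>v. v \<in> S \<and> f v - g v \<noteq> f u - g u \<longrightarrow> e \<le> norm ((f v - g v) - (f u - g u))"
    proof (intro exI [of _ "2*pi"] conjI allI impI)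
      fix v assume v: "v \<in> S \<and> f v - g v \<noteq> f u - g u"
      obtain m where m: "f u = g u + of_int (2 * m) * pi * \<i>"
        using eq [OF u] exp_eq by metis
      obtain n where n: "f v = g v + of_int (2 * n) * pi * \<i>"
        using eq v exp_eq by metis
      have "(f v - g v) - (f u - g u) = of_real (real_of_int (n - m) * (2 * pi)) * \<i>"
        by (simp add: m n algebra_simps)
      then have "norm ((f v - g v) - (f u - g u)) = \<bar>real_of_int (n - m)\<bar> * (2 * pi)"
        by (simp only: norm_mult norm_of_real norm_ii) (simp add: abs_mult)
      moreover have "n \<noteq> m"
        using v m n by auto
      then have "1 \<le> \<bar>real_of_int (n - m)\<bar>"
        by linarith
      ultimately show "2 * pi \<le> norm ((f v - g v) - (f u - g u))"
        using mult_right_mono [of 1 "\<bar>real_of_int (n - m)\<bar>" "2*pi"] by simp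
    qed simp
  qed
  then obtain c where "\<And>x. x \<in> S \<Longrightarrow> f x - g x = c"
    by (auto simp: constant_on_def)
  then show ?thesis
    using \<open>x \<in> S\<close> \<open>y \<in> S\<close> by (metis (no_types, lifting) add_diff_cancel_left' diff_add_cancel
      diff_diff_eq2)
qed

lemma continuous_on_openin_cover:
  fixes f :: "'a::t2_space \<Rightarrow> 'b::topological_space"
  assumes "\<And>x. x \<in> X \<Longrightarrow> \<exists>T. openin (top_of_set X) T \<and> x \<in> T \<and> continuous_on T f"
  shows "continuous_on X f"
  unfolding continuous_on_eq_continuous_within
proof
  fix x assume "x \<in> X"
  then obtain U where U: "open U" "x \<in> U" and f: "continuous_on (X \<inter> U) f"
    using assms by (metis openin_open Int_iff)
  have "at x within X \<inter> U = at x within X"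
    using U by (intro at_within_nhd [of x U]) auto
  moreover have "continuous (at x within X \<inter> U) f"
    using f U \<open>x \<in> X\<close> by (simp add: continuous_on_eq_continuous_within)
  ultimately show "continuous (at x within X) f"
    by (simp add: continuous_within)
qed

text \<open>The ratio has distance less than 1 from 1, hence lies in the open right half-plane,
  where the principal branch \<open>Ln\<close> is continuous.\<close>

lemma near_ratio_not_nonpos:
  fixes w z y :: complex
  assumes "norm (w - z) < norm (y - z)"
  shows "(y - w) / (y - z) \<notin> \<real>\<^sub>\<le>\<^sub>0" "(y - w) / (y - z) \<noteq> 0"
proof -
  have ne: "y - z \<noteq> 0"
    using assms norm_ge_zero [of "w - z"] by force
  have "(y - w) / (y - z) = 1 - (w - z) / (y - z)"
    using ne by (simp add: field_simps)
  moreover have "norm ((w - z) / (y - z)) < 1"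
    using assms ne by (simp add: norm_divide)
  then have "Re ((w - z) / (y - z)) < 1"
    using complex_Re_le_cmod le_less_trans by blast
  ultimately have "Re ((y - w) / (y - z)) > 0"
    by simp
  then show "(y - w) / (y - z) \<notin> \<real>\<^sub>\<le>\<^sub>0" "(y - w) / (y - z) \<noteq> 0"
    by (auto simp: complex_nonpos_Reals_iff)
qed

text \<open>A small move of \<open>z\<close> multiplies \<open>y - z\<close> by a factor near 1, so
  the existence of a logarithm is stable under such moves. It exists for \<open>z\<close> far away,
  and \<open>outside N\<close> is connected. In a bounded hole of \<open>N\<close> it may fail to
  exist.\<close>

lemma continuous_log_diff_outside:
  fixes N :: "complex set"
  assumes "compact N" "z \<in> outside N"
  obtains l where "continuous_on N l" "\<And>y. y \<in> N \<Longrightarrow> exp (l y) = y - z"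
proof -
  define P where "P \<equiv> \<lambda>z. \<exists>l. continuous_on N l \<and> (\<forall>y\<in>N. exp (l y) = y - z)"
  obtain B where B: "B > 0" "\<And>y. y \<in> N \<Longrightarrow> norm y \<le> B"
    using \<open>compact N\<close> compact_imp_bounded bounded_pos by metis
  have out: "open (outside N)" "connected (outside N)"
    by (simp_all add: assms compact_imp_closed compact_imp_bounded open_outside connected_outside)
  have "\<not> bounded (outside N)"
    by (simp add: assms(1) compact_imp_bounded unbounded_outside)
  then obtain b where b: "b \<in> outside N" "norm b > B"
    unfolding bounded_iff by (meson not_less)
  have step: "P w" if "P z'" "norm (z' - w) < e" "\<And>y. y \<in> N \<Longrightarrow> e \<le> norm (y - z')" for z' w e
  proof -
    obtain l where l: "continuous_on N l" "\<And>y. y \<in> N \<Longrightarrow> exp (l y) = y - z'"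
      using \<open>P z'\<close> by (auto simp: P_def)
    have ne: "(y - w) / (y - z') \<notin> \<real>\<^sub>\<le>\<^sub>0" "(y - w) / (y - z') \<noteq> 0" "y \<noteq> z'" if "y \<in> N" for y
    proof -
      have *: "norm (w - z') < norm (y - z')"
        using that \<open>norm (z' - w) < e\<close> \<open>\<And>y. y \<in> N \<Longrightarrow> e \<le> norm (y - z')\<close> 
        by (simp add: norm_minus_commute) (meson less_le_trans)
      show "(y - w) / (y - z') \<notin> \<real>\<^sub>\<le>\<^sub>0" "(y - w) / (y - z') \<noteq> 0"
        using near_ratio_not_nonpos [OF *] by auto
      then show "y \<noteq> z'" by auto
    qed
    have "continuous_on N (\<lambda>y. l y + Ln ((y - w) / (y - z')))"
      using ne by (intro continuous_intros l) auto
    moreover have "exp (l y + Ln ((y - w) / (y - z'))) = y - w" if "y \<in> N" for y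
      using ne [OF that] l(2) [OF that] by (simp add: exp_add)
    ultimately show ?thesis
      unfolding P_def by blast
  qed
  have "P b \<longrightarrow> P z"
  proof -
    have "P b = P z"
    proof (rule connected_equivalence_relation [OF out(2) b(1) assms(2)])
      fix c assume "c \<in> outside N"
      then obtain e where e: "e > 0" "ball c e \<subseteq> outside N"
        using out(1) open_contains_ball by blast
      have disj: "e \<le> norm (y - c)" if "y \<in> N" for y
      proof (rule ccontr)
        assume "\<not> e \<le> norm (y - c)"
        then have "y \<in> outside N"
          using e by (auto simp: dist_norm norm_minus_commute subset_iff)
        then show False
          using that outside_no_overlap by blast
      qed
      \<comment> \<open>The radius is halved so that \<open>step\<close> works in both directions:
        \<open>N\<close> has distance at least \<open>e\<close> from \<open>c\<close> and at least
        \<open>e/2\<close> from \<open>x\<close>.\<close>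
      have "P c = P x" if "x \<in> ball c (e/2)" for x
      proof -
        have n: "norm (x - c) < e/2"
          using that by (simp add: dist_norm norm_minus_commute)
        have "e/2 \<le> norm (y - x)" if "y \<in> N" for y
          using disj [OF that] n norm_triangle_ineq [of "y - x" "x - c"] by simp
        then show ?thesis
          using step [of c x e] step [of x c "e/2"] disj n e
          by (auto simp: norm_minus_commute)
      qed
      then show "\<exists>T. openin (top_of_set (outside N)) T \<and> c \<in> T \<and> (\<forall>x\<in>T. P c = P x)"
        using e
        by (intro exI [of _ "ball c (e/2)"]) (auto intro!: open_subset)
    qed auto
    then show ?thesis by simp
  qed
  moreover have "P b"
  proof -
    have ne: "(y - b) / (- b) \<notin> \<real>\<^sub>\<le>\<^sub>0" "(y - b) / (- b) \<noteq> 0" if "y \<in> N" for y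
    proof -
      have "norm (y - 0) < norm (b - 0)"
        using B(2) [OF that] b by simp
      then show "(y - b) / (- b) \<notin> \<real>\<^sub>\<le>\<^sub>0" "(y - b) / (- b) \<noteq> 0"
        using near_ratio_not_nonpos [of y 0 b]
        by (auto simp: minus_divide_left minus_divide_right)
    qed
    \<comment> \<open>As \<open>N\<close> is closer to 0 than \<open>b\<close> is,
      \<open>y - b\<close> differs from \<open>- b\<close> by a factor in the right
      half-plane.\<close>
    have "continuous_on N (\<lambda>y. Ln (- b) + Ln ((y - b) / (- b)))"
      using ne B b by (intro continuous_intros) auto
    moreover have "exp (Ln (- b) + Ln ((y - b) / (- b))) = y - b" if "y \<in> N" for y
    proof -
      have "b \<noteq> 0" using b B by auto
      then show ?thesis
        using ne [OF that] by (auto simp: exp_add)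
    qed
    ultimately show ?thesis
      unfolding P_def by blast
  qed
  ultimately show thesis
    using that unfolding P_def by blast
qed

text \<open>The logarithm of \<open>(\<phi> z - z) / (a - z)\<close> is obtained by continuing \<open>y - z\<close>
  along \<open>N\<close> from \<open>y = a\<close> to \<open>y = \<phi> z\<close>.\<close>

lemma continuous_log_displacement:
  fixes N :: "complex set"
  assumes N: "compact N" "connected N" "a \<in> N"
    and S: "S \<subseteq> outside N" "continuous_on S \<phi>" "\<phi> ` S \<subseteq> N"
  obtains M where "continuous_on S M"
    "\<And>z. z \<in> S \<Longrightarrow> exp (M z) = (\<phi> z - z) / (a - z)"
    "\<And>z l. \<lbrakk>z \<in> S; continuous_on N l; \<And>y. y \<in> N \<Longrightarrow> exp (l y) = y - z\<rbrakk>
       \<Longrightarrow> M z = l (\<phi> z) - l a"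
proof -
  have "\<forall>z. \<exists>l. z \<in> S \<longrightarrow> continuous_on N l \<and> (\<forall>y\<in>N. exp (l y) = y - z)"
    using continuous_log_diff_outside [OF N(1)] S(1) by (metis subset_iff)
  then obtain l where l: "\<And>z. z \<in> S \<Longrightarrow> continuous_on N (l z)"
      "\<And>z y. \<lbrakk>z \<in> S; y \<in> N\<rbrakk> \<Longrightarrow> exp (l z y) = y - z"
    by metis
  \<comment> \<open>The branches \<open>l z\<close> are chosen separately, with no continuity in
    \<open>z\<close>. The difference does not depend on the choice, because \<open>N\<close> is
    connected.\<close>
  define M where "M \<equiv> \<lambda>z. l z (\<phi> z) - l z a"
  have uni: "M z = k (\<phi> z) - k a"
    if "z \<in> S" "continuous_on N k" "\<And>y. y \<in> N \<Longrightarrow> exp (k y) = y - z" for z k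
    unfolding M_def
    using that l S(3) N(3)
    by (intro continuous_logs_differ_by_constant [OF N(2)]) auto
  have "exp (M z) = (\<phi> z - z) / (a - z)" if "z \<in> S" for z
    using l(2) [OF that] S(3) N(3) that by (auto simp: M_def exp_diff image_subset_iff)
  moreover have "continuous_on S M"
  proof (rule continuous_on_openin_cover)
    fix z assume z: "z \<in> S"
    have op: "open (outside N)"
      by (simp add: N compact_imp_closed open_outside)
    then obtain e where e: "e > 0" "ball z e \<subseteq> outside N"
      using z S(1) open_contains_ball by blast
    have disj: "e \<le> norm (y - z)" if "y \<in> N" for y
    proof (rule ccontr)
      assume "\<not> e \<le> norm (y - z)"
      then have "y \<in> outside N"
        using e by (auto simp: dist_norm norm_minus_commute subset_iff)
      then show False
        using that outside_no_overlap by blast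
    qed
    have ne: "(y - w) / (y - z) \<notin> \<real>\<^sub>\<le>\<^sub>0" "(y - w) / (y - z) \<noteq> 0" "y \<noteq> z"
      if "y \<in> N" "w \<in> ball z e" for y w
    proof -
      have *: "norm (w - z) < norm (y - z)"
        using that disj [OF that(1)] by (simp add: dist_norm norm_minus_commute)
      show "(y - w) / (y - z) \<notin> \<real>\<^sub>\<le>\<^sub>0" "(y - w) / (y - z) \<noteq> 0"
        using near_ratio_not_nonpos [OF *] by auto
      then show "y \<noteq> z" by auto
    qed
    have zN: "z \<notin> N"
      using disj [of z] e by auto
    \<comment> \<open>Near \<open>z\<close> a branch for \<open>w\<close> arises from the one for
      \<open>z\<close> by adding \<open>Ln\<close> of a ratio near 1, which depends continuously on
      \<open>w\<close>.\<close>
    define M' where "M' \<equiv> \<lambda>w. (l z (\<phi> w) + Ln ((\<phi> w - w) / (\<phi> w - z))) - (l z a + Ln ((a - w) / (a -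
      z)))"
    have eq: "M w = M' w" if "w \<in> S \<inter> ball z e" for w
    proof -
      have "continuous_on N (\<lambda>y. l z y + Ln ((y - w) / (y - z)))"
        using ne that zN by (intro continuous_intros l z) auto
      moreover have "exp (l z y + Ln ((y - w) / (y - z))) = y - w" if "y \<in> N" for y
        using ne [of y w] \<open>w \<in> S \<inter> ball z e\<close> l(2) [OF z that] that by (auto simp: exp_add)
      ultimately have "M w = (l z (\<phi> w) + Ln ((\<phi> w - w) / (\<phi> w - z))) - (l z a + Ln ((a - w) / (a -
        z)))"
        using that by (intro uni) auto
      then show ?thesis by (simp add: M'_def)
    qed
    have cl: "continuous_on (S \<inter> ball z e) (\<lambda>w. l z (\<phi> w))"
      by (rule continuous_on_compose2 [OF l(1) [OF z]])
         (use S in \<open>auto intro: continuous_on_subset\<close>)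
    have "continuous_on (S \<inter> ball z e) M'"
      unfolding M'_def
      using ne S N zN
      by (intro continuous_intros cl continuous_on_subset [OF S(2)]) (auto simp: image_subset_iff)
    then have "continuous_on (S \<inter> ball z e) M"
      by (rule continuous_on_eq) (simp add: eq)
    then show "\<exists>T. openin (top_of_set S) T \<and> z \<in> T \<and> continuous_on T M"
      using z e by (intro exI [of _ "S \<inter> ball z e"]) auto
  qed
  ultimately show thesis
    using that uni by blast
qed

section \<open>Turning of the displacement around a trapped disc\<close>

definition upper_half :: "complex set" where
  "upper_half = {z. 0 \<le> Im z}"

lemma upper_half_of_real [simp]: "of_real x \<in> upper_half"
  by (simp add: upper_half_def)

lemma convex_upper_half: "convex upper_half"
  by (simp add: upper_half_def convex_halfspace_Im_ge)

lemma closed_upper_half: "closed upper_half"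
  by (simp add: upper_half_def closed_halfspace_Im_ge)

text \<open>Multiplication by \<open>- \<i>\<close> turns the closed upper half-plane into the
  closed right one, so \<open>Ln (- \<i> * z)\<close> is continuous there except at 0. This branch
  serves for differences with real points.\<close>

lemma mult_ii_not_nonpos:
  assumes "z \<in> upper_half" "z \<noteq> 0"
  shows "- \<i> * z \<notin> \<real>\<^sub>\<le>\<^sub>0"
  using assms by (auto simp: complex_nonpos_Reals_iff upper_half_def complex_eq_iff)

lemma exp_Ln_add: "x \<noteq> 0 \<Longrightarrow> y \<noteq> 0 \<Longrightarrow> exp (Ln x + Ln y) = x * y"
  by (simp add: exp_add)

lemma homeomorphism_funpow:
  assumes "homeomorphism S S f f'"
  shows "homeomorphism S S (f ^^ n) (f' ^^ n)"
proof (induction n)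
  case 0
  then show ?case by (auto simp: homeomorphism_def)
next
  case (Suc n)
  have "homeomorphism S S (f \<circ> (f ^^ n)) ((f' ^^ n) \<circ> f')"
    by (rule homeomorphism_compose [OF Suc assms])
  then show ?case
    by (simp only: funpow.simps(2) flip: funpow_Suc_right)
qed

text \<open>An attracting fixed point contracts only eventually, hence the iterate \<open>m\<close>.
  The gap between the two radii leaves room for intermediate discs, and \<open>R\<close> confines
  their images under the earlier iterates.\<close>

definition disc_trapped :: "(complex \<Rightarrow> complex) \<Rightarrow> real \<Rightarrow> real \<Rightarrow> real \<Rightarrow> nat \<Rightarrow> real \<Rightarrow> bool" where
  "disc_trapped f c \<rho>\<^sub>0 \<rho>\<^sub>1 m R \<longleftrightarrow> 0 < \<rho>\<^sub>0 \<and> \<rho>\<^sub>0 < \<rho>\<^sub>1 \<and> 0 < m \<and>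
     (\<forall>z\<in>upper_half. dist (complex_of_real c) z \<le> \<rho>\<^sub>1 \<longrightarrow>
        dist (complex_of_real c) ((f ^^ m) z) < \<rho>\<^sub>0 \<and>
        (\<forall>j<m. dist (complex_of_real c) ((f ^^ j) z) < R))"

text \<open>A chain of concentric discs turns a disc trapped by an iterate of \<open>f\<close> into a connected set
  trapped by \<open>f\<close> itself. As the images of the discs share the real fixed point \<open>a\<close>, the trapped set
  meets the real line in an interval.\<close>

lemma trapped_connected_set:
  fixes f f' :: "complex \<Rightarrow> complex" and c a \<rho>\<^sub>0 \<rho>\<^sub>1 R :: real and m :: nat
  assumes hom: "homeomorphism upper_half upper_half f f'"
    and real: "\<And>z. z \<in> upper_half \<Longrightarrow> f z \<in> \<real> \<longleftrightarrow> z \<in> \<real>"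
    and dt: "disc_trapped f c \<rho>\<^sub>0 \<rho>\<^sub>1 m R"
    and a: "f (complex_of_real a) = complex_of_real a"
      "dist (complex_of_real c) (complex_of_real a) \<le> \<rho>\<^sub>0"
  obtains N I where "compact N" "connected N" "N \<subseteq> upper_half \<inter> ball (complex_of_real c) R"
    "upper_half \<inter> cball (complex_of_real c) \<rho>\<^sub>0 \<subseteq> N" "connected (N \<inter> \<real>)"
    "I \<subseteq> N" "openin (top_of_set upper_half) I" "f ` N \<subseteq> I"
proof -
  have \<rho>: "0 < \<rho>\<^sub>0" "\<rho>\<^sub>0 < \<rho>\<^sub>1" and m: "0 < m"
    and trap: "\<And>z. \<lbrakk>z \<in> upper_half; dist (complex_of_real c) z \<le> \<rho>\<^sub>1\<rbrakk>
      \<Longrightarrow> dist (complex_of_real c) ((f ^^ m) z) < \<rho>\<^sub>0"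
    and small: "\<And>z j. \<lbrakk>z \<in> upper_half; dist (complex_of_real c) z \<le> \<rho>\<^sub>1; j < m\<rbrakk>
      \<Longrightarrow> dist (complex_of_real c) ((f ^^ j) z) < R"
    using dt by (auto simp: disc_trapped_def)
  \<comment> \<open>Equally spaced radii from \<open>\<rho>\<^sub>0\<close> to
    \<open>\<rho>\<^sub>1\<close>. As they increase strictly, each closed half disc lies in the next
    relatively open one.\<close>
  define r where "r \<equiv> \<lambda>j::nat. \<rho>\<^sub>0 + of_nat j * ((\<rho>\<^sub>1 - \<rho>\<^sub>0) / of_nat m)"
  have r0: "r 0 = \<rho>\<^sub>0" and rm: "r m = \<rho>\<^sub>1"
    using m by (auto simp: r_def)
  have rS: "r j < r (Suc j)" for j
    using divide_pos_pos [of "\<rho>\<^sub>1 - \<rho>\<^sub>0" "real m"] m \<rho> by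
      (simp add: r_def distrib_right add_divide_distrib del: divide_pos_pos zero_less_divide_iff)
  then have smono: "strict_mono r"
    by (simp add: strict_mono_Suc_iff)
  have rle: "r j \<le> \<rho>\<^sub>1" "\<rho>\<^sub>0 \<le> r j" if "j \<le> m" for j
    using strict_mono_less_eq [OF smono, of j m] strict_mono_less_eq [OF smono, of 0 j] that r0 rm
    by linarith+
  define C where "C \<equiv> \<lambda>j. upper_half \<inter> cball (complex_of_real c) (r j)"
  define U where "U \<equiv> \<lambda>j. upper_half \<inter> ball (complex_of_real c) (r j)"
  \<comment> \<open>\<open>f\<close> sends the \<open>j\<close>-th piece into the open part of the
    next one, and the last piece, by way of \<open>f ^^ m\<close>, back into the open half disc of
    radius \<open>\<rho>\<^sub>0\<close>.\<close>
  define N where "N \<equiv> \<Union>j<m. (f ^^ j) ` C j"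
  define I where "I \<equiv> \<Union>j<m. (f ^^ j) ` U j"
  have homn: "homeomorphism upper_half upper_half (f ^^ j) (f' ^^ j)" for j
    by (rule homeomorphism_funpow [OF hom])
  have cont: "continuous_on upper_half (f ^^ j)" for j
    using homeomorphism_cont1 [OF homn] .
  have maps: "(f ^^ j) z \<in> upper_half" if "z \<in> upper_half" for j z
    using homeomorphism_image1 [OF homn, of j] that by (metis imageI)
  have realj: "(f ^^ j) z \<in> \<real> \<longleftrightarrow> z \<in> \<real>" if "z \<in> upper_half" for z j
    using that by (induction j) (auto simp: real maps)
  have aj: "(f ^^ j) (complex_of_real a) = complex_of_real a" for j
    by (induction j) (auto simp: a)
  have aC: "complex_of_real a \<in> C j" if "j \<le> m" for j
    using a rle [OF that] by (auto simp: C_def)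
  have comp: "compact (C j)" for j
    unfolding C_def by (intro closed_Int_compact closed_upper_half compact_cball)
  have conv: "convex (C j)" for j
    unfolding C_def by (intro convex_Int convex_upper_half convex_cball)
  have contC: "continuous_on (C j) (f ^^ j)" for j
    by (rule continuous_on_subset [OF cont]) (auto simp: C_def)
  have conn: "connected ((f ^^ j) ` C j)" for j
    by (intro connected_continuous_image contC convex_connected conv)
  have "compact N"
    unfolding N_def by (intro compact_UN compact_continuous_image contC comp) auto
  moreover have "connected N"
    unfolding N_def
  proof (rule connected_Union)
    show "connected s" if "s \<in> (\<lambda>j. (f ^^ j) ` C j) ` {..<m}" for s
      using that conn by auto
    have "complex_of_real a \<in> (f ^^ j) ` C j" if "j < m" for j
      using aC aj that by (metis image_eqI less_imp_le)
    then show "\<Inter> ((\<lambda>j. (f ^^ j) ` C j) ` {..<m}) \<noteq> {}"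
      by auto
  qed
  moreover have "N \<subseteq> upper_half \<inter> ball (complex_of_real c) R"
  proof
    fix w assume "w \<in> N"
    then obtain j z where j: "j < m" "z \<in> C j" "w = (f ^^ j) z"
      by (auto simp: N_def)
    then have "z \<in> upper_half" "dist (complex_of_real c) z \<le> \<rho>\<^sub>1"
      using rle(1) [of j] by (auto simp: C_def)
    then show "w \<in> upper_half \<inter> ball (complex_of_real c) R"
      using small maps j by auto
  qed
  moreover have "upper_half \<inter> cball (complex_of_real c) \<rho>\<^sub>0 \<subseteq> N"
  proof
    fix z assume "z \<in> upper_half \<inter> cball (complex_of_real c) \<rho>\<^sub>0"
    then have "z \<in> (f ^^ 0) ` C 0"
      by (simp add: C_def r0)
    then show "z \<in> N"
      unfolding N_def using m by blast
  qed
  moreover have "connected (N \<inter> \<real>)"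
  proof -
    have eq: "N \<inter> \<real> = (\<Union>j<m. (f ^^ j) ` (C j \<inter> \<real>))"
    proof (intro equalityI subsetI)
      fix w assume "w \<in> N \<inter> \<real>"
      then obtain j z where j: "j < m" "z \<in> C j" "w = (f ^^ j) z" "w \<in> \<real>"
        by (auto simp: N_def)
      then have "z \<in> C j \<inter> \<real>"
        using realj [of z j] by (auto simp: C_def)
      then show "w \<in> (\<Union>j<m. (f ^^ j) ` (C j \<inter> \<real>))"
        using j by blast
    next
      fix w assume "w \<in> (\<Union>j<m. (f ^^ j) ` (C j \<inter> \<real>))"
      then obtain j z where j: "j < m" "z \<in> C j" "z \<in> \<real>" "w = (f ^^ j) z"
        by auto
      then have "w \<in> \<real>"
        using realj [of z j] by (auto simp: C_def)
      then show "w \<in> N \<inter> \<real>"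
        using j unfolding N_def by blast
    qed
    have "convex (\<real> :: complex set)"
      by (simp add: convex_def complex_is_Real_iff)
    then have *: "connected ((f ^^ j) ` (C j \<inter> \<real>))" for j
      by (intro connected_continuous_image convex_connected convex_Int conv
        continuous_on_subset [OF contC]) auto
    show ?thesis
      unfolding eq
    proof (rule connected_Union)
      show "connected s" if "s \<in> (\<lambda>j. (f ^^ j) ` (C j \<inter> \<real>)) ` {..<m}" for s
        using that * by auto
      have "complex_of_real a \<in> (f ^^ j) ` (C j \<inter> \<real>)" if "j < m" for j
        using aC [of j] aj [of j] that by (intro image_eqI [of _ _ "complex_of_real a"]) auto
      then show "\<Inter> ((\<lambda>j. (f ^^ j) ` (C j \<inter> \<real>)) ` {..<m}) \<noteq> {}"
        by auto
    qed
  qed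
  moreover have "I \<subseteq> N"
  proof -
    have "U j \<subseteq> C j" for j
      by (auto simp: U_def C_def)
    then show ?thesis
      unfolding I_def N_def by blast
  qed
  moreover have "openin (top_of_set upper_half) I"
    unfolding I_def
  proof (intro openin_Union)
    fix S assume "S \<in> (\<lambda>j. (f ^^ j) ` U j) ` {..<m}"
    then show "openin (top_of_set upper_half) S"
      by (auto simp: U_def intro!: homeomorphism_imp_open_map [OF homn])
  qed
  moreover have "f ` N \<subseteq> I"
  proof clarify
    fix w assume "w \<in> N"
    then obtain j z where j: "j < m" "z \<in> C j" "w = (f ^^ j) z"
      by (auto simp: N_def)
    have zU: "z \<in> U (Suc j)"
      using j rS [of j] by (auto simp: C_def U_def)
    show "f w \<in> I"
    proof (cases "Suc j < m")
      case True
      have "f w = (f ^^ Suc j) z"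
        by (simp add: j)
      then show ?thesis
        unfolding I_def using True zU by blast
    next
      case False
      then have "Suc j = m" using j by simp
      then have "f w = (f ^^ m) z"
        using j by auto
      moreover have "dist (complex_of_real c) ((f ^^ m) z) < \<rho>\<^sub>0"
        using j rle [of j] by (intro trap) (auto simp: C_def)
      ultimately have "f w \<in> U 0"
        using maps [of z m] j by (auto simp: U_def C_def r0)
      then have "f w \<in> (f ^^ 0) ` U 0"
        by simp
      then show ?thesis
        unfolding I_def using m by blast
    qed
  qed
  ultimately show thesis
    using that by blast
qed

text \<open>The map pushes both ends of \<open>J\<close> inwards. There is no fixed point between
  \<open>x\<close> and the nearer end, so the intermediate value theorem carries the sign of the
  displacement out to \<open>x\<close>.\<close>

lemma trapped_interval_sign:
  fixes r :: "real \<Rightarrow> real"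
  assumes J: "compact J" "connected J" "a \<in> J" "J \<subseteq> {u..v}"
    and r: "continuous_on {u..v} r" and trap: "\<And>x. x \<in> J \<Longrightarrow> r x \<in> interior J"
    and fixed: "\<And>x. \<lbrakk>x \<in> {u..v}; r x = x\<rbrakk> \<Longrightarrow> x \<in> J"
    and x: "x \<in> {u..v}" "x \<notin> J"
  shows "(r x - x) / (a - x) > 0"
proof -
  have iv: "is_interval J"
    using J is_interval_connected_1 by blast
  obtain l where l: "l \<in> J" "\<And>y. y \<in> J \<Longrightarrow> l \<le> y"
    using compact_attains_inf [OF J(1)] J(3) by blast
  obtain k where k: "k \<in> J" "\<And>y. y \<in> J \<Longrightarrow> y \<le> k"
    using compact_attains_sup [OF J(1)] J(3) by blast
  have "r l \<noteq> l"
  proof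
    assume "r l = l"
    then have "l \<in> interior J" using trap l by force
    then obtain e where "e > 0" "ball l e \<subseteq> J"
      using mem_interior by blast
    then have "l - e/2 \<in> J" by (auto simp: dist_real_def subset_iff)
    then show False using l(2) [of "l - e/2"] \<open>e > 0\<close> by simp
  qed
  then have rl: "r l > l"
    using trap [OF l(1)] l(2) interior_subset [of J] by force
  have "r k \<noteq> k"
  proof
    assume "r k = k"
    then have "k \<in> interior J" using trap k by force
    then obtain e where "e > 0" "ball k e \<subseteq> J"
      using mem_interior by blast
    then have "k + e/2 \<in> J" by (auto simp: dist_real_def subset_iff)
    then show False using k(2) [of "k + e/2"] \<open>e > 0\<close> by simp
  qed
  then have rk: "r k < k"
    using trap [OF k(1)] k(2) interior_subset [of J] by force
  have cont: "continuous_on S (\<lambda>y. r y - y)" if "S \<subseteq> {u..v}" for S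
    using that by (intro continuous_intros continuous_on_subset [OF r])
  consider "x < l" | "x > k"
    using x iv l k unfolding is_interval_1 by (meson not_le)
  then show ?thesis
  proof cases
    case 1
    have "r x > x"
    proof (rule ccontr)
      assume "\<not> r x > x"
      then have "r x - x \<le> 0" "0 \<le> r l - l" "x \<le> l" using rl 1 by auto
      moreover have "continuous_on {x..l} (\<lambda>y. r y - y)"
        using x l(1) J(4) by (intro cont) auto
      ultimately obtain y where "y \<ge> x" "y \<le> l" "r y - y = 0"
        using IVT' [of "\<lambda>y. r y - y" x 0 l] by auto
      then show False
        using fixed [of y] x l J(4) rl by force
    qed
    then show ?thesis
      using 1 l(2) [OF J(3)] by simp
  next
    case 2
    have "r x < x"
    proof (rule ccontr)
      assume "\<not> r x < x"
      then have "0 \<le> r x - x" "r k - k \<le> 0" "k \<le> x" using rk 2 by auto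
      moreover have "continuous_on {k..x} (\<lambda>y. r y - y)"
        using x k(1) J(4) by (intro cont) auto
      ultimately obtain y where "y \<ge> k" "y \<le> x" "r y - y = 0"
        using IVT' [of "\<lambda>y. r y - y" k 0 x] IVT2' [of "\<lambda>y. r y - y" x 0 k] by auto
      then show False
        using fixed [of y] x k J(4) rk by force
    qed
    then show ?thesis
      using 2 k(2) [OF J(3)] by (simp add: divide_neg_neg)
  qed
qed

text \<open>The logarithm of the displacement ratio near the trapped set is cut off and extended by zero,
  so that the ratio extends to the half disc without zeros.\<close>

lemma displacement_extends_over_half_disc:
  fixes f :: "complex \<Rightarrow> complex" and c a R :: real
  assumes f: "continuous_on upper_half f" "f ` upper_half \<subseteq> upper_half"
    and real: "\<And>x. f (complex_of_real x) \<in> \<real>"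
    and N: "compact N" "connected N" "N \<subseteq> upper_half \<inter> ball (complex_of_real c) R"
      "connected (N \<inter> \<real>)"
      "complex_of_real a \<in> N"
    and I: "I \<subseteq> N" "openin (top_of_set upper_half) I" "f ` N \<subseteq> I"
    and fixed: "\<And>z. \<lbrakk>z \<in> upper_half; dist (complex_of_real c) z \<le> R; f z = z\<rbrakk> \<Longrightarrow> z \<in> N"
  obtains q where "continuous_on (upper_half \<inter> cball (complex_of_real c) R) q"
    "\<And>z. z \<in> upper_half \<inter> cball (complex_of_real c) R \<Longrightarrow> q z \<noteq> 0"
    "\<And>z. z \<in> upper_half \<inter> sphere (complex_of_real c) R \<Longrightarrow> q z = (f z - z) / (complex_of_real a - z)"
    "\<And>x. \<bar>x - c\<bar> \<le> R \<Longrightarrow> \<exists>t>0. q (complex_of_real x) = complex_of_real t"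
    "\<And>x. \<lbrakk>\<bar>x - c\<bar> \<le> R; complex_of_real x \<notin> N\<rbrakk> \<Longrightarrow> (Re (f x) - x) / (a - x) > 0"
proof -
  define r where "r \<equiv> \<lambda>x::real. Re (f (complex_of_real x))"
  have fr: "f (complex_of_real x) = complex_of_real (r x)" for x
    using real [of x] by (simp add: r_def)
  define J where "J = Re ` (N \<inter> \<real>)"
  have Jiff: "x \<in> J \<longleftrightarrow> complex_of_real x \<in> N" for x
    by (force simp: J_def Reals_def)
  have contr: "continuous_on S r" for S
    unfolding r_def by (intro continuous_intros continuous_on_compose2 [OF f(1)]) auto
  have sign: "(r x - x) / (a - x) > 0" if "\<bar>x - c\<bar> \<le> R" "complex_of_real x \<notin> N" for x
  proof (rule trapped_interval_sign [of J a "c - R" "c + R"])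
    show "compact J"
      unfolding J_def
      by (intro compact_continuous_image continuous_intros compact_Int_closed N
        closed_complex_Reals)
    show "connected J"
      unfolding J_def by (intro connected_continuous_image continuous_intros N)
    show "a \<in> J" by (simp add: Jiff N)
    show "J \<subseteq> {c - R..c + R}"
    proof
      fix x assume "x \<in> J"
      then have "dist (complex_of_real c) (complex_of_real x) < R"
        using N(3) by (auto simp: Jiff)
      then show "x \<in> {c - R..c + R}"
        by (simp add: dist_real_def) (simp add: abs_less_iff)
    qed
    show "r y \<in> interior J" if "y \<in> J" for y
    proof -
      obtain T where T: "open T" "I = upper_half \<inter> T"
        using I(2) by (auto simp: openin_open)
      have "open (complex_of_real -` T)"
        by (intro open_vimage T continuous_intros)
      moreover have "complex_of_real -` T \<subseteq> J"
        using T I(1) by (force simp: Jiff)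
      moreover have "complex_of_real (r y) \<in> T"
        using that I(3) T fr by (force simp: Jiff)
      ultimately show ?thesis
        by (metis interior_maximal subset_eq vimageI)
    qed
    show "y \<in> J" if "y \<in> {c - R..c + R}" "r y = y" for y
    proof -
      have "dist (complex_of_real c) (complex_of_real y) \<le> R"
        using that by (simp add: dist_real_def) (simp add: abs_le_iff)
      then show ?thesis
        using fixed [of "complex_of_real y"] that by (simp add: Jiff fr)
    qed
    show "x \<in> {c - R..c + R}" "x \<notin> J"
      using that by (auto simp: Jiff abs_le_iff)
  qed (rule contr)

  define X where "X = upper_half \<inter> cball (complex_of_real c) R"
  \<comment> \<open>On \<open>Op\<close> the image lies in \<open>N\<close>, so the logarithm of the
    ratio is available on the part of \<open>Op\<close> in \<open>outside N\<close>. As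
    \<open>f\<close> maps \<open>N\<close> into the relatively open set \<open>I\<close>,
    \<open>Op\<close> is a neighbourhood of \<open>N\<close>.\<close>
  define Op where "Op = {z \<in> upper_half. f z \<in> I}"
  have "openin (top_of_set upper_half) (upper_half \<inter> f -` I)"
    using continuous_openin_preimage [OF f(1) _ I(2)] f(2) by (simp add: image_subset_iff_funcset)
  moreover have "upper_half \<inter> f -` I = Op"
    by (auto simp: Op_def)
  ultimately obtain T where T: "open T" "Op = upper_half \<inter> T"
    by (auto simp: openin_open)
  have NOp: "N \<subseteq> Op"
    using N(3) I(3) by (auto simp: Op_def)
  define S where "S = Op \<inter> outside N"
  obtain M where M: "continuous_on S M"
    "\<And>z. z \<in> S \<Longrightarrow> exp (M z) = (f z - z) / (complex_of_real a - z)"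
    "\<And>z l. \<lbrakk>z \<in> S; continuous_on N l; \<And>y. y \<in> N \<Longrightarrow> exp (l y) = y - z\<rbrakk>
       \<Longrightarrow> M z = l (f z) - l a"
  proof (rule continuous_log_displacement [OF N(1,2,5)])
    show "S \<subseteq> outside N" by (simp add: S_def)
    show "continuous_on S f"
      by (rule continuous_on_subset [OF f(1)]) (auto simp: S_def Op_def)
    show "f ` S \<subseteq> N"
      using I(1) by (auto simp: S_def Op_def)
  next
    fix M assume "continuous_on S M" "\<And>z. z \<in> S \<Longrightarrow> exp (M z) = (f z - z) / (complex_of_real a - z)"
      "\<And>z l. \<lbrakk>z \<in> S; continuous_on N l; \<And>y. y \<in> N \<Longrightarrow> exp (l y) = y - z\<rbrakk>
       \<Longrightarrow> M z = l (f z) - l (complex_of_real a)"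
    then show thesis
      by (rule that)
  qed
  have Mreal: "\<exists>t. M (complex_of_real x) = complex_of_real t"
    if "complex_of_real x \<in> S" "\<bar>x - c\<bar> \<le> R" for x
  proof -
    have xN: "complex_of_real x \<notin> N"
      using that outside_no_overlap unfolding S_def by blast
    define s where "s = (r x - x) / (a - x)"
    have s: "s > 0" "a \<noteq> x"
      using sign [OF that(2) xN] by (auto simp: s_def)
    \<comment> \<open>The canonical logarithm may be computed with any branch on \<open>N\<close>.
      With this one the imaginary parts cancel, because \<open>f x - x\<close> is a positive
      multiple of \<open>a - x\<close>.\<close>
    define l where "l \<equiv> \<lambda>y. Ln (- \<i> * (y - complex_of_real x)) + Ln \<i>"
    have y: "y - complex_of_real x \<in> upper_half" "y - complex_of_real x \<noteq> 0" if "y \<in> N" for y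
      using N(3) xN that by (auto simp: upper_half_def)
    have "M x = l (f x) - l a"
    proof (rule M(3) [OF that(1)])
      show "continuous_on N l"
        unfolding l_def using mult_ii_not_nonpos [OF y] by (intro continuous_intros) auto
      show "exp (l u) = u - complex_of_real x" if "u \<in> N" for u
        unfolding l_def using y [OF that] by (subst exp_Ln_add) (auto simp: algebra_simps)
    qed
    also have "\<dots> = Ln (- \<i> * (complex_of_real (r x) - x)) - Ln (- \<i> * (complex_of_real a - x))"
      by (simp add: l_def fr)
    also have "- \<i> * (complex_of_real (r x) - x) =
      complex_of_real s * (- \<i> * (complex_of_real a - x))"
    proof -
      have "r x - x = s * (a - x)"
        using s by (simp add: s_def)
      then have "complex_of_real (r x - x) = complex_of_real (s * (a - x))"
        by simp
      then show ?thesis by simp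
    qed
    also have "Ln \<dots> = of_real (ln s) + Ln (- \<i> * (complex_of_real a - x))"
      using s by (subst Ln_times_of_real) (auto simp: Ln_of_real)
    finally show ?thesis by auto
  qed
  have "closed (- outside N)"
    using open_outside [OF compact_imp_closed [OF N(1)]] unfolding open_closed .
  \<comment> \<open>The ratio must be replaced on \<open>N\<close> together with its holes, since
    the logarithm is known only in \<open>outside N\<close>. \<open>G\<close> is the neighbourhood
    in which the replacement takes place.\<close>
  define G where "G = (Op \<union> inside N) \<inter> ball (complex_of_real c) R"
  have insN: "inside N \<subseteq> upper_half \<inter> ball (complex_of_real c) R"
  proof -
    have "- (upper_half \<inter> ball (complex_of_real c) R) \<subseteq> outside N"
      by (intro outside_subset_convex convex_Int convex_upper_half convex_ball N)
    then show ?thesis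
      using inside_Int_outside [of N] by blast
  qed
  have KG: "X \<inter> (- outside N) \<subseteq> G"
    using N(3) NOp insN by (auto simp: G_def simp flip: union_with_inside)
  obtain u :: "complex \<Rightarrow> real" where u: "continuous_on X u"
    "\<And>x. x \<in> X \<Longrightarrow> u x \<in> closed_segment 0 1"
    "\<And>x. x \<in> X \<Longrightarrow> (u x = 0 \<longleftrightarrow> x \<in> X \<inter> (- outside N))"
    "\<And>x. x \<in> X \<Longrightarrow> (u x = 1 \<longleftrightarrow> x \<in> X - G)"
  proof (rule Urysohn_local_strong [of X "X \<inter> (- outside N)" "X - G" 0 "1::real"])
    show "closedin (top_of_set X) (X \<inter> - outside N)"
      using \<open>closed (- outside N)\<close> by (rule closedin_closed_Int)
    have "open ((T \<union> inside N) \<inter> ball (complex_of_real c) R)"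
      using T N(1) by (intro open_Int open_Un open_ball open_inside) (auto simp: compact_imp_closed)
    moreover have "X - G = X \<inter> - ((T \<union> inside N) \<inter> ball (complex_of_real c) R)"
      using T(2) insN by (auto simp: X_def G_def)
    ultimately show "closedin (top_of_set X) (X - G)"
      by (metis closedin_closed_Int closed_Compl)
    show "X \<inter> - outside N \<inter> (X - G) = {}"
      using KG by auto
  qed auto
  have u01: "0 \<le> u z" "u z \<le> 1" if "z \<in> X" for z
    using u(2) [OF that] by (auto simp: closed_segment_eq_real_ivl)
  \<comment> \<open>The cut-off is 0 up to 1/3 and 1 from 2/3 on. So \<open>q\<close> is 1 where
    \<open>u < 1/3\<close> and equals \<open>p\<close> where \<open>u > 2/3\<close>, and these two
    regions together with \<open>0 < u < 1\<close> form a relatively open cover.\<close>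
  define \<kappa> where "\<kappa> \<equiv> \<lambda>t::real. min 1 (max 0 (3 * t - 1))"
  define p where "p \<equiv> \<lambda>z. (f z - z) / (complex_of_real a - z)"
  define q where "q \<equiv> \<lambda>z. if u z = 0 then 1 else if u z = 1 then p z else
    exp (of_real (\<kappa> (u z)) * M z)"
  have inS: "z \<in> S" if "z \<in> X" "u z \<noteq> 0" "u z \<noteq> 1" for z
  proof -
    have "z \<in> G" "z \<in> outside N"
      using that u(3) [of z] u(4) [of z] by auto
    then show ?thesis
      using inside_Int_outside [of N] unfolding S_def G_def by blast
  qed
  have notN: "z \<notin> N" if "z \<in> X" "u z \<noteq> 0" for z
  proof -
    have "z \<in> outside N" using that u(3) by auto
    then show ?thesis using outside_no_overlap by blast
  qed
  have q1: "q z = 1" if "z \<in> X" "u z < 1/3" for z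
    using that u01 [of z] by (simp add: q_def \<kappa>_def)
  have q2: "q z = exp (of_real (\<kappa> (u z)) * M z)" if "z \<in> X" "0 < u z" "u z < 1" for z
    using that by (simp add: q_def)
  have q3: "q z = p z" if "z \<in> X" "2/3 < u z" for z
    using that M(2) [OF inS [of z]] by (auto simp: q_def \<kappa>_def p_def)
  have pnz: "p z \<noteq> 0" "complex_of_real a - z \<noteq> 0" if "z \<in> X" "2/3 < u z" for z
  proof -
    have "z \<notin> N" using notN [of z] that by simp
    then show "complex_of_real a - z \<noteq> 0" using N(5) by auto
    moreover have "f z \<noteq> z"
      using fixed [of z] \<open>z \<notin> N\<close> that by (auto simp: X_def)
    ultimately show "p z \<noteq> 0"
      by (simp add: p_def)
  qed
  have op: "openin (top_of_set X) {z \<in> X. u z \<in> V}" if "open V" for V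
    using continuous_openin_preimage_gen [OF u(1) that] by (simp add: vimage_def Int_def)
  have contq: "continuous_on X q"
  proof (rule continuous_on_openin_cover)
    fix z assume z: "z \<in> X"
    consider "u z < 1/3" | "0 < u z" "u z < 1" | "2/3 < u z" by linarith
    then show "\<exists>T. openin (top_of_set X) T \<and> z \<in> T \<and> continuous_on T q"
    proof cases
      case 1
      have "continuous_on {z \<in> X. u z \<in> {..<1/3}} q"
        by (rule continuous_on_eq [of _ "\<lambda>_. 1"]) (auto simp: q1)
      then show ?thesis
        using 1 z op [of "{..<1/3}"] by (intro exI [of _ "{z \<in> X. u z \<in> {..<1/3}}"]) auto
    next
      case 2
      have "continuous_on {z \<in> X. u z \<in> {0<..<1}} (\<lambda>z. exp (of_real (\<kappa> (u z)) * M z))"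
        unfolding \<kappa>_def
        by (intro continuous_intros continuous_on_subset [OF u(1)] continuous_on_subset [OF M(1)])
          (auto intro: inS)
      then have "continuous_on {z \<in> X. u z \<in> {0<..<1}} q"
        by (rule continuous_on_eq) (auto simp: q2)
      then show ?thesis
        using 2 z op [of "{0<..<1}"] by (intro exI [of _ "{z \<in> X. u z \<in> {0<..<1}}"]) auto
    next
      case 3
      have "continuous_on {z \<in> X. u z \<in> {2/3<..}} p"
        unfolding p_def using pnz(2)
        by (intro continuous_intros continuous_on_subset [OF f(1)]) (auto simp: X_def)
      then have "continuous_on {z \<in> X. u z \<in> {2/3<..}} q"
        by (rule continuous_on_eq) (auto simp: q3)
      then show ?thesis
        using 3 z op [of "{2/3<..}"] by (intro exI [of _ "{z \<in> X. u z \<in> {2/3<..}}"]) auto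
    qed
  qed
  have "q z \<noteq> 0" if "z \<in> X" for z
    using that q1 [of z] q2 [of z] q3 [of z] pnz [of z]
    by (cases "u z < 1/3"; cases "2/3 < u z") auto
  moreover have "q z = (f z - z) / (complex_of_real a - z)"
    if "z \<in> upper_half \<inter> sphere (complex_of_real c) R" for z
  proof -
    have z: "z \<in> X" "z \<notin> G"
      using that by (auto simp: X_def G_def)
    then have "u z = 1"
      using u(4) by blast
    then show ?thesis
      using q3 [OF z(1)] by (simp add: p_def)
  qed
  moreover have "\<exists>t>0. q (complex_of_real x) = complex_of_real t" if "\<bar>x - c\<bar> \<le> R" for x
  proof -
    let ?x = "complex_of_real x"
    have x: "?x \<in> X"
      using that by (simp add: X_def dist_real_def abs_minus_commute flip: of_real_diff)
    consider "u ?x < 1/3" | "0 < u ?x" "u ?x < 1" | "2/3 < u ?x" by linarith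
    then show ?thesis
    proof cases
      case 1
      then show ?thesis
        using q1 [OF x] by (intro exI [of _ 1]) auto
    next
      case 2
      then have "?x \<in> S" using inS [OF x] by auto
      then obtain t where "M ?x = complex_of_real t"
        using Mreal [OF _ \<open>\<bar>x - c\<bar> \<le> R\<close>] by blast
      then have "q ?x = complex_of_real (exp (\<kappa> (u ?x) * t))"
        using q2 [OF x 2] by (simp flip: exp_of_real)
      then show ?thesis
        by (intro exI [of _ "exp (\<kappa> (u ?x) * t)"]) auto
    next
      case 3
      then have "q ?x = complex_of_real ((r x - x) / (a - x))"
        using q3 [OF x] by (simp add: p_def fr)
      moreover have "?x \<notin> N" using notN [OF x] 3 by auto
      ultimately show ?thesis
        using sign [OF \<open>\<bar>x - c\<bar> \<le> R\<close>] by blast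
    qed
  qed
  moreover have "(Re (f x) - x) / (a - x) > 0" if "\<bar>x - c\<bar> \<le> R" "complex_of_real x \<notin> N" for x
    using sign [OF that] by (simp add: r_def)
  ultimately show thesis
    using that [of q] contq unfolding X_def by blast
qed

lemma connected_half_circle:
  assumes "R > 0"
  shows "connected (upper_half \<inter> sphere (complex_of_real c) R)"
proof -
  have eq: "upper_half \<inter> sphere (complex_of_real c) R = (\<lambda>t. c + R * cis t) ` {0..pi}"
  proof (intro equalityI subsetI)
    fix z assume "z \<in> upper_half \<inter> sphere (complex_of_real c) R"
    then have z: "Im (z - c) \<ge> 0" "norm (z - c) = R"
      by (auto simp: upper_half_def dist_norm norm_minus_commute)
    then have "0 \<le> Arg (z - c)" "Arg (z - c) \<le> pi"
      using Arg_le_pi assms by (auto simp: Arg_less_0)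
    moreover have "z = c + R * cis (Arg (z - c))"
      using z assms rcis_cmod_Arg [of "z - c"] by (simp add: rcis_def)
    ultimately show "z \<in> (\<lambda>t. c + R * cis t) ` {0..pi}"
      by auto
  next
    fix z assume "z \<in> (\<lambda>t. c + R * cis t) ` {0..pi}"
    then show "z \<in> upper_half \<inter> sphere (complex_of_real c) R"
      using assms by (auto simp: upper_half_def dist_norm norm_mult sin_ge_zero)
  qed
  show ?thesis
    unfolding eq by (intro connected_continuous_image continuous_intros) auto
qed

text \<open>The quotient of the displacement by \<open>a - z\<close> extends over the half disc
  without zeros and is positive on the diameter, so its argument is the same at both ends. Hence the
  displacement turns as \<open>a - z\<close> does, which goes from a positive value through the
  lower half-plane to a negative one. The second conclusion later tells a sink from a
  source.\<close>

lemma displacement_turn_around_trapped_disc: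
  fixes f f' :: "complex \<Rightarrow> complex" and c a \<rho>\<^sub>0 \<rho>\<^sub>1 R :: real and m :: nat
  assumes hom: "homeomorphism upper_half upper_half f f'"
    and real: "\<And>z. z \<in> upper_half \<Longrightarrow> f z \<in> \<real> \<longleftrightarrow> z \<in> \<real>"
    and dt: "disc_trapped f c \<rho>\<^sub>0 \<rho>\<^sub>1 m R"
    and a: "f (complex_of_real a) = complex_of_real a"
      "dist (complex_of_real c) (complex_of_real a) \<le> \<rho>\<^sub>0"
    and fixed: "\<And>z. \<lbrakk>z \<in> upper_half; dist (complex_of_real c) z \<le> R; f z = z\<rbrakk>
      \<Longrightarrow> dist (complex_of_real c) z \<le> \<rho>\<^sub>0"
    and L: "continuous_on (upper_half \<inter> sphere (complex_of_real c) R) L"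
      "\<And>z. z \<in> upper_half \<inter> sphere (complex_of_real c) R \<Longrightarrow> exp (L z) = f z - z"
  shows "Im (L (complex_of_real (c + R))) - Im (L (complex_of_real (c - R))) = - pi \<and>
    Re (f (complex_of_real (c - R))) > c - R"
proof -
  obtain N I where N: "compact N" "connected N" "N \<subseteq> upper_half \<inter> ball (complex_of_real c) R"
      "upper_half \<inter> cball (complex_of_real c) \<rho>\<^sub>0 \<subseteq> N" "connected (N \<inter> \<real>)"
      and I: "I \<subseteq> N" "openin (top_of_set upper_half) I" "f ` N \<subseteq> I"
    by (rule trapped_connected_set [OF hom real dt a]) auto
  have aN: "complex_of_real a \<in> N"
    using N(4) a by auto
  have aR: "\<bar>a - c\<bar> < R"
  proof -
    have "dist (complex_of_real c) (complex_of_real a) < R"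
      using aN N(3) by auto
    then show ?thesis by (simp add: dist_real_def abs_minus_commute)
  qed
  then have R: "R > 0" by linarith
  have f: "continuous_on upper_half f" "f ` upper_half \<subseteq> upper_half"
    using hom by (auto simp: homeomorphism_def)
  have fr: "f (complex_of_real x) \<in> \<real>" for x
    by (simp add: real)
  have fx: "z \<in> N" if "z \<in> upper_half" "dist (complex_of_real c) z \<le> R" "f z = z" for z
    using fixed [OF that] N(4) that by auto
  obtain q where q: "continuous_on (upper_half \<inter> cball (complex_of_real c) R) q"
    "\<And>z. z \<in> upper_half \<inter> cball (complex_of_real c) R \<Longrightarrow> q z \<noteq> 0"
    "\<And>z. z \<in> upper_half \<inter> sphere (complex_of_real c) R \<Longrightarrow> q z = (f z - z) / (complex_of_real a - z)"
    and qr: "\<And>x. \<bar>x - c\<bar> \<le> R \<Longrightarrow> \<exists>t>0. q (complex_of_real x) = complex_of_real t"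
    and sgn: "\<And>x. \<lbrakk>\<bar>x - c\<bar> \<le> R; complex_of_real x \<notin> N\<rbrakk> \<Longrightarrow> (Re (f x) - x) / (a - x) > 0"
    by (rule displacement_extends_over_half_disc [OF f fr N(1,2,3,5) aN I fx]) auto
  have "complex_of_real (c - R) \<notin> N"
    using N(3) R by (auto simp: dist_norm)
  then have "(Re (f (c - R)) - (c - R)) / (a - (c - R)) > 0"
    using R by (intro sgn) auto
  then have right: "Re (f (complex_of_real (c - R))) > c - R"
    using aR by (auto simp: zero_less_divide_iff)
  have "convex (upper_half \<inter> cball (complex_of_real c) R)"
    by (intro convex_Int convex_upper_half convex_cball)
  then obtain Q where Q: "continuous_on (upper_half \<inter> cball (complex_of_real c) R) Q"
      "\<And>z. z \<in> upper_half \<inter> cball (complex_of_real c) R \<Longrightarrow> q z = exp (Q z)"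
    using continuous_logarithm_on_contractible [OF q(1) _ q(2)] convex_imp_contractible by blast
  let ?u = "complex_of_real (c - R)" and ?v = "complex_of_real (c + R)"
  have mem: "complex_of_real x \<in> upper_half \<inter> cball (complex_of_real c) R" if "x \<in> {c - R..c + R}"
    for x
  proof -
    have "dist c x \<le> R"
      using that by (auto simp: dist_real_def)
    then show ?thesis by simp
  qed
  \<comment> \<open>On the diameter \<open>q\<close> is positive, so \<open>Q\<close> differs from a
    real logarithm by a constant.\<close>
  have Qreal: "Im (Q ?v) = Im (Q ?u)"
  proof -
    have contQ: "continuous_on {c - R..c + R} (\<lambda>x. Q (complex_of_real x))"
      by (rule continuous_on_compose2 [OF Q(1)]) (use mem in \<open>auto intro!: continuous_intros\<close>)
    have contq: "continuous_on {c - R..c + R} (\<lambda>x. q (complex_of_real x))"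
      by (rule continuous_on_compose2 [OF q(1)]) (use mem in \<open>auto intro!: continuous_intros\<close>)
    have pos: "Re (q (complex_of_real x)) > 0"
      "q (complex_of_real x) = complex_of_real (Re (q (complex_of_real x)))"
      if "x \<in> {c - R..c + R}" for x
    proof -
      have "\<bar>x - c\<bar> \<le> R" using that by auto
      then show "Re (q (complex_of_real x)) > 0"
        "q (complex_of_real x) = complex_of_real (Re (q (complex_of_real x)))"
        using qr [of x] by auto
    qed
    have "Q (complex_of_real (c + R)) - Q (complex_of_real (c - R)) =
          complex_of_real (ln (Re (q ?v))) - complex_of_real (ln (Re (q ?u)))"
    proof (rule continuous_logs_differ_by_constant [of "{c - R..c + R}"])
      show "continuous_on {c - R..c + R} (\<lambda>x. complex_of_real (ln (Re (q (complex_of_real x)))))"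
        using pos(1) by (intro continuous_intros contq) force
      show "exp (Q (complex_of_real x)) = exp (complex_of_real (ln (Re (q (complex_of_real x)))))"
        if "x \<in> {c - R..c + R}" for x
        using pos [OF that] Q(2) [OF mem [OF that]] by (simp add: exp_of_real)
    qed (use R contQ in auto)
    then have "Im (Q ?v - Q ?u) = 0"
      by (simp only: minus_complex.sel Im_complex_of_real)
    then show ?thesis by simp
  qed
  let ?A = "upper_half \<inter> sphere (complex_of_real c) R"
  have ne: "- \<i> * (z - complex_of_real a) \<notin> \<real>\<^sub>\<le>\<^sub>0" "z \<noteq> complex_of_real a" if "z \<in> ?A" for z
  proof -
    show "z \<noteq> complex_of_real a"
      using that aN N(3) by auto
    then show "- \<i> * (z - complex_of_real a) \<notin> \<real>\<^sub>\<le>\<^sub>0"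
      using that by (intro mult_ii_not_nonpos) (auto simp: upper_half_def)
  qed
  have uv: "?u \<in> ?A" "?v \<in> ?A"
    using R by (auto simp: dist_norm upper_half_def)
  \<comment> \<open>\<open>Ln (- \<i> * (z - a)) + Ln (- \<i>)\<close> is a logarithm of
    \<open>a - z\<close> that is continuous along the half circle.\<close>
  have "L ?v - L ?u = (Q ?v + (Ln (- \<i> * (?v - a)) + Ln (- \<i>))) - (Q ?u + (Ln (- \<i> * (?u - a)) +
    Ln (- \<i>)))"
  proof (rule continuous_logs_differ_by_constant [OF connected_half_circle [OF R] L(1)])
    show "continuous_on ?A (\<lambda>z. Q z + (Ln (- \<i> * (z - a)) + Ln (- \<i>)))"
      using ne(1) by (intro continuous_intros continuous_on_subset [OF Q(1)]) auto
    show "exp (L z) = exp (Q z + (Ln (- \<i> * (z - a)) + Ln (- \<i>)))" if z: "z \<in> ?A" for z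
    proof -
      have "exp (Q z) = (f z - z) / (complex_of_real a - z)"
        using Q(2) [of z] q(3) [OF z] z by auto
      moreover have "exp (Ln (- \<i> * (z - a)) + Ln (- \<i>)) = complex_of_real a - z"
        using ne(2) [OF z] by (subst exp_Ln_add) (auto simp: algebra_simps)
      ultimately show ?thesis
        using L(2) [OF z] ne(2) [OF z] by (simp add: exp_add)
    qed
  qed (use uv in auto)
  then have "Im (L ?v) - Im (L ?u) = Im (Ln (- \<i> * (?v - a))) - Im (Ln (- \<i> * (?u - a)))"
    using Qreal by (simp add: complex_eq_iff)
  moreover have "Ln (- \<i> * (?v - a)) = of_real (ln (c + R - a)) + Ln (- \<i>)"
  proof -
    have "- \<i> * (?v - a) = complex_of_real (c + R - a) * (- \<i>)"
      by (simp add: algebra_simps)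
    then show ?thesis
      using aR by (simp only:, subst Ln_times_of_real)
        (auto simp: Ln_of_real simp del: of_real_add of_real_diff)
  qed
  moreover have "Ln (- \<i> * (?u - a)) = of_real (ln (a - (c - R))) + Ln \<i>"
  proof -
    have "- \<i> * (?u - a) = complex_of_real (a - (c - R)) * \<i>"
      by (simp add: algebra_simps)
    then show ?thesis
      using aR by (simp only:, subst Ln_times_of_real)
        (auto simp: Ln_of_real simp del: of_real_add of_real_diff)
  qed
  ultimately have "Im (L ?v) - Im (L ?u) = - pi"
    by simp
  then show ?thesis
    using right by blast
qed

section \<open>Fixed points of homeomorphisms of the half-plane\<close>

text \<open>Induction on the number of points of \<open>F\<close> in the interval, splitting off the
  largest one.\<close>

lemma sum_of_jumps:
  fixes \<theta> :: "real \<Rightarrow> real"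
  assumes "finite F"
    and const: "\<And>u v. \<lbrakk>u \<le> v; {u..v} \<inter> F = {}\<rbrakk> \<Longrightarrow> \<theta> u = \<theta> v"
    and jump: "\<And>x. x \<in> F \<Longrightarrow> \<exists>\<delta>>0. {x - \<delta>..x + \<delta>} \<inter> F = {x} \<and> \<theta> (x + \<delta>) - \<theta> (x - \<delta>) = k"
    and "u \<le> v" "u \<notin> F" "v \<notin> F"
  shows "\<theta> v - \<theta> u = of_nat (card (F \<inter> {u..v})) * k"
  using assms(4-)
proof (induction "card (F \<inter> {u..v})" arbitrary: v)
  case 0
  then have "{u..v} \<inter> F = {}"
    using \<open>finite F\<close> by auto
  then show ?case
    using const 0 by auto
next
  case (Suc n)
  have fin: "finite (F \<inter> {u..v})"
    using \<open>finite F\<close> by auto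
  have ne: "F \<inter> {u..v} \<noteq> {}"
    using Suc(2) by force
  define m where "m = Max (F \<inter> {u..v})"
  have m: "m \<in> F" "u \<le> m" "m \<le> v"
    using Max_in [OF fin ne] by (auto simp: m_def)
  have mmax: "y \<le> m" if "y \<in> F" "u \<le> y" "y \<le> v" for y
    unfolding m_def using that fin by (intro Max_ge) auto
  have mlt: "u < m" "m < v"
  proof -
    have "u \<noteq> m" "v \<noteq> m"
      using m(1) Suc.prems by auto
    then show "u < m" "m < v"
      using m by linarith+
  qed
  obtain \<delta> where \<delta>: "\<delta> > 0" "{m - \<delta>..m + \<delta>} \<inter> F = {m}" "\<theta> (m + \<delta>) - \<theta> (m - \<delta>) = k"
    using jump [OF m(1)] by blast
  have iso: "y = m" if "y \<in> F" "m - \<delta> \<le> y" "y \<le> m + \<delta>" for y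
  proof -
    have "y \<in> {m - \<delta>..m + \<delta>} \<inter> F" using that by simp
    then show ?thesis unfolding \<delta>(2) by simp
  qed
  \<comment> \<open>The isolating interval of \<open>m\<close> may stick out of the interval from
    \<open>u\<close> to \<open>v\<close>; its left end is cut off at \<open>u\<close> without
    changing \<open>\<theta>\<close>.\<close>
  define w where "w = max u (m - \<delta>)"
  have w: "u \<le> w" "w < m" "w \<notin> F"
    using mlt \<delta>(1) iso [of "m - \<delta>"] Suc.prems by (auto simp: w_def max_def)
  have "\<theta> (m - \<delta>) = \<theta> w"
    using w iso by (intro const) (force simp: w_def)+
  have "F \<inter> {u..v} = insert m (F \<inter> {u..w})"
  proof (intro equalityI subsetI)
    fix y assume y: "y \<in> F \<inter> {u..v}"
    show "y \<in> insert m (F \<inter> {u..w})"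
      using mmax [of y] iso [of y] y \<delta>(1) by (force simp: w_def)
  qed (use m w in auto)
  then have card: "card (F \<inter> {u..v}) = Suc (card (F \<inter> {u..w}))"
    using w \<open>finite F\<close> by auto
  then have "\<theta> w - \<theta> u = of_nat (card (F \<inter> {u..w})) * k"
    using Suc w by auto
  moreover have "\<theta> v = \<theta> (m + \<delta>)"
  proof (cases "v \<le> m + \<delta>")
    case True
    then show ?thesis
      using mlt iso \<delta>(1) by (intro const) force+
  next
    case False
    have "\<theta> (m + \<delta>) = \<theta> v"
    proof (rule const)
      show "{m + \<delta>..v} \<inter> F = {}"
        using False mmax \<delta>(1) m by force
    qed (use False in auto)
    then show ?thesis by simp
  qed
  ultimately show ?case
    using \<delta>(3) \<open>\<theta> (m - \<delta>) = \<theta> w\<close> card by (simp add: algebra_simps)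
qed

lemma disc_trapped_mono: "disc_trapped f c \<rho>\<^sub>0 \<rho>\<^sub>1 m R \<Longrightarrow> R \<le> R' \<Longrightarrow> disc_trapped f c \<rho>\<^sub>0 \<rho>\<^sub>1 m R'"
  unfolding disc_trapped_def by (meson less_le_trans)

text \<open>Trapping at every scale, so that the turn can be computed on a half circle of any radius
  that isolates the fixed point.\<close>

definition attracts_discs :: "(complex \<Rightarrow> complex) \<Rightarrow> real \<Rightarrow> bool" where
  "attracts_discs f c \<longleftrightarrow> (\<forall>R>0. \<exists>\<rho>\<^sub>0 \<rho>\<^sub>1 m. disc_trapped f c \<rho>\<^sub>0 \<rho>\<^sub>1 m R)"

text \<open>The hypotheses \<open>inf\<close> say that infinity repels. For an increasing map of the
  line, the drops at the fixed points must add up to the single drop along a large half circle. This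
  count does not distinguish sinks from sources, which the second conclusion does.\<close>

theorem half_plane_unique_fixed_point:
  fixes f f' :: "complex \<Rightarrow> complex"
  assumes hom: "homeomorphism upper_half upper_half f f'"
    and real: "\<And>z. z \<in> upper_half \<Longrightarrow> f z \<in> \<real> \<longleftrightarrow> z \<in> \<real>"
    and fin: "finite {x. f (complex_of_real x) = complex_of_real x}"
    and fixr: "\<And>z. \<lbrakk>z \<in> upper_half; f z = z\<rbrakk> \<Longrightarrow> z \<in> \<real>"
    and loc: "\<And>x. f (complex_of_real x) = complex_of_real x \<Longrightarrow> attracts_discs f x \<or>
      attracts_discs f' x"
    and inf: "disc_trapped f 0 \<rho>\<^sub>0 \<rho>\<^sub>1 m R" "\<And>z. \<lbrakk>z \<in> upper_half; f z = z\<rbrakk> \<Longrightarrow> norm z \<le> \<rho>\<^sub>0"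
  shows "\<exists>x. {z \<in> upper_half. f z = z} = {complex_of_real x} \<and> \<not> attracts_discs f' x"
proof -
  define F where "F = {x. f (complex_of_real x) = complex_of_real x}"
  have Fiff: "z \<in> complex_of_real ` F" if "z \<in> upper_half" "f z = z" for z
    using fixr [OF that] that by (auto simp: F_def Reals_def)
  have f: "continuous_on upper_half f" "\<And>z. z \<in> upper_half \<Longrightarrow> f z \<in> upper_half"
    and f': "continuous_on upper_half f'" "\<And>z. z \<in> upper_half \<Longrightarrow> f' z \<in> upper_half"
    and inv: "\<And>z. z \<in> upper_half \<Longrightarrow> f' (f z) = z" "\<And>z. z \<in> upper_half \<Longrightarrow> f (f' z) = z"
    using hom by (auto simp: homeomorphism_def)
  have hom': "homeomorphism upper_half upper_half f' f"
    using hom homeomorphism_sym by blast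
  have real': "f' z \<in> \<real> \<longleftrightarrow> z \<in> \<real>" if "z \<in> upper_half" for z
    using real [OF f'(2) [OF that]] inv(2) [OF that] by simp
  define r where "r \<equiv> \<lambda>x::real. Re (f (complex_of_real x))"
  define r' where "r' \<equiv> \<lambda>x::real. Re (f' (complex_of_real x))"
  have fr: "f (complex_of_real x) = complex_of_real (r x)" for x
    using real [of "complex_of_real x"] by (simp add: r_def)
  have fr': "f' (complex_of_real x) = complex_of_real (r' x)" for x
    using real' [of "complex_of_real x"] by (simp add: r'_def)
  have rr': "r (r' x) = x" "r' (r x) = x" for x
    using inv [of "complex_of_real x"] by (simp_all add: fr fr')
  have F: "x \<in> F \<longleftrightarrow> r x = x" for x
    by (simp add: F_def fr)
  have F': "x \<in> F \<longleftrightarrow> r' x = x" for x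
    using F rr' by metis
  have contr: "continuous_on S r" for S
    unfolding r_def by (intro continuous_intros continuous_on_compose2 [OF f(1)]) auto

  \<comment> \<open>A global logarithm of the displacement\<close>
  define \<Omega> where "\<Omega> = upper_half - complex_of_real ` F"
  \<comment> \<open>A segment from \<open>\<i>\<close> to a point of the half-plane meets the real
    line at most at its end. So the punctures do not spoil contractibility, and one logarithm serves
    for all of \<open>\<Omega>\<close>.\<close>
  have "starlike \<Omega>"
    unfolding starlike_def
  proof (intro bexI ballI)
    show i: "\<i> \<in> \<Omega>"
      by (auto simp: \<Omega>_def upper_half_def complex_eq_iff)
    fix z assume z: "z \<in> \<Omega>"
    show "closed_segment \<i> z \<subseteq> \<Omega>"
    proof
      fix w assume w: "w \<in> closed_segment \<i> z"
      then obtain u where u: "0 \<le> u" "u \<le> 1" "w = (1 - u) *\<^sub>R \<i> + u *\<^sub>R z"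
        by (auto simp: closed_segment_def)
      have "w \<in> upper_half"
        using z i w closed_segment_subset [OF _ _ convex_upper_half] by (auto simp: \<Omega>_def)
      moreover have "w \<notin> complex_of_real ` F"
      proof (cases "u = 1")
        case True
        then show ?thesis using u z by (simp add: \<Omega>_def)
      next
        case False
        have "0 < Im w"
          using u z False by (auto simp: \<Omega>_def upper_half_def intro!: add_pos_nonneg)
        then show ?thesis by auto
      qed
      ultimately show "w \<in> \<Omega>"
        by (simp add: \<Omega>_def)
    qed
  qed
  then have "contractible \<Omega>"
    by (rule starlike_imp_contractible)
  moreover have "continuous_on \<Omega> (\<lambda>z. f z - z)"
    by (intro continuous_intros continuous_on_subset [OF f(1)]) (auto simp: \<Omega>_def)
  moreover have "f z - z \<noteq> 0" if "z \<in> \<Omega>" for z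
    using that Fiff by (auto simp: \<Omega>_def)
  ultimately obtain L where L: "continuous_on \<Omega> L" "\<And>z. z \<in> \<Omega> \<Longrightarrow> f z - z = exp (L z)"
    using continuous_logarithm_on_contractible by blast
  define \<theta> where "\<theta> \<equiv> \<lambda>x. Im (L (complex_of_real x))"
  have const: "\<theta> u = \<theta> v" if "u \<le> v" "{u..v} \<inter> F = {}" for u v
  proof -
    have mem: "complex_of_real x \<in> \<Omega>" "r x \<noteq> x" if "x \<in> {u..v}" for x
      using that \<open>{u..v} \<inter> F = {}\<close> by (auto simp: \<Omega>_def F)
    \<comment> \<open>The displacement is real and nonzero here, but of either sign. Squaring makes
      it positive, so it is \<open>2 * L\<close> that differs from a real logarithm by a
      constant.\<close>
    let ?l = "\<lambda>x. complex_of_real (2 * ln \<bar>r x - x\<bar>)"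
    have "2 * L (complex_of_real u) - 2 * L (complex_of_real v) = ?l u - ?l v"
    proof (rule continuous_logs_differ_by_constant [of "{u..v}"])
      show "continuous_on {u..v} (\<lambda>x. 2 * L (complex_of_real x))"
        using mem by (intro continuous_intros continuous_on_compose2 [OF L(1)]) auto
      show "continuous_on {u..v} ?l"
        using mem by (intro continuous_intros contr) auto
      show "exp (2 * L (complex_of_real x)) = exp (?l x)" if "x \<in> {u..v}" for x
      proof -
        have "exp (2 * L (complex_of_real x)) = (f (complex_of_real x) - complex_of_real x)\<^sup>2"
          using L(2) [OF mem(1) [OF that]] by (simp add: exp_double)
        also have "\<dots> = complex_of_real (\<bar>r x - x\<bar>\<^sup>2)"
          by (simp add: fr)
        also have "\<bar>r x - x\<bar>\<^sup>2 = exp (2 * ln \<bar>r x - x\<bar>)"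
          using mem(2) [OF that] by (simp add: exp_double)
        finally show ?thesis
          by (simp only: exp_of_real)
      qed
    qed (use that in auto)
    then have "Im (2 * L (complex_of_real u) - 2 * L (complex_of_real v)) = 0"
      by (simp only: minus_complex.sel Im_complex_of_real)
    then show ?thesis
      by (simp add: \<theta>_def)
  qed

  \<comment> \<open>Existence of a fixed point and the total turn\<close>
  have trap\<rho>: "0 < \<rho>\<^sub>0" "\<rho>\<^sub>0 < \<rho>\<^sub>1" "\<And>x. \<bar>x\<bar> \<le> \<rho>\<^sub>1 \<Longrightarrow> \<bar>(r ^^ m) x\<bar> < \<rho>\<^sub>0"
  proof -
    show "0 < \<rho>\<^sub>0" "\<rho>\<^sub>0 < \<rho>\<^sub>1"
      using inf(1) by (auto simp: disc_trapped_def)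
    have *: "(f ^^ j) (complex_of_real x) = complex_of_real ((r ^^ j) x)" for j x
      by (induction j) (auto simp: fr)
    show "\<bar>(r ^^ m) x\<bar> < \<rho>\<^sub>0" if "\<bar>x\<bar> \<le> \<rho>\<^sub>1" for x
    proof -
      have "dist (complex_of_real 0) ((f ^^ m) (complex_of_real x)) < \<rho>\<^sub>0"
        using inf(1) that unfolding disc_trapped_def by simp
      then show ?thesis
        by (simp add: *)
    qed
  qed
  have IVT: "\<exists>y\<in>{x..x'}. r y = y" if "x \<le> x'" "(r x - x) * (r x' - x') \<le> 0" for x x'
  proof -
    have c: "continuous_on {x..x'} (\<lambda>y. r y - y)"
      by (intro continuous_intros contr)
    have "r x - x \<le> 0 \<and> 0 \<le> r x' - x' \<or> 0 \<le> r x - x \<and> r x' - x' \<le> 0"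
      using that(2) unfolding mult_le_0_iff by blast
    then have "\<exists>y\<ge>x. y \<le> x' \<and> r y - y = 0"
      using IVT' [of "\<lambda>y. r y - y" x 0 x', OF _ _ that(1) c]
        IVT2' [of "\<lambda>y. r y - y" x' 0 x, OF _ _ that(1) c] by (elim disjE conjE) simp_all
    then show ?thesis by auto
  qed
  \<comment> \<open>Without fixed points the whole line would move in one direction, and then the
    iterate \<open>m\<close> could not bring \<open>\<rho>\<^sub>1\<close>, respectively
    \<open>- \<rho>\<^sub>1\<close>, back within \<open>\<rho>\<^sub>0\<close>.\<close>
  have "F \<noteq> {}"
  proof
    assume "F = {}"
    then have pos: "(r x - x) * (r x' - x') > 0" for x x'
      using IVT [of x x'] IVT [of x' x] F by (metis empty_iff linear mult.commute not_le)
    show False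
    proof (cases "r 0 > 0")
      case True
      then have "r x > x" for x
        using pos [of 0 x] by (simp add: zero_less_mult_iff)
      then have "(r ^^ j) x \<ge> x" for x j
        by (induction j) (auto intro: order_trans less_imp_le)
      from this [of \<rho>\<^sub>1 m] show False
        using trap\<rho>(3) [of \<rho>\<^sub>1] trap\<rho>(1,2) by linarith
    next
      case False
      then have "r x < x" for x
        using pos [of 0 x] by (simp add: zero_less_mult_iff)
      then have "(r ^^ j) x \<le> x" for x j
        by (induction j) (auto intro: order_trans less_imp_le)
      from this [of m "- \<rho>\<^sub>1"] show False
        using trap\<rho>(3) [of "- \<rho>\<^sub>1"] trap\<rho>(1,2) by linarith
    qed
  qed
  then obtain a where a: "a \<in> F" by blast
  \<comment> \<open>Beyond all fixed points, which have norm at most \<open>\<rho>\<^sub>0\<close>,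
    and at least \<open>R\<close>, so that the disc is still trapped within radius
    \<open>B\<close>.\<close>
  define B where "B = max R (\<rho>\<^sub>0 + 1)"
  have B: "\<bar>x\<bar> < B" if "x \<in> F" for x
    using inf(2) [of "complex_of_real x"] that by (auto simp: F_def B_def)
  have notF: "complex_of_real x \<in> \<Omega>" if "x \<notin> F" for x
    using that by (auto simp: \<Omega>_def)
  have big: "Im (L (complex_of_real (0 + B))) - Im (L (complex_of_real (0 - B))) = - pi \<and>
      Re (f (complex_of_real (0 - B))) > 0 - B"
  proof (rule displacement_turn_around_trapped_disc [OF hom real disc_trapped_mono [OF inf(1)]])
    show "R \<le> B" by (simp add: B_def)
    show "f (complex_of_real a) = complex_of_real a" using a by (simp add: F_def)
    then show "dist (complex_of_real 0) (complex_of_real a) \<le> \<rho>\<^sub>0"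
      using inf(2) [of "complex_of_real a"] by simp
    show "dist (complex_of_real 0) z \<le> \<rho>\<^sub>0" if "z \<in> upper_half" "f z = z" for z
      using inf(2) [OF that] by simp
    have sub: "upper_half \<inter> sphere (complex_of_real 0) B \<subseteq> \<Omega>"
      using B by (force simp: \<Omega>_def)
    show "continuous_on (upper_half \<inter> sphere (complex_of_real 0) B) L"
      by (rule continuous_on_subset [OF L(1) sub])
    show "exp (L z) = f z - z" if "z \<in> upper_half \<inter> sphere (complex_of_real 0) B" for z
      using L(2) sub that by auto
  qed
  then have bigjump: "\<theta> B - \<theta> (- B) = - pi" and rB: "r (- B) > - B"
    by (auto simp: \<theta>_def r_def)

  \<comment> \<open>The turn at a single fixed point\<close>
  have isolated: "\<exists>\<delta>>0. {x - \<delta>..x + \<delta>} \<inter> F = {x}" if "x \<in> F" for x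
  proof -
    have "finite F" using fin by (simp add: F_def)
    then obtain d where d: "d > 0" "\<And>y. y \<in> F \<Longrightarrow> y \<noteq> x \<Longrightarrow> d \<le> dist x y"
      using finite_set_avoid [of F x] by blast
    then have "{x - d/2..x + d/2} \<inter> F = {x}"
      using that by (force simp: dist_real_def)
    then show ?thesis
      using d(1) by (intro exI [of _ "d/2"]) auto
  qed
  have fixeddist: "dist (complex_of_real x) z \<le> \<rho>"
    if "{x - \<delta>..x + \<delta>} \<inter> F = {x}" "0 < \<rho>" "z \<in> upper_half" "dist (complex_of_real x) z \<le> \<delta>"
      "f z = z"
    for x \<delta> \<rho> z
  proof -
    have "z \<in> complex_of_real ` F"
      by (rule Fiff [OF that(3,5)])
    then obtain y where y: "y \<in> F" "z = complex_of_real y"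
      by auto
    then have "y \<in> {x - \<delta>..x + \<delta>} \<inter> F"
      using that(4) y(1) by (auto simp: dist_norm simp flip: of_real_diff)
    then have "y = x" unfolding that(1) by simp
    then show ?thesis using y that by simp
  qed
  have ring: "upper_half \<inter> sphere (complex_of_real x) \<delta> \<subseteq> \<Omega>"
    if "{x - \<delta>..x + \<delta>} \<inter> F = {x}" "\<delta> > 0" for x \<delta>
  proof
    fix z assume z: "z \<in> upper_half \<inter> sphere (complex_of_real x) \<delta>"
    have "z \<notin> complex_of_real ` F"
    proof
      assume "z \<in> complex_of_real ` F"
      then obtain y where y: "y \<in> F" "z = complex_of_real y" by auto
      then have "\<bar>x - y\<bar> = \<delta>"
        using z by (auto simp: dist_norm simp flip: of_real_diff)
      then have "y \<in> {x - \<delta>..x + \<delta>} \<inter> F"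
        using y(1) by (simp add: abs_if split: if_splits)
      then have "y = x" unfolding that(1) by simp
      then show False using \<open>\<bar>x - y\<bar> = \<delta>\<close> that(2) by simp
    qed
    then show "z \<in> \<Omega>" using z by (simp add: \<Omega>_def)
  qed
  have att: "\<theta> (x + \<delta>) - \<theta> (x - \<delta>) = - pi"
    if x: "attracts_discs f x" "x \<in> F" and \<delta>: "\<delta> > 0" "{x - \<delta>..x + \<delta>} \<inter> F = {x}" for x \<delta>
  proof -
    obtain s0 s1 n where tr: "disc_trapped f x s0 s1 n \<delta>"
      using x(1) \<delta>(1) unfolding attracts_discs_def by blast
    have "Im (L (complex_of_real (x + \<delta>))) - Im (L (complex_of_real (x - \<delta>))) = - pi \<and>
      Re (f (complex_of_real (x - \<delta>))) > x - \<delta>"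
    proof (rule displacement_turn_around_trapped_disc [OF hom real tr])
      show "f (complex_of_real x) = complex_of_real x" using x by (simp add: F_def)
      show "dist (complex_of_real x) (complex_of_real x) \<le> s0"
        using tr by (simp add: disc_trapped_def)
      show "dist (complex_of_real x) z \<le> s0"
        if "z \<in> upper_half" "dist (complex_of_real x) z \<le> \<delta>" "f z = z" for z
        using fixeddist [OF \<delta>(2) _ that] tr by (simp add: disc_trapped_def)
      show "continuous_on (upper_half \<inter> sphere (complex_of_real x) \<delta>) L"
        by (rule continuous_on_subset [OF L(1) ring [OF \<delta>(2,1)]])
      show "exp (L z) = f z - z" if "z \<in> upper_half \<inter> sphere (complex_of_real x) \<delta>" for z
        using L(2) ring [OF \<delta>(2,1)] that by auto
    qed
    then show ?thesis by (simp add: \<theta>_def)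
  qed
  have rep: "\<theta> (r' (x + \<delta>)) - \<theta> (r' (x - \<delta>)) = - pi \<and> r' (x - \<delta>) > x - \<delta>"
    if x: "attracts_discs f' x" "x \<in> F" and \<delta>: "\<delta> > 0" "{x - \<delta>..x + \<delta>} \<inter> F = {x}" for x \<delta>
  proof -
    obtain s0 s1 n where tr: "disc_trapped f' x s0 s1 n \<delta>"
      using x(1) \<delta>(1) unfolding attracts_discs_def by blast
    \<comment> \<open>A logarithm of \<open>f' z - z\<close>, the negative of the displacement of
      \<open>f\<close> at \<open>f' z\<close>; the sign contributes \<open>\<i> * pi\<close>. The
      turn of \<open>L\<close> is thus measured between \<open>r' (x - \<delta>)\<close> and
      \<open>r' (x + \<delta>)\<close>.\<close>
    define L' where "L' \<equiv> \<lambda>y. L (f' y) + \<i> * pi"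
    have ring': "f' z \<in> \<Omega>" if "z \<in> upper_half \<inter> sphere (complex_of_real x) \<delta>" for z
    proof -
      have z: "z \<in> upper_half" "z \<in> \<Omega>" using that ring [OF \<delta>(2,1)] by auto
      have "f' z \<notin> complex_of_real ` F"
      proof
        assume "f' z \<in> complex_of_real ` F"
        then obtain y where y: "y \<in> F" "f' z = complex_of_real y" by auto
        then have "z = complex_of_real y"
          using inv(2) [OF z(1)] by (auto simp: F_def)
        then show False using y z by (auto simp: \<Omega>_def)
      qed
      then show ?thesis using f'(2) [OF z(1)] by (simp add: \<Omega>_def)
    qed
    have "Im (L' (complex_of_real (x + \<delta>))) - Im (L' (complex_of_real (x - \<delta>))) = - pi \<and>
      Re (f' (complex_of_real (x - \<delta>))) > x - \<delta>"
    proof (rule displacement_turn_around_trapped_disc [OF hom' real' tr])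
      show "f' (complex_of_real x) = complex_of_real x" using x F' by (simp add: fr')
      show "dist (complex_of_real x) (complex_of_real x) \<le> s0"
        using tr by (simp add: disc_trapped_def)
      show "dist (complex_of_real x) z \<le> s0"
        if "z \<in> upper_half" "dist (complex_of_real x) z \<le> \<delta>" "f' z = z" for z
      proof -
        have "f z = z" using inv(2) [OF that(1)] that(3) by simp
        then show ?thesis
          using fixeddist [OF \<delta>(2) _ that(1,2)] tr by (simp add: disc_trapped_def)
      qed
      show "continuous_on (upper_half \<inter> sphere (complex_of_real x) \<delta>) L'"
        unfolding L'_def
        using ring' by (intro continuous_intros continuous_on_compose2 [OF L(1)
          continuous_on_subset [OF f'(1)]]) auto
      show "exp (L' z) = f' z - z" if "z \<in> upper_half \<inter> sphere (complex_of_real x) \<delta>" for z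
      proof -
        have "exp (L (f' z)) = z - f' z"
          using L(2) [OF ring' [OF that]] that inv(2) [of z] by simp
        then show ?thesis
          by (simp add: L'_def exp_add)
      qed
    qed
    moreover have "Im (L' (complex_of_real y)) = \<theta> (r' y) + pi" "Re (f' (complex_of_real y)) = r' y"
      for y
      by (simp_all add: L'_def \<theta>_def fr')
    ultimately show ?thesis
      by (simp del: of_real_add of_real_diff)
  qed

  \<comment> \<open>Counting, according to the orientation of the map on the line\<close>
  have "inj r"
    using rr'(2) by (metis injI)
  then consider "strict_mono r" | "strict_antimono_on UNIV r"
    using injective_eq_monotone_map [OF is_interval_univ contr] by blast
  then have "\<exists>x. F = {x} \<and> \<not> attracts_discs f' x"
  proof cases
    case 1
    then have mono: "r x < r y \<longleftrightarrow> x < y" for x y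
      by (simp add: strict_mono_less)
    \<comment> \<open>An increasing map preserves the gaps between its fixed points, so
      \<open>r' p\<close> lies in the gap of \<open>p\<close>, where \<open>\<theta>\<close> is
      constant.\<close>
    have same: "\<theta> (r' p) = \<theta> p" if "p \<notin> F" for p
    proof -
      have no: False if "y \<in> F" "p < y \<and> y \<le> r' p \<or> r' p \<le> y \<and> y < p" for y
      proof -
        have "r y = y" using that F by simp
        then show False
          using that(2) mono [of p y] mono [of y p] mono [of "r' p" y] mono [of y "r' p"] rr'(1)
            [of p]
          by (metis linorder_not_le order_less_le_trans order_less_imp_le order_le_less)
      qed
      show ?thesis
      proof (cases "p \<le> r' p")
        case True
        have "{p..r' p} \<inter> F = {}"
        proof (rule ccontr)
          assume "{p..r' p} \<inter> F \<noteq> {}"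
          then obtain y where "y \<in> {p..r' p} \<inter> F" by blast
          then show False using no [of y] that by (cases "y = p") auto
        qed
        then have "\<theta> p = \<theta> (r' p)"
          using True by (intro const)
        then show ?thesis by simp
      next
        case False
        have "{r' p..p} \<inter> F = {}"
        proof (rule ccontr)
          assume "{r' p..p} \<inter> F \<noteq> {}"
          then obtain y where "y \<in> {r' p..p} \<inter> F" by blast
          then show False using no [of y] that by (cases "y = p") auto
        qed
        then show ?thesis
          using False by (intro const) auto
      qed
    qed
    have jump: "\<exists>\<delta>>0. {x - \<delta>..x + \<delta>} \<inter> F = {x} \<and> \<theta> (x + \<delta>) - \<theta> (x - \<delta>) = - pi" if x: "x \<in> F" for x
    proof -
      obtain \<delta> where \<delta>: "\<delta> > 0" "{x - \<delta>..x + \<delta>} \<inter> F = {x}"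
        using isolated [OF x] by blast
      have "x + \<delta> \<notin> F" "x - \<delta> \<notin> F"
      proof -
        show "x + \<delta> \<notin> F"
        proof
          assume "x + \<delta> \<in> F"
          then have "x + \<delta> \<in> {x - \<delta>..x + \<delta>} \<inter> F" using \<delta>(1) by auto
          then show False using \<delta> by auto
        qed
        show "x - \<delta> \<notin> F"
        proof
          assume "x - \<delta> \<in> F"
          then have "x - \<delta> \<in> {x - \<delta>..x + \<delta>} \<inter> F" using \<delta>(1) by auto
          then show False using \<delta> by auto
        qed
      qed
      then have "\<theta> (x + \<delta>) - \<theta> (x - \<delta>) = - pi"
        using loc [of x] x att [OF _ x \<delta>] rep [OF _ x \<delta>] same by (auto simp: F_def)
      then show ?thesis using \<delta> by blast
    qed
    have "finite F" using fin by (simp add: F_def)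
    have "- B \<le> B" "- B \<notin> F" "B \<notin> F"
      using B [of a] B [of B] B [of "-B"] a by auto
    then have "\<theta> B - \<theta> (- B) = of_nat (card (F \<inter> {-B..B})) * (- pi)"
      by (intro sum_of_jumps [OF \<open>finite F\<close> const jump]) auto
    moreover have "F \<inter> {-B..B} = F"
      using B by (force simp: abs_less_iff)
    ultimately have "card F = 1"
      using bigjump by simp
    then obtain x where x: "F = {x}"
      using card_1_singletonE by blast
    \<comment> \<open>If \<open>x\<close> repelled, \<open>x - 1\<close> would move left, while
      \<open>- B\<close> moves right. That gives a second fixed point to the left of
      \<open>x\<close>.\<close>
    have "\<not> attracts_discs f' x"
    proof
      assume "attracts_discs f' x"
      then have "r' (x - 1) > x - 1"
        using rep [of x 1] x by auto
      then have "r (x - 1) < x - 1"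
        using mono [of "x - 1" "r' (x - 1)"] rr'(1) [of "x - 1"] by simp
      moreover define p where "p = min (- B) (x - 1)"
      have "\<exists>y\<in>{min (-B) (x-1)..max (-B) (x-1)}. r y = y"
        using calculation rB IVT [of "-B" "x - 1"] IVT [of "x - 1" "-B"]
        by (auto simp: min_def max_def mult_le_0_iff)
      then obtain y where "r y = y" "y \<le> max (-B) (x-1)"
        by auto
      moreover have "- B < x"
        using B [of x] x by (auto simp: abs_less_iff)
      ultimately show False
        using x F [of y] by auto
    qed
    then show ?thesis using x by blast
  next
    case 2
    then have anti: "r y < r x" if "x < y" for x y
      using that 2 by (auto simp: monotone_on_def)
    have uniq: "y = a" if "y \<in> F" for y
      using anti [of y a] anti [of a y] a that F by (metis linorder_neqE less_asym)
    then have Fa: "F = {a}" using a by blast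
    \<comment> \<open>If \<open>a\<close> repelled, then, as \<open>r'\<close> exchanges its two
      sides, \<open>\<theta>\<close> would rise by \<open>pi\<close> from left to right, whereas
      \<open>bigjump\<close> says that it drops.\<close>
    have "\<not> attracts_discs f' a"
    proof
      assume "attracts_discs f' a"
      then have "\<theta> (r' (a + 1)) - \<theta> (r' (a - 1)) = - pi"
        using rep [of a 1] a by (simp add: Fa)
      moreover have "r' (a + 1) < a" "a < r' (a - 1)"
      proof -
        have "r a = a" using a F by simp
        have "\<not> a < r' (a + 1)"
        proof
          assume "a < r' (a + 1)"
          from anti [OF this] show False using rr'(1) [of "a + 1"] \<open>r a = a\<close> by simp
        qed
        moreover have "r' (a + 1) \<noteq> a"
          using rr'(1) [of "a + 1"] \<open>r a = a\<close> by (metis less_add_one less_irrefl)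
        ultimately show "r' (a + 1) < a"
          by linarith
        have "\<not> r' (a - 1) < a"
        proof
          assume "r' (a - 1) < a"
          from anti [OF this] show False using rr'(1) [of "a - 1"] \<open>r a = a\<close> by simp
        qed
        moreover have "r' (a - 1) \<noteq> a"
        proof
          assume "r' (a - 1) = a"
          then show False using rr'(1) [of "a - 1"] \<open>r a = a\<close> by simp
        qed
        ultimately show "a < r' (a - 1)"
          by linarith
      qed
      moreover have const': "\<theta> u = \<theta> v" if "u \<le> v" "a < u \<or> v < a" for u v
        using that Fa by (intro const) auto
      have Ba: "- B < a" "a < B"
        using B [OF a] by auto
      have "\<theta> u = \<theta> (- B)" if "u < a" for u
        using that Ba const' by (metis linear)
      moreover have "\<theta> u = \<theta> B" if "a < u" for u
        using that Ba const' by (metis linear)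
      ultimately show False
        using bigjump pi_gt_zero by (smt (verit))
    qed
    then show ?thesis using Fa by blast
  qed
  then obtain x where x: "F = {x}" "\<not> attracts_discs f' x" by blast
  then have "{z \<in> upper_half. f z = z} = {complex_of_real x}"
    using Fiff by (auto simp: F_def)
  then show ?thesis using x by blast
qed

section \<open>Isometries of the ball model\<close>

text \<open>The hyperbolic distance \<open>d\<close> in the ball model is given by \<open>sinh\<^sup>2 (d / 2) = hgap x y\<close>.\<close>

definition hgap :: "'a::real_inner \<Rightarrow> 'a \<Rightarrow> real" where
  "hgap x y = (norm (x - y))\<^sup>2 / ((1 - (norm x)\<^sup>2) * (1 - (norm y)\<^sup>2))"

lemma ball_norm_square: "x \<in> ball 0 1 \<Longrightarrow> 0 < 1 - (norm x)\<^sup>2"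
  by (simp add: power_less_one_iff)

lemma hgap_nonneg: "x \<in> ball 0 1 \<Longrightarrow> y \<in> ball 0 1 \<Longrightarrow> 0 \<le> hgap x y"
  unfolding hgap_def using ball_norm_square [of x] ball_norm_square [of y]
  by (intro divide_nonneg_pos mult_pos_pos) auto

lemma hgap_commute: "hgap x y = hgap y x"
  by (simp add: hgap_def norm_minus_commute mult.commute)

lemma hgap_eq_0_iff: "x \<in> ball 0 1 \<Longrightarrow> y \<in> ball 0 1 \<Longrightarrow> hgap x y = 0 \<longleftrightarrow> x = y"
  unfolding hgap_def using ball_norm_square [of x] ball_norm_square [of y] by auto

text \<open>The Lorentz form, negative in the time coordinate, which is the first component.\<close>

definition mink :: "real \<times> 'a::real_inner \<Rightarrow> real \<times> 'a \<Rightarrow> real" where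
  "mink p q = snd p \<bullet> snd q - fst p * fst q"

lemma mink_simps:
  "mink (p + q) s = mink p s + mink q s" "mink s (p + q) = mink s p + mink s q"
  "mink (p - q) s = mink p s - mink q s" "mink s (p - q) = mink s p - mink s q"
  "mink (c *\<^sub>R p) s = c * mink p s" "mink s (c *\<^sub>R p) = c * mink s p"
  by (simp_all add: mink_def inner_simps algebra_simps)

lemma mink_commute: "mink p q = mink q p"
  by (simp add: mink_def inner_commute)

text \<open>The inverse of stereographic projection from \<open>(-1, 0)\<close>. It carries the ball
  onto the upper sheet of \<open>mink p p = -1\<close>, where isometries become accessible to linear
  algebra.\<close>

definition hyperboloid :: "'a::real_inner \<Rightarrow> real \<times> 'a" where
  "hyperboloid x = ((1 + (norm x)\<^sup>2) / (1 - (norm x)\<^sup>2), (2 / (1 - (norm x)\<^sup>2)) *\<^sub>R x)"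

text \<open>With d the hyperbolic distance, the product is minus cosh d, and
  \<open>1 + 2 * hgap x y\<close> is cosh d by the half-angle formula.\<close>

lemma mink_hyperboloid:
  assumes "x \<in> ball 0 1" "y \<in> ball 0 1"
  shows "mink (hyperboloid x) (hyperboloid y) = - (1 + 2 * hgap x y)"
proof -
  define a b where "a = 1 - (norm x)\<^sup>2" and "b = 1 - (norm y)\<^sup>2"
  have ab: "a > 0" "b > 0" "(norm x)\<^sup>2 = 1 - a" "(norm y)\<^sup>2 = 1 - b"
    using ball_norm_square assms by (auto simp: a_def b_def)
  have "(norm (x - y))\<^sup>2 = (norm x)\<^sup>2 + (norm y)\<^sup>2 - 2 * (x \<bullet> y)"
    by (simp add: power2_norm_eq_inner inner_simps inner_commute)
  then have n: "(norm (x - y))\<^sup>2 = 2 - a - b - 2 * (x \<bullet> y)"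
    using ab by simp
  show ?thesis
    unfolding mink_def hyperboloid_def hgap_def fst_conv snd_conv n
    unfolding ab(3,4) using ab(1,2) by (simp add: field_simps)
qed

lemma hyperboloid_time: 
  assumes "x \<in> ball 0 1"
  shows "1 \<le> fst (hyperboloid x)" "x = (1 / (1 + fst (hyperboloid x))) *\<^sub>R snd (hyperboloid x)"
proof -
  have n: "1 - (norm x)\<^sup>2 > 0" by (rule ball_norm_square [OF assms])
  show "1 \<le> fst (hyperboloid x)"
    using n by (simp add: hyperboloid_def)
  have e: "1 + fst (hyperboloid x) = 2 / (1 - (norm x)\<^sup>2)"
    using n by (simp add: hyperboloid_def field_simps)
  define a where "a = 1 - (norm x)\<^sup>2"
  have "a > 0" "snd (hyperboloid x) = (2 / a) *\<^sub>R x"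
    using n by (simp_all add: hyperboloid_def a_def)
  then show "x = (1 / (1 + fst (hyperboloid x))) *\<^sub>R snd (hyperboloid x)"
    unfolding e a_def [symmetric] by simp
qed

lemma hyperboloid_surj:
  assumes "mink p p = -1" "0 < fst p"
  obtains x where "x \<in> ball 0 1" "hyperboloid x = p"
proof -
  obtain t v where p: "p = (t, v)" by (cases p) auto
  have t: "t > 0" "(norm v)\<^sup>2 = t\<^sup>2 - 1"
  proof -
    show "t > 0" using assms by (simp add: p)
    have "v \<bullet> v = t * t - 1" using assms(1) by (simp add: p mink_def)
    then show "(norm v)\<^sup>2 = t\<^sup>2 - 1"
      unfolding power2_norm_eq_inner power2_eq_square [of t] .
  qed
  define x where "x = (1 / (1 + t)) *\<^sub>R v"
  have "(norm x)\<^sup>2 = (t\<^sup>2 - 1) / (1 + t)\<^sup>2"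
    using t by (simp add: x_def power_divide)
  also have "\<dots> = (t - 1) / (t + 1)"
  proof -
    have "t\<^sup>2 - 1 = (t - 1) * (1 + t)" by (simp add: power2_eq_square algebra_simps)
    then show ?thesis
      using t(1) by (simp add: power2_eq_square add.commute)
  qed
  finally have nx: "1 - (norm x)\<^sup>2 = 2 / (1 + t)" "1 + (norm x)\<^sup>2 = 2 * t / (1 + t)"
    using t by (simp_all add: field_simps)
  then have "(norm x)\<^sup>2 < 1"
    using t by (smt (verit) divide_pos_pos)
  then have "x \<in> ball 0 1"
    by (simp add: power_less_one_iff)
  moreover have "hyperboloid x = p"
    unfolding hyperboloid_def nx p using t by (simp add: x_def field_simps)
  ultimately show thesis
    by (rule that)
qed

text \<open>The orthogonal complement of a timelike vector is positive definite, by Cauchy-Schwarz.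
  This turns inequalities between Minkowski products into equations between vectors.\<close>

lemma mink_orthogonal_timelike:
  assumes "mink p p = -1" "mink v p = 0" "mink v v \<le> 0"
  shows "v = 0"
proof -
  obtain t u where p: "p = (t, u)" by (cases p) auto
  obtain s w where v: "v = (s, w)" by (cases v) auto
  have 1: "w \<bullet> u = s * t" "u \<bullet> u = t\<^sup>2 - 1" "w \<bullet> w \<le> s\<^sup>2"
    using assms by (auto simp: p v mink_def power2_eq_square)
  have "(s * t)\<^sup>2 \<le> (w \<bullet> w) * (u \<bullet> u)"
    using Cauchy_Schwarz_ineq [of w u] 1 by simp
  also have "\<dots> \<le> s\<^sup>2 * (t\<^sup>2 - 1)"
    using 1 inner_ge_zero [of u] by (metis mult_right_mono)
  finally have "s = 0"
    by (simp add: power_mult_distrib algebra_simps)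
  moreover from this have "w \<bullet> w = 0"
    using 1(3) inner_ge_zero [of w] by simp
  ultimately show ?thesis
    by (simp add: v zero_prod_def)
qed

definition ball_isometry :: "('a::real_inner \<Rightarrow> 'a) \<Rightarrow> bool" where
  "ball_isometry g \<longleftrightarrow> (\<forall>x\<in>ball 0 1. g x \<in> ball 0 1) \<and>
     (\<forall>x\<in>ball 0 1. \<forall>y\<in>ball 0 1. hgap (g x) (g y) = hgap x y)"

lemma ball_isometryD:
  assumes "ball_isometry g" 
  shows "x \<in> ball 0 1 \<Longrightarrow> g x \<in> ball 0 1"
    "\<lbrakk>x \<in> ball 0 1; y \<in> ball 0 1\<rbrakk> \<Longrightarrow> hgap (g x) (g y) = hgap x y"
  using assms unfolding ball_isometry_def by blast+

lemma ball_isometry_funpow: "ball_isometry g \<Longrightarrow> ball_isometry (g ^^ n)"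
  by (induction n) (simp_all add: ball_isometry_def)

text \<open>The midpoint of \<open>x\<close> and \<open>g x\<close> is moved at least as far as \<open>x\<close>, which forces
  \<open>x\<close>, \<open>g x\<close> and \<open>g (g x)\<close> to lie on one geodesic.\<close>

lemma minimal_displacement_collinear:
  fixes g :: "'a::real_inner \<Rightarrow> 'a"
  assumes g: "ball_isometry g" and x: "x \<in> ball 0 1"
    and min: "\<And>y. y \<in> ball 0 1 \<Longrightarrow> hgap x (g x) \<le> hgap y (g y)"
  shows "hyperboloid (g (g x)) = (2 * (1 + 2 * hgap x (g x))) *\<^sub>R hyperboloid (g x) - hyperboloid x"
proof -
  define C where "C = 1 + 2 * hgap x (g x)"
  define X0 X1 X2 where "X0 = hyperboloid x" and "X1 = hyperboloid (g x)"
    and "X2 = hyperboloid (g (g x))"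
  have gx: "g x \<in> ball 0 1" "g (g x) \<in> ball 0 1"
    using ball_isometryD(1) [OF g] x by blast+
  have C: "C \<ge> 1"
    using hgap_nonneg [OF x gx(1)] by (simp add: C_def)
  have self: "hgap z z = 0" for z :: 'a
    by (simp add: hgap_def)
  have m: "mink X0 X0 = -1" "mink X1 X1 = -1" "mink X2 X2 = -1" "mink X0 X1 = - C"
    "mink X1 X2 = - C"
    using x gx ball_isometryD(2) [OF g x gx(1)]
    by (simp_all add: X0_def X1_def X2_def C_def mink_hyperboloid self)
  \<comment> \<open>If d is the displacement of \<open>x\<close>, then \<open>C\<close> is cosh d
    and \<open>k\<close> is cosh (d/2). \<open>M\<close> below is the midpoint of \<open>X0\<close>
    and \<open>X1\<close>, and \<open>N\<close> that of \<open>X1\<close> and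
    \<open>X2\<close>.\<close>
  define k where "k = sqrt (2 + 2 * C) / 2"
  have k: "k > 0" "4 * (k * k) = 2 + 2 * C"
  proof -
    show "k > 0" using C by (simp add: k_def)
    have "4 * (k * k) = sqrt (2 + 2 * C) * sqrt (2 + 2 * C)" by (simp add: k_def)
    then show "4 * (k * k) = 2 + 2 * C" using C by simp
  qed
  define M where "M = (1 / (2 * k)) *\<^sub>R (X0 + X1)"
  have MM: "mink M M = -1"
  proof -
    have "mink M M = (- 2 - 2 * C) / (4 * (k * k))"
      using k(1) by (simp add: M_def mink_simps m mink_commute [of X1 X0] field_simps)
    moreover have "(- 2 - 2 * C) / (2 + 2 * C) = -1"
      using C by (simp add: divide_eq_eq)
    ultimately show ?thesis unfolding k(2) by simp
  qed
  have M0: "mink M X0 = - k" and M1: "mink M X1 = - k"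
  proof -
    have "mink M X0 = - (1 + C) / (2 * k)" "mink M X1 = - (1 + C) / (2 * k)"
      using k(1) by (simp_all add: M_def mink_simps m mink_commute [of X1 X0] field_simps)
    moreover have "1 + C = 2 * k * k" using k by simp
    ultimately show "mink M X0 = - k" "mink M X1 = - k"
      using k by simp_all
  qed
  have "fst M > 0"
    using hyperboloid_time(1) [OF x] hyperboloid_time(1) [OF gx(1)] k
    by (simp add: M_def X0_def X1_def)
  then obtain y where y: "y \<in> ball 0 1" "hyperboloid y = M"
    using hyperboloid_surj MM by blast
  define N where "N = hyperboloid (g y)"
  have gy: "g y \<in> ball 0 1" by (rule ball_isometryD(1) [OF g y(1)])
  have NN: "mink N N = -1"
    using gy by (simp add: N_def mink_hyperboloid self)
  have N1: "mink N X1 = - k"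
    using M0 ball_isometryD(2) [OF g y(1) x] mink_hyperboloid [OF gy gx(1)] mink_hyperboloid
      [OF y(1) x]
    unfolding N_def X1_def X0_def y(2) by simp
  have N2: "mink N X2 = - k"
    using M1 ball_isometryD(2) [OF g y(1) gx(1)] mink_hyperboloid [OF gy gx(2)] mink_hyperboloid
      [OF y(1) gx(1)]
    unfolding N_def X1_def X2_def y(2) by simp
  \<comment> \<open>Minimality, applied to the midpoint.\<close>
  have MN: "mink M N \<le> - C"
    using min [OF y(1)] mink_hyperboloid [OF y(1) gy] unfolding N_def C_def y(2) by simp
  \<comment> \<open>\<open>M\<close> and \<open>N\<close> have distance d/2 from \<open>X1\<close>
    and are at least d apart. This leaves only equality, with \<open>X1\<close> as their
    midpoint.\<close>
  have "M + N - (2 * k) *\<^sub>R X1 = 0"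
  proof (rule mink_orthogonal_timelike [OF m(2)])
    show "mink (M + N - (2 * k) *\<^sub>R X1) X1 = 0"
      by (simp add: mink_simps M1 N1 m)
    have "mink (M + N - (2 * k) *\<^sub>R X1) (M + N - (2 * k) *\<^sub>R X1) = - 2 + 2 * mink M N + 4 * (k * k)"
      by (simp add: mink_simps M1 N1 m MM NN mink_commute [of X1 M] mink_commute [of X1 N]
        mink_commute [of N M]
          algebra_simps)
    then show "mink (M + N - (2 * k) *\<^sub>R X1) (M + N - (2 * k) *\<^sub>R X1) \<le> 0"
      using MN k(2) by linarith
  qed
  then have N: "N = (2 * k) *\<^sub>R X1 - M"
    by (simp add: algebra_simps)
  have "X1 + X2 - (2 * k) *\<^sub>R N = 0"
  proof (rule mink_orthogonal_timelike [OF NN])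
    show "mink (X1 + X2 - (2 * k) *\<^sub>R N) N = 0"
      by (simp add: mink_simps N1 N2 NN mink_commute [of X1 N] mink_commute [of X2 N])
    have "mink (X1 + X2 - (2 * k) *\<^sub>R N) (X1 + X2 - (2 * k) *\<^sub>R N) = - 2 - 2 * C + 4 * (k * k)"
      by (simp add: mink_simps N1 N2 m NN mink_commute [of X1 N] mink_commute [of X2 N]
        mink_commute [of X2 X1]
          algebra_simps)
    then show "mink (X1 + X2 - (2 * k) *\<^sub>R N) (X1 + X2 - (2 * k) *\<^sub>R N) \<le> 0"
      using k(2) by linarith
  qed
  then have "X2 = (2 * k) *\<^sub>R N - X1"
    by (simp add: algebra_simps)
  also have "(2 * k) *\<^sub>R N = (4 * (k * k)) *\<^sub>R X1 - (X0 + X1)"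
    using k(1) by (simp add: N M_def algebra_simps)
  also have "(4 * (k * k)) *\<^sub>R X1 - (X0 + X1) - X1 = (2 * C) *\<^sub>R X1 - X0"
    unfolding k(2) by (simp add: algebra_simps flip: scaleR_2)
  finally show ?thesis
    by (simp add: X0_def X1_def X2_def C_def)
qed

lemma linear_recurrence_solution:
  fixes Y :: "nat \<Rightarrow> 'a::real_vector"
  assumes "l \<noteq> 0" and rec: "\<And>n. Y (Suc (Suc n)) = (l + 1 / l) *\<^sub>R Y (Suc n) - Y n"
    and "Y 0 = U + V" "Y 1 = l *\<^sub>R U + (1 / l) *\<^sub>R V"
  shows "Y n = l ^ n *\<^sub>R U + (1 / l) ^ n *\<^sub>R V"
proof -
  have "Y n = l ^ n *\<^sub>R U + (1 / l) ^ n *\<^sub>R V \<and> Y (Suc n) = l ^ Suc n *\<^sub>R U + (1 / l) ^ Suc n *\<^sub>R V"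
  proof (induction n)
    case 0
    then show ?case using assms by simp
  next
    case (Suc n)
    have "l * l ^ Suc n = (l + 1 / l) * l ^ Suc n - l ^ n"
      "(1 / l) * (1 / l) ^ Suc n = (l + 1 / l) * (1 / l) ^ Suc n - (1 / l) ^ n"
      using \<open>l \<noteq> 0\<close> by (simp_all add: field_simps)
    then have "Y (Suc (Suc n)) = l ^ Suc (Suc n) *\<^sub>R U + (1 / l) ^ Suc (Suc n) *\<^sub>R V"
      unfolding rec using Suc by (simp only: power_Suc) (simp add: algebra_simps)
    then show ?case using Suc by blast
  qed
  then show ?thesis ..
qed

text \<open>The term in \<open>U\<close> dominates. As the term in \<open>V\<close> dies out, a time
  coordinate that stays at least 1 rules out \<open>fst U \<le> 0\<close>.\<close>

lemma hyperboloid_growth_limit: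
  fixes x :: "nat \<Rightarrow> 'a::real_inner"
  assumes ball: "\<And>n. x n \<in> ball 0 1" and "l > 1"
    and eq: "\<And>n. hyperboloid (x n) = l ^ n *\<^sub>R U + (1 / l) ^ n *\<^sub>R V"
  shows "fst U > 0" "x \<longlonglongrightarrow> (1 / fst U) *\<^sub>R snd U"
proof -
  have lim: "(\<lambda>n. (1 / l) ^ n) \<longlonglongrightarrow> 0"
    using \<open>l > 1\<close> by (intro LIMSEQ_realpow_zero) auto
  have lim2: "(\<lambda>n. (1 / l) ^ n * (1 / l) ^ n) \<longlonglongrightarrow> 0"
    using tendsto_mult [OF lim lim] by simp
  have lp: "l ^ n > 0" "(1 / l) ^ n * l ^ n = 1" for n
    using \<open>l > 1\<close> by (simp_all add: power_one_over)
  show U: "fst U > 0"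
  proof (rule ccontr)
    assume "\<not> fst U > 0"
    have "1 \<le> (1 / l) ^ n * fst V" for n
    proof -
      have "1 \<le> l ^ n * fst U + (1 / l) ^ n * fst V"
        using hyperboloid_time(1) [OF ball, of n] by (simp add: eq)
      moreover have "l ^ n * fst U \<le> 0"
        using \<open>\<not> fst U > 0\<close> lp(1) [of n] by (simp add: mult_nonneg_nonpos)
      ultimately show ?thesis by linarith
    qed
    moreover have "(\<lambda>n. (1 / l) ^ n * fst V) \<longlonglongrightarrow> 0"
      using tendsto_mult_right [OF lim, of "fst V"] by simp
    ultimately have "(1::real) \<le> 0"
      using LIMSEQ_le_const by blast
    then show False by simp
  qed
  \<comment> \<open>Numerator and denominator of the stereographic projection are multiplied by
    \<open>(1 / l) ^ n\<close>, after which every term converges.\<close>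
  have xe: "x n = (1 / ((1 / l) ^ n + fst U + (1 / l) ^ n * (1 / l) ^ n * fst V)) *\<^sub>R
      (snd U + ((1 / l) ^ n * (1 / l) ^ n) *\<^sub>R snd V)" for n
  proof -
    let ?e = "(1 / l) ^ n"
    have e: "?e > 0" using \<open>l > 1\<close> by simp
    have cancel: "1 / t = 1 / (s * t) * s" if "s > 0" for s t :: real
      using that by simp
    have "x n = (1 / (1 + fst (hyperboloid (x n)))) *\<^sub>R snd (hyperboloid (x n))"
      by (rule hyperboloid_time(2) [OF ball])
    also have "1 / (1 + fst (hyperboloid (x n))) = 1 / (?e * (1 + fst (hyperboloid (x n)))) * ?e"
      by (rule cancel [OF e])
    also have "(1 / (?e * (1 + fst (hyperboloid (x n)))) * ?e) *\<^sub>R snd (hyperboloid (x n)) =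
        (1 / (?e * (1 + fst (hyperboloid (x n))))) *\<^sub>R (?e *\<^sub>R snd (hyperboloid (x n)))"
      by simp
    also have "?e * (1 + fst (hyperboloid (x n))) = ?e + (?e * l ^ n) * fst U + ?e * ?e * fst V"
      unfolding eq by (simp add: algebra_simps)
    also have "?e *\<^sub>R snd (hyperboloid (x n)) = (?e * l ^ n) *\<^sub>R snd U + (?e * ?e) *\<^sub>R snd V"
      unfolding eq by (simp add: algebra_simps)
    finally show ?thesis
      unfolding lp by simp
  qed
  have "(\<lambda>n. (1 / ((1 / l) ^ n + fst U + (1 / l) ^ n * (1 / l) ^ n * fst V)) *\<^sub>R
      (snd U + ((1 / l) ^ n * (1 / l) ^ n) *\<^sub>R snd V)) \<longlonglongrightarrow> (1 / (0 + fst U + 0 * fst V)) *\<^sub>R (snd U +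
        0 *\<^sub>R snd V)"
    using U \<open>l > 1\<close> by (intro tendsto_intros lim lim2) auto
  then have "(\<lambda>n. x n) \<longlonglongrightarrow> (1 / (0 + fst U + 0 * fst V)) *\<^sub>R (snd U + 0 *\<^sub>R snd V)"
    unfolding xe .
  then show "x \<longlonglongrightarrow> (1 / fst U) *\<^sub>R snd U"
    by simp
qed

text \<open>Minimality makes the orbit on the hyperboloid satisfy a linear recurrence. Its two
  coefficient vectors are lightlike, so they project to the unit sphere; these are the ends of the
  axis.\<close>

lemma translation_orbit_limits:
  fixes g g' :: "'a::real_inner \<Rightarrow> 'a"
  assumes g: "ball_isometry g" and g': "ball_isometry g'"
    and inv: "\<And>y. y \<in> ball 0 1 \<Longrightarrow> g' (g y) = y" "\<And>y. y \<in> ball 0 1 \<Longrightarrow> g (g' y) = y"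
    and x: "x \<in> ball 0 1" "g x \<noteq> x"
    and min: "\<And>y. y \<in> ball 0 1 \<Longrightarrow> hgap x (g x) \<le> hgap y (g y)"
  obtains a r where "norm a = 1" "norm r = 1" "a \<noteq> r"
    "(\<lambda>n. (g ^^ n) x) \<longlonglongrightarrow> a" "(\<lambda>n. (g' ^^ n) x) \<longlonglongrightarrow> r"
proof -
  define C where "C = 1 + 2 * hgap x (g x)"
  have gx: "g x \<in> ball 0 1" using ball_isometryD(1) [OF g x(1)] .
  have C: "C > 1"
    using hgap_nonneg [OF x(1) gx] hgap_eq_0_iff [OF x(1) gx] x(2) by (simp add: C_def)
  \<comment> \<open>The larger root of \<open>l + 1 / l = 2 * C\<close>; as \<open>C\<close> is cosh
    d for the displacement d, this is e^d.\<close>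
  define l where "l = C + sqrt (C\<^sup>2 - 1)"
  have sq: "(sqrt (C\<^sup>2 - 1))\<^sup>2 = C\<^sup>2 - 1" "sqrt (C\<^sup>2 - 1) > 0"
    using C by (auto simp: one_less_power)
  have l: "l > 1" unfolding l_def using C sq(2) by linarith
  have "l * (C - sqrt (C\<^sup>2 - 1)) = 1"
    using sq(1) by (simp add: l_def algebra_simps power2_eq_square)
  then have il: "1 / l = C - sqrt (C\<^sup>2 - 1)"
    using l by (simp add: field_simps)
  have lC: "l + 1 / l = 2 * C"
    unfolding il by (simp add: l_def)
  have orbit: "(g ^^ n) x \<in> ball 0 1" "(g' ^^ n) x \<in> ball 0 1" for n
    by (rule ball_isometryD(1) [OF ball_isometry_funpow [OF g] x(1)],
        rule ball_isometryD(1) [OF ball_isometry_funpow [OF g'] x(1)])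
  have disp: "hgap ((g ^^ n) x) (g ((g ^^ n) x)) = hgap x (g x)" for n
    using ball_isometryD(2) [OF ball_isometry_funpow [OF g] x(1) gx, of n]
    by (simp add: funpow_swap1)
  have disp': "hgap y (g' y) = hgap (g' y) (g (g' y))" if "y \<in> ball 0 1" for y
    using inv(2) [OF that] by (simp add: hgap_commute)
  have dispn': "hgap ((g' ^^ n) x) (g' ((g' ^^ n) x)) = hgap x (g x)" for n
  proof -
    have "hgap ((g' ^^ n) x) (g' ((g' ^^ n) x)) = hgap x (g' x)"
      using ball_isometryD(2) [OF ball_isometry_funpow [OF g'] x(1) ball_isometryD(1) [OF g'
        x(1)], of n]
      by (simp add: funpow_swap1)
    also have "\<dots> = hgap (g x) (g (g' x))"
      using ball_isometryD(2) [OF g x(1) ball_isometryD(1) [OF g' x(1)]] by simp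
    also have "\<dots> = hgap x (g x)"
      using inv(2) [OF x(1)] by (simp add: hgap_commute)
    finally show ?thesis .
  qed
  have rec: "hyperboloid ((g ^^ Suc (Suc n)) x) =
    (l + 1 / l) *\<^sub>R hyperboloid ((g ^^ Suc n) x) - hyperboloid ((g ^^ n) x)" for n
    using minimal_displacement_collinear [OF g orbit(1), of n] min by (simp add: disp lC C_def)
  have rec': "hyperboloid ((g' ^^ Suc (Suc n)) x) =
    (l + 1 / l) *\<^sub>R hyperboloid ((g' ^^ Suc n) x) - hyperboloid ((g' ^^ n) x)" for n
  proof -
    have "hgap ((g' ^^ n) x) (g' ((g' ^^ n) x)) \<le> hgap y (g' y)" if "y \<in> ball 0 1" for y
      unfolding dispn' disp' [OF that] using min ball_isometryD(1) [OF g' that] by blast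
    then show ?thesis
      using minimal_displacement_collinear [OF g' orbit(2), of n] by (simp add: dispn' lC C_def)
  qed
  define X0 X1 where "X0 = hyperboloid x" and "X1 = hyperboloid (g x)"
  define d where "d = l - 1 / l"
  have "1 / l < 1" using l by simp
  then have d: "d > 0" unfolding d_def using l by linarith
  define U where "U = (1 / d) *\<^sub>R (X1 - (1 / l) *\<^sub>R X0)"
  define V where "V = (1 / d) *\<^sub>R (l *\<^sub>R X0 - X1)"
  have UV0: "X0 = U + V"
  proof -
    have "U + V = (1 / d) *\<^sub>R ((l - 1 / l) *\<^sub>R X0)"
      by (simp add: U_def V_def algebra_simps)
    then show ?thesis using d by (simp add: d_def)
  qed
  have UV1: "X1 = l *\<^sub>R U + (1 / l) *\<^sub>R V"
  proof -
    have "l *\<^sub>R U + (1 / l) *\<^sub>R V = (1 / d) *\<^sub>R ((l - 1 / l) *\<^sub>R X1)"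
      using l by (simp add: U_def V_def algebra_simps)
    then show ?thesis using d by (simp add: d_def)
  qed
  have gn: "hyperboloid ((g ^^ n) x) = l ^ n *\<^sub>R U + (1 / l) ^ n *\<^sub>R V" for n
    by (rule linear_recurrence_solution [where Y = "\<lambda>n. hyperboloid ((g ^^ n) x)", OF _ rec])
       (use l UV0 UV1 in \<open>auto simp: X0_def X1_def\<close>)
  \<comment> \<open>Running the orbit backwards interchanges \<open>U\<close> and
    \<open>V\<close>.\<close>
  have X': "hyperboloid (g' x) = l *\<^sub>R V + (1 / l) *\<^sub>R U"
  proof -
    have gx': "g' x \<in> ball 0 1" using ball_isometryD(1) [OF g' x(1)] .
    have "hgap (g' x) (g (g' x)) = hgap x (g x)"
      using dispn' [of 0] inv(2) [OF x(1)] by (simp add: hgap_commute)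
    then have "X1 = (l + 1 / l) *\<^sub>R X0 - hyperboloid (g' x)"
      using minimal_displacement_collinear [OF g gx'] min inv(2) [OF x(1)]
      by (simp add: lC C_def X1_def X0_def)
    then have "hyperboloid (g' x) = (l + 1 / l) *\<^sub>R X0 - X1"
      by (simp add: algebra_simps)
    then show ?thesis
      unfolding UV1 UV0 by (simp add: algebra_simps)
  qed
  have gn': "hyperboloid ((g' ^^ n) x) = l ^ n *\<^sub>R V + (1 / l) ^ n *\<^sub>R U" for n
    by (rule linear_recurrence_solution [where Y = "\<lambda>n. hyperboloid ((g' ^^ n) x)", OF _ rec'])
       (use l UV0 X' in \<open>auto simp: X0_def add.commute\<close>)
  note limU = hyperboloid_growth_limit [of "\<lambda>n. (g ^^ n) x", OF orbit(1) l gn]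
  note limV = hyperboloid_growth_limit [of "\<lambda>n. (g' ^^ n) x", OF orbit(2) l gn']
  have m: "mink X0 X0 = -1" "mink X1 X1 = -1" "mink X0 X1 = - C" "mink X1 X0 = - C"
    using x gx by (simp_all add: X0_def X1_def C_def mink_hyperboloid hgap_commute)
      (simp_all add: hgap_def)
  have lne: "l \<noteq> 0" using l by simp
  have UU: "mink U U = 0"
  proof -
    have "mink U U = (1 / d) * (1 / d) * (- 1 - (1 / l) * (1 / l) + (1 / l) * (2 * C))"
      by (simp add: U_def mink_simps m algebra_simps)
    also have "\<dots> = 0"
      unfolding lC [symmetric] using lne by (simp add: field_simps)
    finally show ?thesis .
  qed
  have VV: "mink V V = 0"
  proof -
    have "mink V V = (1 / d) * (1 / d) * (- 1 - l * l + l * (2 * C))"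
    proof -
      have "mink (l *\<^sub>R X0 - X1) (l *\<^sub>R X0 - X1) = - 1 - l * l + l * (2 * C)"
        by (simp add: mink_simps m algebra_simps)
      then show ?thesis
        by (simp add: V_def mink_simps(5,6))
    qed
    also have "\<dots> = 0"
      unfolding lC [symmetric] using lne by (simp add: field_simps)
    finally show ?thesis .
  qed
  \<comment> \<open>Otherwise \<open>X0 = U + V\<close> would be lightlike. The product separates
    the two limits, since proportional lightlike vectors are orthogonal.\<close>
  have UV: "mink U V \<noteq> 0"
  proof
    assume "mink U V = 0"
    then have "mink X0 X0 = 0"
      by (simp add: UV0 mink_simps UU VV mink_commute [of V U])
    then show False using m by simp
  qed
  have unit: "norm ((1 / fst p) *\<^sub>R snd p) = 1" if "mink p p = 0" "fst p > 0" for p :: "real \<times> 'a"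
  proof -
    have "(norm (snd p))\<^sup>2 = (fst p)\<^sup>2"
      using that(1) by (simp add: mink_def power2_norm_eq_inner) (simp add: power2_eq_square)
    then have "norm (snd p) = fst p"
      using that(2) by (simp add: power2_eq_iff_nonneg)
    then show ?thesis using that(2) by simp
  qed
  show thesis
  proof (rule that)
    show "norm ((1 / fst U) *\<^sub>R snd U) = 1" "norm ((1 / fst V) *\<^sub>R snd V) = 1"
      by (rule unit [OF UU limU(1)], rule unit [OF VV limV(1)])
    show "(1 / fst U) *\<^sub>R snd U \<noteq> (1 / fst V) *\<^sub>R snd V"
    proof
      assume e: "(1 / fst U) *\<^sub>R snd U = (1 / fst V) *\<^sub>R snd V"
      define a where "a = (1 / fst U) *\<^sub>R snd U"
      have "a \<bullet> a = 1"
        using unit [OF UU limU(1)] unfolding a_def [symmetric] norm_eq_1 .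
      have "snd U = fst U *\<^sub>R a"
        using limU(1) by (simp add: a_def)
      moreover have "snd V = fst V *\<^sub>R a"
        using limV(1) unfolding a_def e by simp
      ultimately have "mink U V = 0"
        using \<open>a \<bullet> a = 1\<close> by (simp add: mink_def)
      then show False using UV by simp
    qed
  qed (use limU(2) limV(2) in auto)
qed

text \<open>Invariance of \<open>hgap\<close> at \<open>x\<close> and \<open>w\<close>, solved for
  \<open>h x\<close>. Expanded, \<open>D x\<close> is 1 - 2 x.w + |x|^2 |w|^2, which stays away from
  0 up to the sphere and equals |x - w|^2 there.\<close>

lemma ball_isometry_norm:
  assumes h: "ball_isometry h" and w: "w \<in> ball 0 1" "h w = 0" and x: "x \<in> ball 0 1"
  defines "D \<equiv> \<lambda>x. (1 - (norm x)\<^sup>2) * (1 - (norm w)\<^sup>2) + (norm (x - w))\<^sup>2"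
  shows "1 - (norm (h x))\<^sup>2 = (1 - (norm x)\<^sup>2) * (1 - (norm w)\<^sup>2) / D x" "D x \<ge> (1 - norm w)\<^sup>2"
proof -
  have hx: "h x \<in> ball 0 1" using ball_isometryD(1) [OF h x] .
  define a b c where "a = 1 - (norm x)\<^sup>2" and "b = 1 - (norm w)\<^sup>2" and "c = 1 - (norm (h x))\<^sup>2"
  have abc: "a > 0" "b > 0" "c > 0"
    using ball_norm_square x w hx by (auto simp: a_def b_def c_def)
  have Dx: "D x = a * b + (norm (x - w))\<^sup>2"
    by (simp add: D_def a_def b_def)
  then have Dpos: "D x > 0"
    using abc by (simp add: add_pos_nonneg)
  have "hgap (h x) (h w) = hgap x w"
    by (rule ball_isometryD(2) [OF h x w(1)])
  then have "(1 - c) / c = (norm (x - w))\<^sup>2 / (a * b)"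
    by (simp add: hgap_def w(2) a_def b_def c_def)
  then have "(1 - c) * (a * b) = (norm (x - w))\<^sup>2 * c"
    using abc by (simp add: frac_eq_eq)
  moreover have "s = c * (s + n)" if "(1 - c) * s = n * c" for s n :: real
    using that by (simp add: algebra_simps)
  ultimately have "a * b = c * D x"
    unfolding Dx by blast
  then show "1 - (norm (h x))\<^sup>2 = (1 - (norm x)\<^sup>2) * (1 - (norm w)\<^sup>2) / D x"
    using Dpos by (simp add: a_def b_def c_def field_simps)
  have "D x = 1 - 2 * (x \<bullet> w) + (norm x)\<^sup>2 * (norm w)\<^sup>2"
  proof -
    have "(norm (x - w))\<^sup>2 = (norm x)\<^sup>2 + (norm w)\<^sup>2 - 2 * (x \<bullet> w)"
      by (simp add: power2_norm_eq_inner inner_simps inner_commute)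
    then show ?thesis by (simp add: D_def algebra_simps)
  qed
  also have "\<dots> \<ge> 1 - 2 * (norm x * norm w) + (norm x)\<^sup>2 * (norm w)\<^sup>2"
    using Cauchy_Schwarz_ineq2 [of x w] by simp
  also have "1 - 2 * (norm x * norm w) + (norm x)\<^sup>2 * (norm w)\<^sup>2 = (1 - norm x * norm w)\<^sup>2"
    by (simp add: power2_eq_square algebra_simps)
  finally have *: "D x \<ge> (1 - norm x * norm w)\<^sup>2" .
  have "norm x * norm w \<le> norm w"
    using x by (simp add: mult_left_le_one_le)
  moreover have "norm w < 1" using w by simp
  ultimately have "(1 - norm w)\<^sup>2 \<le> (1 - norm x * norm w)\<^sup>2"
    by (intro power_mono) auto
  then show "D x \<ge> (1 - norm w)\<^sup>2"
    using * by linarith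
qed

text \<open>Invariance of \<open>hgap\<close> at \<open>x\<close> and \<open>y\<close>. Substituting
  the formula for \<open>1 - (norm (h x))\<^sup>2\<close> cancels the factors that vanish at the
  sphere, so the result survives the passage to the boundary.\<close>

lemma ball_isometry_dist:
  assumes h: "ball_isometry h" and w: "w \<in> ball 0 1" "h w = 0" and x: "x \<in> ball 0 1"
    and y: "y \<in> ball 0 1"
  defines "D \<equiv> \<lambda>x. (1 - (norm x)\<^sup>2) * (1 - (norm w)\<^sup>2) + (norm (x - w))\<^sup>2"
  shows "(norm (h x - h y))\<^sup>2 = (norm (x - y))\<^sup>2 * (1 - (norm w)\<^sup>2)\<^sup>2 / (D x * D y)"
proof -
  have hx: "h x \<in> ball 0 1" "h y \<in> ball 0 1" using ball_isometryD(1) [OF h] x y by auto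
  have pos: "1 - (norm x)\<^sup>2 > 0" "1 - (norm y)\<^sup>2 > 0" "1 - (norm w)\<^sup>2 > 0"
      "1 - (norm (h x))\<^sup>2 > 0" "1 - (norm (h y))\<^sup>2 > 0"
    using ball_norm_square x y w hx by auto
  have Dpos: "D x > 0" "D y > 0"
    unfolding D_def using pos by (auto intro!: add_pos_nonneg)
  have n: "1 - (norm (h x))\<^sup>2 = (1 - (norm x)\<^sup>2) * (1 - (norm w)\<^sup>2) / D x"
      "1 - (norm (h y))\<^sup>2 = (1 - (norm y)\<^sup>2) * (1 - (norm w)\<^sup>2) / D y"
    unfolding D_def by (rule ball_isometry_norm(1) [OF h w x], rule ball_isometry_norm(1) [OF h w
      y])
  have "(norm (h x - h y))\<^sup>2 = hgap (h x) (h y) * ((1 - (norm (h x))\<^sup>2) * (1 - (norm (h y))\<^sup>2))"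
    using pos(4,5) unfolding hgap_def by simp
  also have "hgap (h x) (h y) = (norm (x - y))\<^sup>2 / ((1 - (norm x)\<^sup>2) * (1 - (norm y)\<^sup>2))"
    using ball_isometryD(2) [OF h x y] by (simp add: hgap_def)
  finally have "(norm (h x - h y))\<^sup>2 =
      (norm (x - y))\<^sup>2 / ((1 - (norm x)\<^sup>2) * (1 - (norm y)\<^sup>2)) *
        ((1 - (norm (h x))\<^sup>2) * (1 - (norm (h y))\<^sup>2))" .
  moreover have "k / (a * b) * (a * c / d * (b * c / e)) = k * c\<^sup>2 / (d * e)" if "a > 0" "b > 0"
    for a b c d e k :: real
    using that by (simp add: power2_eq_square)
  ultimately show ?thesis
    unfolding n using pos(1,2) by metis
qed

text \<open>The distance formula makes \<open>h\<close> Lipschitz in the Euclidean metric, hence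
  extendable to the sphere. Its limit for \<open>y = 0\<close>, where \<open>D 0 = 1\<close>, is the
  second claim.\<close>

lemma ball_isometry_boundary_limit:
  fixes h :: "'a::euclidean_space \<Rightarrow> 'a"
  assumes h: "ball_isometry h" and w: "w \<in> ball 0 1" "h w = 0" and z: "norm z = 1"
  obtains b where "(h \<longlongrightarrow> b) (at z within ball 0 1)"
    "norm (b - h 0) = (1 - (norm w)\<^sup>2) / norm (z - w)"
proof -
  define D where "D \<equiv> \<lambda>x. (1 - (norm x)\<^sup>2) * (1 - (norm w)\<^sup>2) + (norm (x - w))\<^sup>2"
  define e where "e = 1 - (norm w)\<^sup>2"
  have e: "e > 0" using ball_norm_square w(1) by (auto simp: e_def)
  have w1: "norm w < 1" using w by simp
  define B where "B = e / (1 - norm w)\<^sup>2"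
  have B: "B > 0" using e w1 by (simp add: B_def)
  have lip: "norm (h x - h y) \<le> B * norm (x - y)" if "x \<in> ball 0 1" "y \<in> ball 0 1" for x y
  proof -
    have D: "D x \<ge> (1 - norm w)\<^sup>2" "D y \<ge> (1 - norm w)\<^sup>2"
      unfolding D_def by (rule ball_isometry_norm(2) [OF h w
        that(1)], rule ball_isometry_norm(2) [OF h w that(2)])
    have p: "(1 - norm w)\<^sup>2 > 0" using w1 by simp
    have "(norm (h x - h y))\<^sup>2 = (norm (x - y))\<^sup>2 * e\<^sup>2 / (D x * D y)"
      unfolding D_def e_def by (rule ball_isometry_dist [OF h w that])
    also have "\<dots> \<le> (norm (x - y))\<^sup>2 * e\<^sup>2 / ((1 - norm w)\<^sup>2 * (1 - norm w)\<^sup>2)"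
    proof -
      have "k / (s * t) \<le> k / (p * p)" if "p \<le> s" "p \<le> t" "0 < p" "0 \<le> k" for k s t p :: real
        using that by (intro divide_left_mono mult_mono mult_pos_pos) auto
      from this [OF D p] show ?thesis by simp
    qed
    also have "\<dots> = (B * norm (x - y))\<^sup>2"
      unfolding B_def power_mult_distrib power_divide power2_eq_square [of "(1 - norm w)\<^sup>2"] by simp
    finally show ?thesis
      by (rule power2_le_imp_le) (use B in auto)
  qed
  have "uniformly_continuous_on (ball 0 1) h"
    unfolding uniformly_continuous_on_def
  proof (intro allI impI)
    fix \<epsilon> :: real assume "\<epsilon> > 0"
    show "\<exists>d>0. \<forall>x\<in>ball 0 1. \<forall>x'\<in>ball 0 1. dist x' x < d \<longrightarrow> dist (h x') (h x) < \<epsilon>"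
    proof (intro exI [of _ "\<epsilon> / B"] conjI ballI impI)
      fix x y :: 'a assume "x \<in> ball 0 1" "y \<in> ball 0 1" "dist y x < \<epsilon> / B"
      then show "dist (h y) (h x) < \<epsilon>"
        using lip [of y x] B by (simp add: dist_norm field_simps)
    qed (use B \<open>\<epsilon> > 0\<close> in auto)
  qed
  moreover have "z \<in> closure (ball 0 1)" using z by simp
  ultimately obtain b where b: "(h \<longlongrightarrow> b) (at z within ball 0 1)"
    using uniformly_continuous_on_extension_at_closure by blast
  have nt: "at z within ball (0::'a) 1 \<noteq> bot"
  proof -
    have "z islimpt ball 0 1" using z by (simp add: islimpt_ball)
    then show ?thesis by (simp add: trivial_limit_within)
  qed
  have zw: "norm (z - w) > 0" using z w1 by auto
  have "((\<lambda>x. (norm (h x - h 0))\<^sup>2) \<longlongrightarrow> (norm (b - h 0))\<^sup>2) (at z within ball 0 1)"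
    by (intro tendsto_intros b)
  moreover have "((\<lambda>x. (norm (h x - h 0))\<^sup>2) \<longlongrightarrow> (norm z)\<^sup>2 * e\<^sup>2 / D z) (at z within ball 0 1)"
  proof (rule Lim_transform_within)
    show "((\<lambda>x. (norm x)\<^sup>2 * e\<^sup>2 / D x) \<longlongrightarrow> (norm z)\<^sup>2 * e\<^sup>2 / D z) (at z within ball 0 1)"
      unfolding D_def using zw z by (intro tendsto_intros) auto
    show "(norm x)\<^sup>2 * e\<^sup>2 / D x = (norm (h x - h 0))\<^sup>2" if "x \<in> ball 0 1" for x
    proof -
      have "D 0 = 1" by (simp add: D_def)
      then show ?thesis
        using ball_isometry_dist [OF h w that, of 0] by (simp add: D_def e_def)
    qed
  qed (rule zero_less_one)
  ultimately have "(norm (b - h 0))\<^sup>2 = (norm z)\<^sup>2 * e\<^sup>2 / D z"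
    using tendsto_unique [OF nt] by blast
  also have "\<dots> = (e / norm (z - w))\<^sup>2"
    by (simp add: D_def z power_divide)
  finally have "norm (b - h 0) = e / norm (z - w)"
    using e zw by (simp add: power2_eq_iff_nonneg)
  then show thesis
    using that b by (simp add: e_def)
qed

text \<open>Two points at a fixed hyperbolic distance become Euclidean close when one of them tends
  to the sphere.\<close>

lemma ball_isometry_tendsto_transfer:
  fixes g :: "nat \<Rightarrow> 'a::euclidean_space \<Rightarrow> 'a"
  assumes g: "\<And>n. ball_isometry (g n)" and xy: "x \<in> ball 0 1" "y \<in> ball 0 1"
    and lim: "(\<lambda>n. g n x) \<longlonglongrightarrow> a" "norm a = 1"
  shows "(\<lambda>n. g n y) \<longlonglongrightarrow> a"
proof -
  have gb: "g n x \<in> ball 0 1" "g n y \<in> ball 0 1" for n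
    using ball_isometryD(1) [OF g] xy by auto
  have bound: "(norm (g n y - g n x))\<^sup>2 \<le> hgap y x * (1 - (norm (g n x))\<^sup>2)" for n
  proof -
    have pos: "1 - (norm (g n x))\<^sup>2 > 0" "1 - (norm (g n y))\<^sup>2 > 0"
      by (rule ball_norm_square [OF gb(1)], rule ball_norm_square [OF gb(2)])
    have "hgap y x = hgap (g n y) (g n x)"
      using ball_isometryD(2) [OF g xy(2,1)] by simp
    then have "(norm (g n y - g n x))\<^sup>2 = hgap y x * (1 - (norm (g n x))\<^sup>2) * (1 -
      (norm (g n y))\<^sup>2)"
      using pos by (simp add: hgap_def)
    also have "\<dots> \<le> hgap y x * (1 - (norm (g n x))\<^sup>2)"
      using pos hgap_nonneg [OF xy(2,1)] by (intro mult_left_le) auto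
    finally show ?thesis .
  qed
  have "(\<lambda>n. hgap y x * (1 - (norm (g n x))\<^sup>2)) \<longlonglongrightarrow> hgap y x * (1 - (norm a)\<^sup>2)"
    by (intro tendsto_intros lim)
  then have "(\<lambda>n. hgap y x * (1 - (norm (g n x))\<^sup>2)) \<longlonglongrightarrow> 0"
    by (simp add: lim)
  then have "(\<lambda>n. (norm (g n y - g n x))\<^sup>2) \<longlonglongrightarrow> 0"
    by (rule Lim_null_comparison [rotated]) (simp add: bound)
  then have "(\<lambda>n. sqrt ((norm (g n y - g n x))\<^sup>2)) \<longlonglongrightarrow> sqrt 0"
    by (intro tendsto_intros)
  then have "(\<lambda>n. norm (g n y - g n x)) \<longlonglongrightarrow> 0"
    by simp
  then have "(\<lambda>n. g n y - g n x) \<longlonglongrightarrow> 0"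
    by (rule tendsto_norm_zero_cancel)
  then have "(\<lambda>n. (g n y - g n x) + g n x) \<longlonglongrightarrow> 0 + a"
    by (intro tendsto_intros lim)
  then show ?thesis by simp
qed

text \<open>North-south dynamics: the points \<open>w\<^sub>n = g'\<^sup>n 0\<close> converge to \<open>r\<close>, and the formula
  for the distance from the boundary value at \<open>z\<close> to \<open>g\<^sup>n 0\<close> has
  \<open>1 - |w\<^sub>n|\<^sup>2\<close> in the numerator.\<close>

lemma translation_boundary_dynamics:
  fixes g g' :: "'a::euclidean_space \<Rightarrow> 'a"
  assumes g: "ball_isometry g" and g': "ball_isometry g'"
    and inv: "\<And>y. y \<in> ball 0 1 \<Longrightarrow> g (g' y) = y"
    and x: "x \<in> ball 0 1"
    and lim: "(\<lambda>n. (g ^^ n) x) \<longlonglongrightarrow> a" "norm a = 1" "(\<lambda>n. (g' ^^ n) x) \<longlonglongrightarrow> r" "norm r = 1"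
    and z: "norm z = 1" "z \<noteq> r"
    and h: "\<And>n y. y \<in> ball 0 1 \<Longrightarrow> h n y = (g ^^ n) y"
  shows "(\<lambda>n. Lim (at z within ball 0 1) (h n)) \<longlonglongrightarrow> a"
proof -
  define w where "w \<equiv> \<lambda>n. (g' ^^ n) 0"
  have zero: "(0::'a) \<in> ball 0 1" by simp
  have wb: "w n \<in> ball 0 1" for n
    unfolding w_def using ball_isometryD(1) [OF ball_isometry_funpow [OF g'] zero] .
  have gw: "(g ^^ n) ((g' ^^ n) y) = y" if "y \<in> ball 0 1" for n y
    using that
  proof (induction n arbitrary: y)
    case (Suc n)
    have "(g ^^ Suc n) ((g' ^^ Suc n) y) = g ((g ^^ n) ((g' ^^ n) (g' y)))"
      by (simp only: funpow.simps(2) comp_apply funpow_swap1 [of g' n])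
    also have "\<dots> = y"
      using Suc.IH [OF ball_isometryD(1) [OF g' Suc.prems]] inv [OF Suc.prems] by simp
    finally show ?case .
  qed simp
  have wr: "w \<longlonglongrightarrow> r"
    unfolding w_def using ball_isometry_tendsto_transfer
      [OF ball_isometry_funpow [OF g'] x zero lim(3,4)] .
  have ga: "(\<lambda>n. (g ^^ n) 0) \<longlonglongrightarrow> a"
    using ball_isometry_tendsto_transfer [OF ball_isometry_funpow [OF g] x zero lim(1,2)] .
  have nt: "at z within ball (0::'a) 1 \<noteq> bot"
  proof -
    have "z islimpt ball 0 1" using z by (simp add: islimpt_ball)
    then show ?thesis by (simp add: trivial_limit_within)
  qed
  have b: "norm (Lim (at z within ball 0 1) (h n) - (g ^^ n) 0) =
    (1 - (norm (w n))\<^sup>2) / norm (z - w n)" for n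
  proof -
    have "(g ^^ n) (w n) = 0"
      unfolding w_def by (rule gw [OF zero])
    then obtain b where b: "((g ^^ n) \<longlongrightarrow> b) (at z within ball 0 1)"
        "norm (b - (g ^^ n) 0) = (1 - (norm (w n))\<^sup>2) / norm (z - w n)"
      using ball_isometry_boundary_limit [OF ball_isometry_funpow [OF g, of n] wb [of n] _ z(1)]
      by blast
    have "(h n \<longlongrightarrow> b) (at z within ball 0 1)"
      by (rule Lim_transform_within [OF b(1) zero_less_one]) (simp add: h)
    then have "Lim (at z within ball 0 1) (h n) = b"
      by (rule tendsto_Lim [OF nt])
    then show ?thesis using b(2) by simp
  qed
  have "(\<lambda>n. (1 - (norm (w n))\<^sup>2) / norm (z - w n)) \<longlonglongrightarrow> (1 - (norm r)\<^sup>2) / norm (z - r)"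
    using z by (intro tendsto_intros wr) auto
  then have "(\<lambda>n. norm (Lim (at z within ball 0 1) (h n) - (g ^^ n) 0)) \<longlonglongrightarrow> 0"
    by (simp add: b lim)
  then have "(\<lambda>n. Lim (at z within ball 0 1) (h n) - (g ^^ n) 0) \<longlonglongrightarrow> 0"
    by (rule tendsto_norm_zero_cancel)
  then have "(\<lambda>n. (Lim (at z within ball 0 1) (h n) - (g ^^ n) 0) + (g ^^ n) 0) \<longlonglongrightarrow> 0 + a"
    by (intro tendsto_intros ga)
  then show ?thesis by simp
qed

section \<open>Deck transformations\<close>

text \<open>Lifts of \<open>q\<close> through itself are sections of the first projection of the fibre product.
  Unlike \<open>M\<close>, the base of that covering is a subset of a normed space, as the lifting theorems
  require.\<close>

lemma covering_space_fibre_product: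
  fixes q :: "'a::real_normed_vector \<Rightarrow> 'm::topological_space"
  assumes cov: "covering_space c q M"
  shows "covering_space {(x, y). x \<in> c \<and> y \<in> c \<and> q x = q y} fst c"
proof -
  define E where "E = {(x, y). x \<in> c \<and> y \<in> c \<and> q x = q y}"
  have "\<exists>W. x \<in> W \<and> openin (top_of_set c) W \<and>
      (\<exists>v. \<Union>v = E \<inter> fst -` W \<and> (\<forall>u\<in>v. openin (top_of_set E) u) \<and> pairwise disjnt v \<and>
        (\<forall>u\<in>v. \<exists>s. homeomorphism u W fst s))" if x: "x \<in> c" for x
  proof -
    have "q x \<in> M" using cov x covering_space_imp_surjective by blast
    moreover have "\<forall>y\<in>M. \<exists>T. y \<in> T \<and> openin (top_of_set M) T \<and>
        (\<exists>v. \<Union>v = c \<inter> q -` T \<and> (\<forall>u\<in>v. openin (top_of_set c) u) \<and> pairwise disjnt v \<and>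
          (\<forall>u\<in>v. \<exists>s. homeomorphism u T q s))"
      using cov by (simp add: covering_space_def)
    ultimately obtain T v where T: "q x \<in> T"
      and v: "\<Union>v = c \<inter> q -` T" "\<forall>u\<in>v. openin (top_of_set c) u"
        "pairwise disjnt v" "\<forall>u\<in>v. \<exists>s. homeomorphism u T q s"
      by (elim ballE [of _ _ "q x"] exE conjE) auto
    define W where "W = c \<inter> q -` T"
    \<comment> \<open>The sheet over \<open>W\<close> belonging to \<open>u\<close>. As
      \<open>q\<close> is injective on \<open>u\<close>, the second coordinate is recovered from the
      first by the local inverse \<open>s\<close>.\<close>
    define Z where "Z \<equiv> \<lambda>u. E \<inter> (W \<times> u)"
    have vc: "u \<subseteq> c" if "u \<in> v" for u using v(2) that openin_imp_subset by blast
    have "openin (top_of_set c) W"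
      unfolding W_def v(1) [symmetric] using v(2) by blast
    moreover have "\<Union> (Z ` v) = E \<inter> fst -` W"
    proof (intro equalityI subsetI)
      fix p assume p: "p \<in> E \<inter> fst -` W"
      then have "snd p \<in> c \<inter> q -` T"
        by (auto simp: E_def W_def)
      then obtain u where "u \<in> v" "snd p \<in> u"
        unfolding v(1) [symmetric] by blast
      then show "p \<in> \<Union> (Z ` v)"
        using p by (cases p) (auto simp: Z_def)
    qed (auto simp: Z_def)
    moreover have "openin (top_of_set E) (Z u)" if u: "u \<in> v" for u
    proof -
      obtain U where U: "open U" "u = c \<inter> U"
        using v(2) u by (auto simp: openin_open)
      have "Z u = E \<inter> (UNIV \<times> U)"
      proof (intro equalityI subsetI)
        fix p assume p: "p \<in> E \<inter> (UNIV \<times> U)"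
        then have "snd p \<in> u" using U by (auto simp: E_def)
        then have "snd p \<in> c \<inter> q -` T" using v(1) u by blast
        then show "p \<in> Z u" using p \<open>snd p \<in> u\<close> by (auto simp: Z_def E_def W_def)
      qed (use U in \<open>auto simp: Z_def\<close>)
      then show ?thesis
        using U by (auto simp: openin_open intro!: exI [of _ "UNIV \<times> U"] open_Times)
    qed
    moreover have "pairwise disjnt (Z ` v)"
    proof (rule pairwise_imageI)
      fix a b assume "a \<in> v" "b \<in> v" "a \<noteq> b"
      then have "a \<inter> b = {}"
        using v(3) by (auto simp: pairwise_def disjnt_def)
      then show "disjnt (Z a) (Z b)"
        by (auto simp: disjnt_def Z_def)
    qed
    moreover have "\<exists>s. homeomorphism (Z u) W fst s" if u: "u \<in> v" for u
    proof -
      obtain s where s: "homeomorphism u T q s" using v(4) u by blast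
      have st: "s t \<in> u" "q (s t) = t" if "t \<in> T" for t
        using s that by (auto simp: homeomorphism_def)
      have sq: "s (q y) = y" "q y \<in> T" if "y \<in> u" for y
        using s that by (auto simp: homeomorphism_def)
      have qW: "q p \<in> T" "p \<in> c" if "p \<in> W" for p
        using that by (auto simp: W_def)
      have "homeomorphism (Z u) W fst (\<lambda>p. (p, s (q p)))"
      proof (rule homeomorphismI)
        show "continuous_on (Z u) fst"
          by (intro continuous_intros)
        have "continuous_on W q"
          using covering_space_imp_continuous [OF cov] by (rule continuous_on_subset)
            (auto simp: W_def)
        moreover have "continuous_on T s"
          using s by (simp add: homeomorphism_def)
        ultimately show "continuous_on W (\<lambda>p. (p, s (q p)))"
          using qW by (intro continuous_intros continuous_on_compose2 [of T s W q]) auto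
        show "fst ` Z u \<subseteq> W" by (auto simp: Z_def)
        show "(\<lambda>p. (p, s (q p))) ` W \<subseteq> Z u"
          using qW st vc [OF u] by (auto simp: Z_def E_def)
        show "(fst p, s (q (fst p))) = p" if "p \<in> Z u" for p
          using that sq by (auto simp: Z_def E_def)
      qed auto
      then show ?thesis by blast
    qed
    ultimately show ?thesis
      using x T by (intro exI [of _ W] conjI exI [of _ "Z ` v"]) (auto simp: W_def)
  qed
  moreover have "fst ` E = c"
    by (force simp: E_def)
  moreover have "continuous_on E fst"
    by (intro continuous_intros)
  ultimately show ?thesis
    unfolding covering_space_def E_def [symmetric] by blast
qed

text \<open>The identity is lifted through the first projection of the fibre product; the second
  component of the lift is the required map.\<close>

lemma covering_space_self_lift:
  fixes q :: "'a::real_normed_vector \<Rightarrow> 'm::topological_space"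
  assumes cov: "covering_space c q M" and c: "simply_connected c" "locally path_connected c"
    and xy: "x \<in> c" "y \<in> c" "q x = q y"
  obtains h where "continuous_on c h" "\<And>p. p \<in> c \<Longrightarrow> h p \<in> c" "h x = y" "\<And>p. p \<in> c \<Longrightarrow> q (h p) = q p"
proof -
  let ?E = "{(x, y). x \<in> c \<and> y \<in> c \<and> q x = q y}"
  have p: "(x, y) \<in> ?E" "continuous_on c id" "id \<in> c \<rightarrow> c" "id x = fst (x, y)"
    using xy by auto
  obtain k where k: "continuous_on c k" "k \<in> c \<rightarrow> ?E" "k x = (x, y)" "\<And>p. p \<in> c \<Longrightarrow> fst (k p) = id p"
    using covering_space_lift_strong [OF covering_space_fibre_product [OF cov] p(1) xy(1) c p(2-4)]
      by blast
  show thesis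
  proof
    show "continuous_on c (\<lambda>p. snd (k p))"
      by (intro continuous_intros k)
    show "snd (k p) \<in> c" "q (snd (k p)) = q p" if "p \<in> c" for p
    proof -
      have "k p \<in> ?E" using k(2) that by (rule funcset_mem)
      then show "snd (k p) \<in> c" "q (snd (k p)) = q p"
        using k(4) [OF that] by (auto simp: case_prod_unfold)
    qed
  qed (use k in auto)
qed

lemma deck_transformationsD:
  assumes "g \<in> deck_transformations q"
  shows "continuous_on hyp_space g" "\<And>x. x \<in> hyp_space \<Longrightarrow> g x \<in> hyp_space"
    "\<And>x. x \<in> hyp_space \<Longrightarrow> q (g x) = q x" "bij_betw g hyp_space hyp_space" "g \<in> extensional hyp_space"
proof -
  have h: "homeomorphic_map (top_of_set hyp_space) (top_of_set hyp_space) g"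
    using assms by (simp add: deck_transformations_def)
  then have "continuous_map (top_of_set hyp_space) (top_of_set hyp_space) g"
    by (rule homeomorphic_imp_continuous_map)
  then show "continuous_on hyp_space g" "\<And>x. x \<in> hyp_space \<Longrightarrow> g x \<in> hyp_space"
    by auto
  show "\<And>x. x \<in> hyp_space \<Longrightarrow> q (g x) = q x" "g \<in> extensional hyp_space"
    using assms by (auto simp: deck_transformations_def)
  show "bij_betw g hyp_space hyp_space"
    using h by (auto simp: homeomorphic_eq_everything_map bij_betw_def)
qed

text \<open>Both maps lift \<open>q\<close>, so agreement at one point suffices. With the identity
  as one of them, a deck transformation with a fixed point is trivial.\<close>

lemma self_lift_unique:
  assumes cov: "covering_space hyp_space q M"
    and f: "continuous_on hyp_space f" "\<And>x. x \<in> hyp_space \<Longrightarrow> f x \<in> hyp_space"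
      "\<And>x. x \<in> hyp_space \<Longrightarrow> q (f x) = q x"
    and g: "continuous_on hyp_space g" "\<And>x. x \<in> hyp_space \<Longrightarrow> g x \<in> hyp_space"
      "\<And>x. x \<in> hyp_space \<Longrightarrow> q (g x) = q x"
    and x: "x \<in> hyp_space" "f x = g x" and y: "y \<in> hyp_space"
  shows "f y = g y"
proof (rule covering_space_lift_unique [where ?g1.0 = f and ?g2.0 = g and a = x and T = hyp_space
  and f = q, OF cov])
  show "continuous_on hyp_space q" by (rule covering_space_imp_continuous [OF cov])
  show "q \<in> hyp_space \<rightarrow> M" using covering_space_imp_surjective [OF cov] by auto
  show "connected hyp_space" by (simp add: convex_connected)
qed (use f g x y in auto)

text \<open>Lifts taking \<open>x\<close> to \<open>y\<close> and \<open>y\<close> to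
  \<open>x\<close> are mutually inverse by uniqueness, since their composites fix a point. The
  restriction at the end is made because deck transformations are extensional.\<close>

lemma deck_transformations_transitive:
  assumes cov: "covering_space hyp_space q M" and xy: "x \<in> hyp_space" "y \<in> hyp_space" "q x = q y"
  obtains g where "g \<in> deck_transformations q" "g x = y"
proof -
  have c: "simply_connected hyp_space" "locally path_connected hyp_space"
    by (simp_all add: convex_imp_simply_connected convex_imp_locally_path_connected)
  obtain h where h: "continuous_on hyp_space h" "\<And>p. p \<in> hyp_space \<Longrightarrow> h p \<in> hyp_space" "h x = y"
      "\<And>p. p \<in> hyp_space \<Longrightarrow> q (h p) = q p"
    using covering_space_self_lift [OF cov c xy] by blast
  obtain k where k: "continuous_on hyp_space k" "\<And>p. p \<in> hyp_space \<Longrightarrow> k p \<in> hyp_space" "k y = x"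
      "\<And>p. p \<in> hyp_space \<Longrightarrow> q (k p) = q p"
    using covering_space_self_lift [OF cov c xy(2,1) xy(3) [symmetric]] by blast
  have inverse: "k (h p) = p"
    if h: "continuous_on hyp_space h" "\<And>p. p \<in> hyp_space \<Longrightarrow> h p \<in> hyp_space"
      "\<And>p. p \<in> hyp_space \<Longrightarrow> q (h p) = q p"
      and k: "continuous_on hyp_space k" "\<And>p. p \<in> hyp_space \<Longrightarrow> k p \<in> hyp_space"
        "\<And>p. p \<in> hyp_space \<Longrightarrow> q (k p) = q p"
      and x: "x \<in> hyp_space" "k (h x) = x" and p: "p \<in> hyp_space" for h k x p
  proof -
    have 1: "continuous_on hyp_space (\<lambda>p. k (h p))"
      by (rule continuous_on_compose2 [OF k(1) h(1)]) (use h(2) in blast)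
    have 2: "k (h p) \<in> hyp_space" "q (k (h p)) = q p" if "p \<in> hyp_space" for p
      using h(2,3) [OF that] k(2,3) by metis+
    show ?thesis
      by (rule self_lift_unique [where f = "\<lambda>p. k (h p)" and g = "\<lambda>p. p", OF cov 1 2
        continuous_on_id _ refl x p])
  qed
  have kh: "k (h p) = p" if "p \<in> hyp_space" for p
    by (rule inverse [OF h(1,2,4) k(1,2,4) xy(1) _ that]) (auto simp only: h(3) k(3))
  have hk: "h (k p) = p" if "p \<in> hyp_space" for p
    by (rule inverse [OF k(1,2,4) h(1,2,4) xy(2) _ that]) (auto simp only: h(3) k(3))
  have "homeomorphic_maps (top_of_set hyp_space) (top_of_set hyp_space) h k"
    unfolding homeomorphic_maps_def using h(1,2) k(1,2) kh hk by (auto simp del: mem_ball)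
  then have "homeomorphic_map (top_of_set hyp_space) (top_of_set hyp_space) h"
    using homeomorphic_map_maps by blast
  then have "homeomorphic_map (top_of_set hyp_space) (top_of_set hyp_space) (restrict h hyp_space)"
    by (rule homeomorphic_map_eq) simp
  then have "restrict h hyp_space \<in> deck_transformations q"
    using h(4) by (simp add: deck_transformations_def del: mem_ball)
  moreover have "restrict h hyp_space x = y"
    using h(3) xy(1) by (simp del: mem_ball)
  ultimately show thesis by (rule that)
qed

lemma deck_ball_isometry:
  assumes M: "closed_orientable_hyperbolic_3manifold M q" and g: "g \<in> deck_transformations q"
  shows "ball_isometry g"
proof -
  have iso: "orientation_preserving_isometry g"
    using M g by (auto simp: closed_orientable_hyperbolic_3manifold_def deck_group_def)
  have "hgap (g x) (g y) = hgap x y" if x: "x \<in> hyp_space" and y: "y \<in> hyp_space" for x y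
  proof -
    have "hdist (g x) (g y) = hdist x y"
      using iso x y unfolding orientation_preserving_isometry_def by blast
    then have "arcosh (1 + 2 * hgap (g x) (g y)) = arcosh (1 + 2 * hgap x y)"
      by (simp add: hdist_def hgap_def)
    then have "cosh (arcosh (1 + 2 * hgap (g x) (g y))) = cosh (arcosh (1 + 2 * hgap x y))"
      by (rule arg_cong)
    moreover have "1 \<le> 1 + 2 * hgap (g x) (g y)"
      using hgap_nonneg [OF deck_transformationsD(2) [OF g x] deck_transformationsD(2) [OF g y]]
        by linarith
    moreover have "1 \<le> 1 + 2 * hgap x y"
      using hgap_nonneg [OF x y] by linarith
    ultimately have "1 + 2 * hgap (g x) (g y) = 1 + 2 * hgap x y"
      by (simp only: cosh_arcosh_real)
    then show ?thesis by linarith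
  qed
  then show ?thesis
    using deck_transformationsD(2) [OF g] by (simp add: ball_isometry_def)
qed

lemma tendsto_hgap:
  assumes "x \<longlonglongrightarrow> a" "y \<longlonglongrightarrow> b" "a \<in> ball 0 1" "b \<in> ball 0 1"
  shows "(\<lambda>n. hgap (x n) (y n)) \<longlonglongrightarrow> hgap a b"
  unfolding hgap_def
  using ball_norm_square [OF assms(3)] ball_norm_square [OF assms(4)]
  by (intro tendsto_intros assms) auto

text \<open>Coverings are locally homeomorphisms, so every point of \<open>M\<close> has a
  neighbourhood in the image of a ball of radius below 1. By compactness finitely many such radii
  suffice.\<close>

lemma covering_compact_fundamental_set:
  assumes "compact M" "covering_space (ball (0::'a::real_normed_vector) 1) q M"
  obtains \<rho> where "\<rho> < 1" "\<And>m. m \<in> M \<Longrightarrow> \<exists>x\<in>cball 0 \<rho>. q x = m"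
proof -
  define C where "C = {V. openin (top_of_set M) V \<and> (\<exists>\<rho><1. V \<subseteq> q ` cball 0 \<rho>)}"
  have "\<exists>V\<in>C. m \<in> V" if "m \<in> M" for m
  proof -
    obtain x where x: "x \<in> ball 0 1" "q x = m"
      using covering_space_imp_surjective [OF assms(2)] \<open>m \<in> M\<close> by blast
    obtain T u s where T: "x \<in> T" "openin (top_of_set (ball 0 1)) T" "q x \<in> u"
      "openin (top_of_set M) u"
        "homeomorphism T u q s"
      using covering_space_local_homeomorphism [OF assms(2) x(1)] by blast
    define \<rho> where "\<rho> = (norm x + 1) / 2"
    have r: "norm x < \<rho>" "\<rho> < 1" using x by (auto simp: \<rho>_def)
    have "openin (top_of_set T) (T \<inter> ball 0 \<rho>)"
      by (simp add: openin_open_Int)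
    then have "openin (top_of_set u) (q ` (T \<inter> ball 0 \<rho>))"
      by (rule homeomorphism_imp_open_map [OF T(5)])
    then have "openin (top_of_set M) (q ` (T \<inter> ball 0 \<rho>))"
      using T(4) openin_trans by blast
    moreover have "q ` (T \<inter> ball 0 \<rho>) \<subseteq> q ` cball 0 \<rho>"
      by (intro image_mono) auto
    ultimately have "q ` (T \<inter> ball 0 \<rho>) \<in> C"
      using r(2) by (auto simp: C_def)
    moreover have "m \<in> q ` (T \<inter> ball 0 \<rho>)"
      using x T(1) r(1) by auto
    ultimately show ?thesis by (rule bexI [rotated])
  qed
  then have "M \<subseteq> \<Union>C" by blast
  moreover have "\<forall>V\<in>C. openin (top_of_set M) V" by (simp add: C_def)
  ultimately obtain F where F: "F \<subseteq> C" "finite F" "M \<subseteq> \<Union>F"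
    using \<open>compact M\<close> unfolding compact_eq_openin_cover by meson
  have "\<forall>V\<in>F. \<exists>\<rho><1. V \<subseteq> q ` cball 0 \<rho>"
    using F(1) by (auto simp: C_def)
  then obtain r where r: "\<And>V. V \<in> F \<Longrightarrow> r V < (1::real)" "\<And>V. V \<in> F \<Longrightarrow> V \<subseteq> q ` cball 0 (r V)"
    by metis
  \<comment> \<open>Including 0 keeps the maximum defined whether or not \<open>F\<close> is
    empty.\<close>
  define \<rho> where "\<rho> = Max (insert 0 (r ` F))"
  have fin: "finite (insert 0 (r ` F))" using F(2) by simp
  have "\<rho> < 1"
    unfolding \<rho>_def using fin r(1) by (subst Max_less_iff) auto
  moreover have "\<exists>x\<in>cball 0 \<rho>. q x = m" if "m \<in> M" for m
  proof -
    obtain V where V: "V \<in> F" "m \<in> V" using F(3) \<open>m \<in> M\<close> by blast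
    then obtain x where x: "x \<in> cball 0 (r V)" "q x = m" using r(2) by blast
    have "r V \<le> \<rho>" unfolding \<rho>_def using fin V by (intro Max_ge) auto
    then show ?thesis using x by (intro bexI [of _ x]) auto
  qed
  ultimately show thesis by (rule that)
qed

text \<open>A minimizing sequence is moved into a compact set by deck transformations
  \<open>\<gamma>\<^sub>n\<close>; by discreteness the conjugates of \<open>g\<close> by \<open>\<gamma>\<^sub>n\<close> are eventually
  constant.\<close>

lemma minimal_displacement_exists:
  assumes M: "closed_orientable_hyperbolic_3manifold M q" and g: "g \<in> deck_transformations q"
  obtains x where "x \<in> hyp_space" "\<And>y. y \<in> hyp_space \<Longrightarrow> hgap x (g x) \<le> hgap y (g y)"
proof -
  have cov: "covering_space hyp_space q M" and "compact M"
    using M by (auto simp: closed_orientable_hyperbolic_3manifold_def)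
  obtain \<rho> where \<rho>: "\<rho> < 1" "\<And>m. m \<in> M \<Longrightarrow> \<exists>x\<in>cball 0 \<rho>. q x = m"
    using covering_compact_fundamental_set [OF \<open>compact M\<close> cov] by blast
  note gD = deck_transformationsD [OF g]
  have giso: "ball_isometry h" if "h \<in> deck_transformations q" for h
    by (rule deck_ball_isometry [OF M that])
  define D where "D = (\<lambda>y. hgap y (g y)) ` hyp_space"
  have D0: "0 \<le> d" if "d \<in> D" for d
  proof -
    obtain y where "y \<in> hyp_space" "d = hgap y (g y)"
      using \<open>d \<in> D\<close> unfolding D_def by blast
    then show ?thesis using hgap_nonneg gD(2) by blast
  qed
  have bdd: "bdd_below D"
    using D0 by (auto simp: bdd_below_def)
  have Dne: "D \<noteq> {}"
    by (auto simp: D_def)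
  define l where "l = Inf D"
  have "\<forall>n. \<exists>x\<in>hyp_space. hgap x (g x) < l + 1 / Suc n"
  proof
    fix n
    have "\<exists>d\<in>D. d < l + 1 / Suc n"
      unfolding l_def by (rule cInf_lessD [OF Dne]) simp
    then show "\<exists>x\<in>hyp_space. hgap x (g x) < l + 1 / Suc n"
      by (auto simp: D_def)
  qed
  then obtain x where x: "\<And>n. x n \<in> hyp_space" "\<And>n. hgap (x n) (g (x n)) < l + 1 / Suc n"
    by metis
  have lx: "l \<le> hgap y (g y)" if "y \<in> hyp_space" for y
    unfolding l_def using that by (intro cInf_lower bdd) (auto simp: D_def)
  have limx: "(\<lambda>n. hgap (x n) (g (x n))) \<longlonglongrightarrow> l"
  proof (rule tendsto_sandwich [of "\<lambda>_. l" _ sequentially "\<lambda>n. l + 1 / Suc n"])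
    show "(\<lambda>n. l + 1 / Suc n) \<longlonglongrightarrow> l"
      using tendsto_add [OF tendsto_const LIMSEQ_Suc [OF lim_1_over_n], of l] by simp
    show "\<forall>\<^sub>F n in sequentially. l \<le> hgap (x n) (g (x n))"
      using lx x(1) by simp
    show "\<forall>\<^sub>F n in sequentially. hgap (x n) (g (x n)) \<le> l + 1 / Suc n"
      using x(2) less_imp_le by (intro always_eventually allI) blast
  qed simp
  have "\<forall>n. \<exists>\<gamma>. \<gamma> \<in> deck_transformations q \<and> \<gamma> (x n) \<in> cball 0 \<rho>"
  proof
    fix n
    have "q (x n) \<in> M"
      using covering_space_imp_surjective [OF cov] x(1) by blast
    then obtain y where y: "y \<in> cball 0 \<rho>" "q y = q (x n)"
      using \<rho>(2) by blast
    then have "y \<in> hyp_space" using \<rho>(1) by auto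
    then obtain \<gamma> where "\<gamma> \<in> deck_transformations q" "\<gamma> (x n) = y"
      using deck_transformations_transitive [OF cov x(1)] y(2) by metis
    then show "\<exists>\<gamma>. \<gamma> \<in> deck_transformations q \<and> \<gamma> (x n) \<in> cball 0 \<rho>"
      using y(1) by blast
  qed
  then obtain \<gamma> where \<gamma>: "\<And>n. \<gamma> n \<in> deck_transformations q" "\<And>n. \<gamma> n (x n) \<in> cball 0 \<rho>"
    by metis
  define y where "y \<equiv> \<lambda>n. \<gamma> n (x n)"
  define z where "z \<equiv> \<lambda>n. \<gamma> n (g (x n))"
  have gx: "g (x n) \<in> hyp_space" for n using gD(2) x(1) .
  have yb: "y n \<in> hyp_space" "z n \<in> hyp_space" for n
    unfolding y_def z_def
    by (rule deck_transformationsD(2) [OF \<gamma>(1) x(1)], rule deck_transformationsD(2) [OF \<gamma>(1) gx])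
  have qyz: "q (z n) = q (y n)" for n
    unfolding y_def z_def using deck_transformationsD(3) [OF \<gamma>(1)] x(1) gx gD(3) by metis
  have hyz: "hgap (y n) (z n) = hgap (x n) (g (x n))" for n
    unfolding y_def z_def by (rule ball_isometryD(2) [OF giso [OF \<gamma>(1)] x(1) gx])
  \<comment> \<open>Nothing so far keeps \<open>z n\<close> away from the sphere, so its limit is
    first taken in the closed ball.\<close>
  have "\<forall>n. (y n, z n) \<in> cball 0 \<rho> \<times> cball 0 1"
    using \<gamma>(2) yb(2) by (auto simp: y_def intro: less_imp_le)
  moreover have "compact (cball (0::real^3) \<rho> \<times> cball (0::real^3) 1)"
    by (intro compact_Times compact_cball)
  ultimately obtain p \<phi> where p: "p \<in> cball 0 \<rho> \<times> cball 0 1" "strict_mono (\<phi> :: nat \<Rightarrow> nat)"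
      "((\<lambda>n. (y n, z n)) \<circ> \<phi>) \<longlonglongrightarrow> p"
    unfolding compact_def by (elim allE [of _ "\<lambda>n. (y n, z n)"]) auto
  define a b where "a = fst p" and "b = snd p"
  have ab: "a \<in> cball 0 \<rho>" "b \<in> cball 0 1" using p(1) by (auto simp: a_def b_def)
  then have a: "a \<in> hyp_space" using \<rho>(1) by auto
  have ya: "(\<lambda>n. y (\<phi> n)) \<longlonglongrightarrow> a" and zb: "(\<lambda>n. z (\<phi> n)) \<longlonglongrightarrow> b"
    using tendsto_fst [OF p(3)] tendsto_snd [OF p(3)] by (simp_all add: a_def b_def o_def)
  have liml: "(\<lambda>n. hgap (y (\<phi> n)) (z (\<phi> n))) \<longlonglongrightarrow> l"
    using LIMSEQ_subseq_LIMSEQ [OF limx p(2)] by (simp add: hyz o_def)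
  \<comment> \<open>The displacements converge to \<open>l\<close>. For \<open>b\<close> on the
    sphere the limit of the identity \<open>eq\<close> would give \<open>a = b\<close>, although
    \<open>a\<close> lies inside.\<close>
  have "norm b < 1"
  proof (rule ccontr)
    assume "\<not> norm b < 1"
    then have b1: "norm b = 1" using ab by simp
    have eq: "hgap (y n) (z n) * ((1 - (norm (y n))\<^sup>2) * (1 - (norm (z n))\<^sup>2)) =
      (norm (y n - z n))\<^sup>2" for n
      using ball_norm_square [OF yb(1), of n] ball_norm_square [OF yb(2), of n] by
        (simp add: hgap_def)
    have "(\<lambda>n. hgap (y (\<phi> n)) (z (\<phi> n)) * ((1 - (norm (y (\<phi> n)))\<^sup>2) * (1 - (norm (z (\<phi> n)))\<^sup>2)))
        \<longlonglongrightarrow> l * ((1 - (norm a)\<^sup>2) * (1 - (norm b)\<^sup>2))"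
      by (intro tendsto_intros liml ya zb)
    moreover have "(\<lambda>n. (norm (y (\<phi> n) - z (\<phi> n)))\<^sup>2) \<longlonglongrightarrow> (norm (a - b))\<^sup>2"
      by (intro tendsto_intros ya zb)
    ultimately have "l * ((1 - (norm a)\<^sup>2) * (1 - (norm b)\<^sup>2)) = (norm (a - b))\<^sup>2"
      unfolding eq using LIMSEQ_unique by blast
    then have "a = b" using b1 by simp
    then show False using a b1 by simp
  qed
  then have b: "b \<in> hyp_space" by simp
  have contq: "continuous_on hyp_space q" by (rule covering_space_imp_continuous [OF cov])
  have "q b = q a"
  proof -
    have "(\<lambda>n. q (y (\<phi> n))) \<longlonglongrightarrow> q a"
      by (rule continuous_on_tendsto_compose [OF contq ya a]) (use yb in auto)
    moreover have "(\<lambda>n. q (z (\<phi> n))) \<longlonglongrightarrow> q b"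
      by (rule continuous_on_tendsto_compose [OF contq zb b]) (use yb in auto)
    ultimately show ?thesis
      unfolding qyz using LIMSEQ_unique by blast
  qed
  \<comment> \<open>\<open>\<sigma> (y (\<phi> n))\<close> and \<open>z (\<phi> n)\<close> both
    approach \<open>b\<close>, near which \<open>q\<close> is injective, so they agree from some
    \<open>n\<close> on. Then \<open>\<sigma>\<close> is the conjugate of \<open>g\<close> by that
    \<open>\<gamma>\<close>.\<close>
  then obtain \<sigma> where \<sigma>: "\<sigma> \<in> deck_transformations q" "\<sigma> a = b"
    using deck_transformations_transitive [OF cov a b] by metis
  have \<sigma>y: "(\<lambda>n. \<sigma> (y (\<phi> n))) \<longlonglongrightarrow> b"
    unfolding \<sigma>(2) [symmetric]
    by (rule continuous_on_tendsto_compose [OF deck_transformationsD(1) [OF \<sigma>(1)] ya a])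
      (use yb in auto)
  obtain T u s where T: "b \<in> T" "openin (top_of_set hyp_space) T" "homeomorphism T u q s"
    using covering_space_local_homeomorphism [OF cov b] by metis
  obtain T' where T': "open T'" "T = hyp_space \<inter> T'"
    using T(2) by (auto simp: openin_open)
  have "\<forall>\<^sub>F n in sequentially. \<sigma> (y (\<phi> n)) \<in> T' \<and> z (\<phi> n) \<in> T'"
    using topological_tendstoD [OF \<sigma>y T'(1)] topological_tendstoD [OF zb T'(1)] T(1) T'(2)
    by (auto intro: eventually_conj)
  then obtain n where n: "\<sigma> (y (\<phi> n)) \<in> T'" "z (\<phi> n) \<in> T'"
    by (auto simp: eventually_sequentially)
  define k where "k = \<phi> n"
  have mem: "\<sigma> (y k) \<in> T" "z k \<in> T"
    using n yb deck_transformationsD(2) [OF \<sigma>(1)] by (auto simp: k_def T'(2) simp del: mem_ball)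
  moreover have "q (\<sigma> (y k)) = q (z k)"
    using deck_transformationsD(3) [OF \<sigma>(1) yb(1)] qyz by simp
  ultimately have eqz: "\<sigma> (y k) = z k"
    using T(3) unfolding homeomorphism_def by metis
  \<comment> \<open>The infimum is attained at the point whose translate is \<open>a\<close>: there
    the displacement of \<open>g\<close> is that of \<open>\<sigma>\<close> at
    \<open>a\<close>.\<close>
  obtain w where w: "w \<in> hyp_space" "\<gamma> k w = a"
    using deck_transformationsD(4) [OF \<gamma>(1) [of k]] a by (metis bij_betw_iff_bijections)
  have "\<gamma> k (g w) = \<sigma> (\<gamma> k w)"
  proof -
    note G = deck_transformationsD [OF \<gamma>(1) [of k]] and S = deck_transformationsD [OF \<sigma>(1)]
    have 1: "continuous_on hyp_space (\<lambda>p. \<gamma> k (g p))"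
      by (rule continuous_on_compose2 [OF G(1) gD(1)]) (use gD(2) in blast)
    have 2: "\<gamma> k (g p) \<in> hyp_space" "q (\<gamma> k (g p)) = q p" if "p \<in> hyp_space" for p
      using gD(2,3) [OF that] G(2,3) by metis+
    have 3: "continuous_on hyp_space (\<lambda>p. \<sigma> (\<gamma> k p))"
      by (rule continuous_on_compose2 [OF S(1) G(1)]) (use G(2) in blast)
    have 4: "\<sigma> (\<gamma> k p) \<in> hyp_space" "q (\<sigma> (\<gamma> k p)) = q p" if "p \<in> hyp_space" for p
      using G(2,3) [OF that] S(2,3) by metis+
    have 5: "\<gamma> k (g (x k)) = \<sigma> (\<gamma> k (x k))"
      using eqz by (simp add: y_def z_def)
    show ?thesis
      by (rule self_lift_unique [where f = "\<lambda>p. \<gamma> k (g p)" and g = "\<lambda>p. \<sigma> (\<gamma> k p)", OF cov 1 2 3 4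
        x(1) 5 w(1)])
  qed
  then have "hgap w (g w) = hgap a b"
    using ball_isometryD(2) [OF giso [OF \<gamma>(1) [of k]] w(1) gD(2) [OF w(1)]] w(2) \<sigma>(2) by simp
  moreover have "hgap a b = l"
    by (rule LIMSEQ_unique [OF tendsto_hgap [OF ya zb a b] liml])
  ultimately show thesis
    using that [OF w(1)] lx by simp
qed

text \<open>A point of minimal displacement lies on an axis of \<open>g\<close>, whose ends are
  \<open>r\<close> and \<open>a\<close>; it is not fixed, as \<open>g\<close> is nontrivial. The
  maps \<open>h n\<close> need to agree with the iterates only on the ball, which admits the
  extensional powers in the deck group.\<close>

lemma deck_boundary_dynamics:
  assumes M: "closed_orientable_hyperbolic_3manifold M q"
    and g: "g \<in> deck_transformations q" "g' \<in> deck_transformations q"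
    and inv: "\<And>x. x \<in> hyp_space \<Longrightarrow> g' (g x) = x" "\<And>x. x \<in> hyp_space \<Longrightarrow> g (g' x) = x"
    and nontriv: "x\<^sub>0 \<in> hyp_space" "g x\<^sub>0 \<noteq> x\<^sub>0"
  obtains a r where "a \<noteq> r"
    "\<And>z h. \<lbrakk>z \<in> sphere_inf; z \<noteq> r; \<And>n y. y \<in> hyp_space \<Longrightarrow> h n y = (g ^^ n) y\<rbrakk>
       \<Longrightarrow> (\<lambda>n. boundary_action (h n) z) \<longlonglongrightarrow> a"
    "\<And>z h. \<lbrakk>z \<in> sphere_inf; z \<noteq> a; \<And>n y. y \<in> hyp_space \<Longrightarrow> h n y = (g' ^^ n) y\<rbrakk>
       \<Longrightarrow> (\<lambda>n. boundary_action (h n) z) \<longlonglongrightarrow> r"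
proof -
  have cov: "covering_space hyp_space q M"
    using M by (auto simp: closed_orientable_hyperbolic_3manifold_def)
  obtain x where x: "x \<in> hyp_space" "\<And>y. y \<in> hyp_space \<Longrightarrow> hgap x (g x) \<le> hgap y (g y)"
    using minimal_displacement_exists [OF M g(1)] by blast
  note gD = deck_transformationsD [OF g(1)]
  have "g x \<noteq> x"
  proof
    assume "g x = x"
    then have "g x\<^sub>0 = x\<^sub>0"
      by (intro self_lift_unique [where f = g and g = "\<lambda>x. x", OF cov gD(1-3) continuous_on_id _
        refl x(1) _ nontriv(1)])
    then show False using nontriv by simp
  qed
  have iso: "ball_isometry g" "ball_isometry g'"
    by (rule deck_ball_isometry [OF M g(1)], rule deck_ball_isometry [OF M g(2)])
  obtain a r where ar: "norm a = 1" "norm r = 1" "a \<noteq> r"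
    "(\<lambda>n. (g ^^ n) x) \<longlonglongrightarrow> a" "(\<lambda>n. (g' ^^ n) x) \<longlonglongrightarrow> r"
    using translation_orbit_limits [OF iso inv x(1) \<open>g x \<noteq> x\<close> x(2)] by blast
  show thesis
  proof (rule that [OF ar(3)])
    show "(\<lambda>n. boundary_action (h n) z) \<longlonglongrightarrow> a"
      if "z \<in> sphere_inf" "z \<noteq> r" "\<And>n y. y \<in> hyp_space \<Longrightarrow> h n y = (g ^^ n) y" for z h
      unfolding boundary_action_def using that(1)
      by (intro translation_boundary_dynamics [OF iso inv(2) x(1) ar(4,1,5,2) _ that(2,3)]) auto
    show "(\<lambda>n. boundary_action (h n) z) \<longlonglongrightarrow> r"
      if "z \<in> sphere_inf" "z \<noteq> a" "\<And>n y. y \<in> hyp_space \<Longrightarrow> h n y = (g' ^^ n) y" for z h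
      unfolding boundary_action_def using that(1)
      by (intro translation_boundary_dynamics [OF iso(2,1) inv(1) x(1) ar(5,2,4,1) _ that(2,3)])
        auto
  qed
qed

section \<open>Dynamics on the closed disc\<close>

lemma funpow_inverse:
  assumes "homeomorphism X X G G'" "x \<in> X"
  shows "(G' ^^ n) ((G ^^ n) x) = x" "(G ^^ n) ((G' ^^ n) x) = x" "(G ^^ n) x \<in> X" "(G' ^^ n) x \<in> X"
  using homeomorphism_funpow [OF assms(1), of n] assms(2) unfolding homeomorphism_def by auto

lemma funpow_cancel:
  assumes "homeomorphism X X G G'" "x \<in> X" "j \<le> n"
  shows "(G' ^^ j) ((G ^^ n) x) = (G ^^ (n - j)) x"
proof -
  have "(G ^^ n) x = (G ^^ j) ((G ^^ (n - j)) x)"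
    using \<open>j \<le> n\<close> by (metis comp_apply funpow_add le_add_diff_inverse)
  then show ?thesis
    using funpow_inverse(1) [OF assms(1) funpow_inverse(3) [OF assms(1,2)]] by metis
qed

text \<open>By compactness: if backward orbits stay in \<open>W\<close> for longer and longer, the
  backward orbit of a limit point stays there forever. The start \<open>j\<^sub>0\<close> allows for
  points that are themselves outside \<open>W\<close>.\<close>

lemma backward_orbit_limit:
  fixes X :: "'a::metric_space set"
  assumes X: "compact X" and hom: "homeomorphism X X G G'" and W: "closed W"
    and y: "\<And>k. y k \<in> X" and bwd: "\<And>j. j \<ge> j\<^sub>0 \<Longrightarrow> \<forall>\<^sub>F k in sequentially. (G' ^^ j) (y k) \<in> W"
  obtains l \<phi> where "l \<in> X" "strict_mono (\<phi> :: nat \<Rightarrow> nat)" "(\<lambda>k. y (\<phi> k)) \<longlonglongrightarrow> l"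
    "\<And>j. j \<ge> j\<^sub>0 \<Longrightarrow> (G' ^^ j) l \<in> W"
proof -
  obtain l \<phi> where l: "l \<in> X" "strict_mono (\<phi> :: nat \<Rightarrow> nat)" "(y \<circ> \<phi>) \<longlonglongrightarrow> l"
    using X y unfolding compact_def by meson
  have yl: "(\<lambda>k. y (\<phi> k)) \<longlonglongrightarrow> l"
    using l(3) by (simp add: o_def)
  have "(G' ^^ j) l \<in> W" if "j \<ge> j\<^sub>0" for j
  proof -
    have "continuous_on X (G' ^^ j)"
      using homeomorphism_funpow [OF hom, of j] by (simp add: homeomorphism_def)
    then have "(\<lambda>k. (G' ^^ j) (y (\<phi> k))) \<longlonglongrightarrow> (G' ^^ j) l"
      by (rule continuous_on_tendsto_compose [OF _ yl l(1)]) (simp add: y)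
    moreover have "\<forall>\<^sub>F k in sequentially. (G' ^^ j) (y (\<phi> k)) \<in> W"
      by (rule eventually_subseq [OF l(2) bwd [OF that]])
    ultimately show ?thesis
      by (intro Lim_in_closed_set [OF W, of "\<lambda>k. (G' ^^ j) (y (\<phi> k))" sequentially]) auto
  qed
  then show thesis using that l(1,2) yl by blast
qed

text \<open>Points close to \<open>p\<close> whose forward orbits leave \<open>W\<close>, or stay away from \<open>p\<close> for arbitrarily
  long, would accumulate at a second backward orbit inside \<open>W\<close>.\<close>

lemma isolated_backward_orbit_imp_attracting:
  fixes X :: "'a::metric_space set"
  assumes X: "compact X" and hom: "homeomorphism X X G G'" and p: "p \<in> X" "G p = p"
    and W: "closed W" "open Q" "p \<in> Q" "X \<inter> Q \<subseteq> W"
    and iso: "\<And>y. \<lbrakk>y \<in> X; \<And>n. (G' ^^ n) y \<in> W\<rbrakk> \<Longrightarrow> y = p"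
  shows "attracting_fixed_point (top_of_set X) G p"
proof -
  have pn: "(G ^^ n) p = p" for n
    by (induction n) (auto simp: p)
  have cont: "continuous_on X (G ^^ n)" for n
    using homeomorphism_funpow [OF hom, of n] by (simp add: homeomorphism_def)
  have inX: "(G ^^ n) x \<in> X" "(G' ^^ n) x \<in> X" if "x \<in> X" for n x
    using funpow_inverse [OF hom that] by auto
  have "\<exists>e>0. \<forall>x\<in>X. dist p x < e \<longrightarrow> (\<forall>n. (G ^^ n) x \<in> W)"
  proof (rule ccontr)
    assume neg: "\<not> (\<exists>e>0. \<forall>x\<in>X. dist p x < e \<longrightarrow> (\<forall>n. (G ^^ n) x \<in> W))"
    have "\<exists>x\<in>X. dist p x < 1 / Suc k \<and> (\<exists>n. (G ^^ n) x \<notin> W)" for k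
      using neg by (metis of_nat_0_less_iff zero_less_Suc zero_less_divide_1_iff)
    then obtain x where x: "\<And>k. x k \<in> X" "\<And>k. dist p (x k) < 1 / Suc k" "\<And>k. \<exists>n. (G ^^ n) (x k) \<notin> W"
      by metis
    \<comment> \<open>The first exit time. It tends to infinity, because \<open>p\<close> is fixed
      and \<open>x k\<close> tends to \<open>p\<close>.\<close>
    define N where "N \<equiv> \<lambda>k. LEAST n. (G ^^ n) (x k) \<notin> W"
    have N: "(G ^^ N k) (x k) \<notin> W" for k
      unfolding N_def using x(3) LeastI_ex by fast
    have less: "(G ^^ j) (x k) \<in> W" if "j < N k" for j k
      using not_less_Least that unfolding N_def by blast
    have xp: "x \<longlonglongrightarrow> p"
    proof (rule metric_LIMSEQ_I)
      fix r :: real assume "r > 0"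
      then obtain n0 where "1 / Suc n0 < r" using nat_approx_posE by blast
      then have "dist (x n) p < r" if "n \<ge> n0" for n
      proof -
        have "1 / real (Suc n) \<le> 1 / real (Suc n0)"
          using that by (intro divide_left_mono) auto
        then show ?thesis using x(2) [of n] \<open>1 / Suc n0 < r\<close> by (simp add: dist_commute)
      qed
      then show "\<exists>no. \<forall>n\<ge>no. dist (x n) p < r" by blast
    qed
    have near: "\<forall>\<^sub>F k in sequentially. (G ^^ j) (x k) \<in> Q" for j
    proof -
      have "(\<lambda>k. (G ^^ j) (x k)) \<longlonglongrightarrow> (G ^^ j) p"
        by (rule continuous_on_tendsto_compose [OF cont xp p(1)]) (simp add: x)
      then show ?thesis
        using topological_tendstoD W(2,3) unfolding pn by blast
    qed
    have big: "\<forall>\<^sub>F k in sequentially. j < N k" for j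
    proof -
      have "\<forall>\<^sub>F k in sequentially. \<forall>i\<in>{..j}. (G ^^ i) (x k) \<in> Q"
        using near by (intro eventually_ball_finite) auto
      then show ?thesis
      proof eventually_elim
        case (elim k)
        then have "(G ^^ i) (x k) \<in> W" if "i \<le> j" for i
          using W(4) inX(1) [OF x(1)] that by blast
        then show ?case using N [of k] by (meson not_less)
      qed
    qed
    define y where "y \<equiv> \<lambda>k. (G ^^ N k) (x k)"
    have yX: "y k \<in> X" for k
      unfolding y_def by (rule inX(1) [OF x(1)])
    have bwd: "\<forall>\<^sub>F k in sequentially. (G' ^^ j) (y k) \<in> W" if "j \<ge> 1" for j
      using big [of j]
    proof eventually_elim
      case (elim k)
      then have "(G' ^^ j) (y k) = (G ^^ (N k - j)) (x k)"
        unfolding y_def by (intro funpow_cancel [OF hom x(1)]) simp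
      then show ?case using less [of "N k - j" k] that elim by simp
    qed
    obtain l \<phi> where l: "l \<in> X" "strict_mono (\<phi> :: nat \<Rightarrow> nat)" "(\<lambda>k. y (\<phi> k)) \<longlonglongrightarrow> l"
      "\<And>j. j \<ge> 1 \<Longrightarrow> (G' ^^ j) l \<in> W"
      using backward_orbit_limit [OF X hom W(1) yX bwd] by blast
    \<comment> \<open>The exit points lie outside \<open>W\<close>, so membership in
      \<open>W\<close> is known only from \<open>G' l\<close> on; isolation is applied to that
      point.\<close>
    have "G' l = p"
    proof (rule iso)
      show "G' l \<in> X" using inX(2) [OF l(1), of 1] by simp
      show "(G' ^^ n) (G' l) \<in> W" for n
        using l(4) [of "Suc n"] by (simp add: funpow_swap1)
    qed
    then have "l = p"
      using hom l(1) p by (metis homeomorphism_apply2)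
    moreover have "y (\<phi> k) \<notin> Q" for k
      using N [of "\<phi> k"] yX W(4) by (auto simp: y_def)
    then have "l \<notin> Q"
      using l(3) W(2) by (metis (no_types, lifting) closed_sequentially closed_Compl ComplD ComplI)
    ultimately show False using W(3) by simp
  qed
  then obtain e where e: "e > 0" "\<And>x n. \<lbrakk>x \<in> X; dist p x < e\<rbrakk> \<Longrightarrow> (G ^^ n) x \<in> W"
    by blast
  \<comment> \<open>Forward orbits from the ball never leave \<open>W\<close>. Points reached after
    ever longer times therefore have ever longer backward orbits in \<open>W\<close> and accumulate
    only at \<open>p\<close>.\<close>
  have "\<exists>N. \<forall>n\<ge>N. (G ^^ n) ` (X \<inter> ball p e) \<subseteq> V" if V: "openin (top_of_set X) V" "p \<in> V" for V
  proof (rule ccontr)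
    assume "\<not> ?thesis"
    then have "\<forall>k. \<exists>n x. n \<ge> k \<and> x \<in> X \<inter> ball p e \<and> (G ^^ n) x \<notin> V"
      by blast
    then obtain N x where Nx: "\<And>k. N k \<ge> k" "\<And>k. x k \<in> X \<inter> ball p e" "\<And>k. (G ^^ N k) (x k) \<notin> V"
      by metis
    define y where "y \<equiv> \<lambda>k::nat. (G ^^ N k) (x k)"
    have yX: "y k \<in> X" for k
      unfolding y_def using inX(1) Nx(2) by auto
    have bwd: "\<forall>\<^sub>F k in sequentially. (G' ^^ j) (y k) \<in> W" if "j \<ge> 0" for j
      using eventually_ge_at_top [of j]
    proof eventually_elim
      case (elim k)
      have "x k \<in> X" using Nx(2) by auto
      then have "(G' ^^ j) (y k) = (G ^^ (N k - j)) (x k)"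
        unfolding y_def using elim Nx(1) [of k] by (intro funpow_cancel [OF hom]) auto
      then show ?case using e(2) [of "x k"] Nx(2) [of k] by auto
    qed
    obtain l \<phi> where l: "l \<in> X" "strict_mono (\<phi> :: nat \<Rightarrow> nat)" "(\<lambda>k. y (\<phi> k)) \<longlonglongrightarrow> l"
      "\<And>j. j \<ge> 0 \<Longrightarrow> (G' ^^ j) l \<in> W"
      using backward_orbit_limit [OF X hom W(1) yX bwd] by blast
    have "l = p"
      using iso l by blast
    obtain V' where V': "open V'" "V = X \<inter> V'"
      using V(1) by (auto simp: openin_open)
    have "y (\<phi> k) \<notin> V'" for k
      using Nx(3) [of "\<phi> k"] yX V'(2) by (auto simp: y_def)
    then have "l \<notin> V'"
      using l(3) V'(1) by (metis (no_types, lifting) closed_sequentially closed_Compl ComplD ComplI)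
    then show False using \<open>l = p\<close> V(2) V'(2) by auto
  qed
  then show ?thesis
    unfolding attracting_fixed_point_def using p e(1)
    by (intro conjI exI [of _ "X \<inter> ball p e"]) (auto simp: openin_open_Int)
qed

text \<open>A monotone map keeps the orbit of any \<open>x > y\<close> above that of
  \<open>y\<close>. If the latter stayed beyond \<open>R\<close>, so would that of a generic
  \<open>x\<close>, whose values under \<open>e\<close> have to converge to
  \<open>r\<close>.\<close>

lemma backward_orbit_leaves:
  fixes h' :: "real \<Rightarrow> real" and e :: "real \<Rightarrow> 'b::metric_space"
  assumes "mono h'" and "\<delta> > 0" and away: "\<And>x. x > R \<Longrightarrow> \<delta> \<le> dist (e x) r"
    and generic: "\<exists>x>y. e x \<noteq> a" and dyn: "\<And>x. e x \<noteq> a \<Longrightarrow> (\<lambda>n. e ((h' ^^ n) x)) \<longlonglongrightarrow> r"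
  shows "\<exists>n. (h' ^^ n) y \<le> R"
proof (rule ccontr)
  assume "\<not> ?thesis"
  then have y: "(h' ^^ n) y > R" for n by (simp add: not_le)
  obtain x where x: "x > y" "e x \<noteq> a" using generic by blast
  have "(h' ^^ n) x \<ge> (h' ^^ n) y" for n
    using funpow_mono [OF \<open>mono h'\<close>, of y x n] x by simp
  then have "\<delta> \<le> dist (e ((h' ^^ n) x)) r" for n
    using away y less_le_trans by blast
  moreover have "\<forall>\<^sub>F n in sequentially. dist (e ((h' ^^ n) x)) r < \<delta>"
    using dyn [OF x(2)] \<open>\<delta> > 0\<close> by (rule tendstoD)
  ultimately show False
    by (auto simp: eventually_sequentially not_less [symmetric])
qed

section \<open>The Cayley transform taking the boundary point \<open>p\<close> of the disc to
  infinity\<close>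

definition to_half :: "complex \<Rightarrow> complex \<Rightarrow> complex" where
  "to_half p w = \<i> * (p + w) / (p - w)"

definition of_half :: "complex \<Rightarrow> complex \<Rightarrow> complex" where
  "of_half p z = p * (z - \<i>) / (z + \<i>)"

lemma of_half_to_half: "w \<noteq> p \<Longrightarrow> p \<noteq> 0 \<Longrightarrow> of_half p (to_half p w) = w"
proof -
  assume w: "w \<noteq> p" and p: "p \<noteq> 0"
  have "to_half p w - \<i> = 2 * \<i> * w / (p - w)" "to_half p w + \<i> = 2 * \<i> * p / (p - w)"
    using w by (simp_all add: to_half_def field_simps)
  then show ?thesis
    using w p by (simp add: of_half_def)
qed

lemma upper_half_plus_ii: "z \<in> upper_half \<Longrightarrow> z + \<i> \<noteq> 0"
  by (auto simp: upper_half_def complex_eq_iff)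

lemma to_half_of_half:
  assumes "z \<in> upper_half" "p \<noteq> 0"
  shows "to_half p (of_half p z) = z" "of_half p z \<noteq> p"
proof -
  have z: "z + \<i> \<noteq> 0" by (rule upper_half_plus_ii [OF assms(1)])
  have 1: "p + of_half p z = 2 * p * z / (z + \<i>)" and 2: "p - of_half p z = 2 * \<i> * p / (z + \<i>)"
    using z by (simp_all add: of_half_def field_simps)
  show "to_half p (of_half p z) = z"
    unfolding to_half_def 1 2 using z assms by simp
  show "of_half p z \<noteq> p"
    using 2 z assms by auto
qed

text \<open>For \<open>p\<close> on the unit circle this is the Poisson kernel, positive inside the
  disc and zero on the circle away from \<open>p\<close>.\<close>

lemma Im_to_half:
  assumes "w \<noteq> p"
  shows "Im (to_half p w) = ((norm p)\<^sup>2 - (norm w)\<^sup>2) / (norm (p - w))\<^sup>2"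
proof -
  have n: "(norm (p - w))\<^sup>2 \<noteq> 0" using assms by simp
  have "to_half p w = \<i> * ((p + w) * cnj (p - w)) / of_real ((norm (p - w))\<^sup>2)"
  proof -
    have "\<i> * (p + w) / d = \<i> * ((p + w) * cnj d) / (d * cnj d)" if "d \<noteq> 0" for d
      using that by simp
    then show ?thesis
      unfolding to_half_def complex_norm_square using assms by simp
  qed
  then have "Im (to_half p w) = Re ((p + w) * cnj (p - w)) / (norm (p - w))\<^sup>2"
    using n by (simp add: Im_divide_of_real)
  also have "Re ((p + w) * cnj (p - w)) = (norm p)\<^sup>2 - (norm w)\<^sup>2"
    unfolding cmod_power2 by (simp add: power2_eq_square algebra_simps)
  finally show ?thesis .
qed

lemma to_half_upper_half:
  assumes "norm p = 1" "w \<noteq> p" 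
  shows "to_half p w \<in> upper_half \<longleftrightarrow> norm w \<le> 1" "to_half p w \<in> \<real> \<longleftrightarrow> norm w = 1"
proof -
  have n: "(norm (p - w))\<^sup>2 > 0" using assms by simp
  show "to_half p w \<in> upper_half \<longleftrightarrow> norm w \<le> 1"
    using n abs_le_square_iff [of "norm w" 1] by
      (simp add: upper_half_def Im_to_half assms zero_le_divide_iff)
  have "(norm w)\<^sup>2 = 1 \<longleftrightarrow> norm w = 1"
    using power2_eq_iff_nonneg [of "norm w" 1] by simp
  then show "to_half p w \<in> \<real> \<longleftrightarrow> norm w = 1"
    using n by (auto simp: complex_is_Real_iff Im_to_half assms)
qed

lemma to_half_homeomorphism:
  assumes "norm p = 1"
  shows "homeomorphism (cball 0 1 - {p}) upper_half (to_half p) (of_half p)"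
proof (rule homeomorphismI)
  have p: "p \<noteq> 0" using assms by auto
  have of: "norm (of_half p z) \<le> 1" "of_half p z \<noteq> p" if "z \<in> upper_half" for z
  proof -
    show "of_half p z \<noteq> p" using to_half_of_half [OF that p] by blast
    then show "norm (of_half p z) \<le> 1"
      using to_half_upper_half(1) [OF assms] to_half_of_half(1) [OF that p] that by metis
  qed
  show "continuous_on (cball 0 1 - {p}) (to_half p)"
    unfolding to_half_def by (intro continuous_intros) auto
  show "to_half p ` (cball 0 1 - {p}) \<subseteq> upper_half"
    by (rule image_subsetI) (use to_half_upper_half(1) [OF assms] in auto)
  show "continuous_on upper_half (of_half p)"
    unfolding of_half_def by (intro continuous_intros) (simp add: upper_half_plus_ii)
  show "of_half p ` upper_half \<subseteq> cball 0 1 - {p}"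
    using of by auto
  show "of_half p (to_half p w) = w" if "w \<in> cball 0 1 - {p}" for w
    using that p by (intro of_half_to_half) auto
  show "to_half p (of_half p z) = z" if "z \<in> upper_half" for z
    by (rule to_half_of_half(1) [OF that p])
qed

text \<open>As \<open>norm (p + w)\<close> is at most 2, a large value of \<open>to_half p w\<close>
  forces a small \<open>p - w\<close>. The constant 3 makes the estimate strict.\<close>

lemma near_pole_of_to_half:
  assumes "norm p = 1" "e > 0"
  obtains R where "R > 0" "\<And>w. \<lbrakk>w \<in> cball 0 1; w \<noteq> p; R \<le> norm (to_half p w)\<rbrakk> \<Longrightarrow> dist p w < e"
proof
  show "3 / e > 0" using assms by simp
  fix w assume w: "w \<in> cball 0 1" "w \<noteq> p" "3 / e \<le> norm (to_half p w)"
  have "norm (p + w) \<le> 2"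
    using norm_triangle_ineq [of p w] w(1) assms by simp
  then have "norm (to_half p w) * norm (p - w) \<le> 2"
    using w(2) by (simp add: to_half_def norm_mult norm_divide)
  moreover have "3 / e * norm (p - w) \<le> norm (to_half p w) * norm (p - w)"
    using w(3) by (intro mult_right_mono) auto
  ultimately have "3 / e * norm (p - w) \<le> 2" by linarith
  then have "3 * norm (p - w) \<le> 2 * e"
    using assms by (simp add: field_simps)
  then show "dist p w < e"
    using assms by (simp add: dist_norm)
qed

text \<open>The unit disc with a boundary fixed point \<open>p\<close> of \<open>G\<close> moved to infinity.\<close>

locale disc_pole =
  fixes G G' :: "complex \<Rightarrow> complex" and p :: complex
  assumes hom: "homeomorphism (cball 0 1) (cball 0 1) G G'"
    and circle: "\<And>w. w \<in> cball 0 1 \<Longrightarrow> norm (G w) = 1 \<longleftrightarrow> norm w = 1"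
    and pole: "norm p = 1" "G p = p"
begin

definition "f \<equiv> \<lambda>z. to_half p (G (of_half p z))"
definition "f' \<equiv> \<lambda>z. to_half p (G' (of_half p z))"

lemma p_nz: "p \<noteq> 0" using pole by auto

lemma GG: "w \<in> cball 0 1 \<Longrightarrow> G' (G w) = w" "w \<in> cball 0 1 \<Longrightarrow> G (G' w) = w"
    "w \<in> cball 0 1 \<Longrightarrow> G w \<in> cball 0 1" "w \<in> cball 0 1 \<Longrightarrow> G' w \<in> cball 0 1"
  using hom by (auto simp: homeomorphism_def simp del: mem_cball)

lemma p_in: "p \<in> cball 0 1" using pole by simp

lemma pole': "G' p = p"
  using GG(1) [OF p_in] pole by simp

lemma circle': "w \<in> cball 0 1 \<Longrightarrow> norm (G' w) = 1 \<longleftrightarrow> norm w = 1"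
  using circle [OF GG(4)] GG(2) by metis

lemma disc_pole_inverse: "disc_pole G' G p"
  by unfold_locales (use hom homeomorphism_sym circle' pole pole' in auto)

lemma G_ne_p: "w \<in> cball 0 1 \<Longrightarrow> w \<noteq> p \<Longrightarrow> G w \<noteq> p" "w \<in> cball 0 1 \<Longrightarrow> w \<noteq> p \<Longrightarrow> G' w \<noteq> p"
  using GG p_in pole pole' by metis+

lemma of_half_in: "z \<in> upper_half \<Longrightarrow> of_half p z \<in> cball 0 1" "z \<in> upper_half \<Longrightarrow> of_half p z \<noteq> p"
  using homeomorphism_image2 [OF to_half_homeomorphism [OF pole(1)]] by (blast, blast)

lemma to_half_in: "w \<in> cball 0 1 \<Longrightarrow> w \<noteq> p \<Longrightarrow> to_half p w \<in> upper_half"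
  using to_half_upper_half(1) [OF pole(1)] by simp

lemma f_homeomorphism: "homeomorphism upper_half upper_half f f'"
proof -
  let ?D = "cball 0 1 - {p}"
  note T = to_half_homeomorphism [OF pole(1)]
  have "homeomorphism ?D ?D G G'"
  proof (rule homeomorphismI)
    show "continuous_on ?D G" "continuous_on ?D G'"
      using hom by (auto simp: homeomorphism_def intro: continuous_on_subset)
    show "G ` ?D \<subseteq> ?D"
      by (rule image_subsetI) (use GG(3) G_ne_p(1) in blast)
    show "G' ` ?D \<subseteq> ?D"
      by (rule image_subsetI) (use GG(4) G_ne_p(2) in blast)
  qed (use GG in auto)
  then have "homeomorphism upper_half upper_half (to_half p \<circ> (G \<circ> of_half p)) ((to_half p \<circ> G') \<circ> of_half p)"
    using homeomorphism_compose homeomorphism_symD T by metis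
  then show ?thesis
    by (simp add: f_def f'_def comp_def)
qed

lemma f_real: "z \<in> upper_half \<Longrightarrow> f z \<in> \<real> \<longleftrightarrow> z \<in> \<real>"
proof -
  assume z: "z \<in> upper_half"
  note o = of_half_in [OF z]
  have "f z \<in> \<real> \<longleftrightarrow> norm (G (of_half p z)) = 1"
    unfolding f_def by (rule to_half_upper_half(2) [OF pole(1) G_ne_p(1) [OF o]])
  also have "\<dots> \<longleftrightarrow> norm (of_half p z) = 1"
    by (rule circle [OF o(1)])
  also have "\<dots> \<longleftrightarrow> z \<in> \<real>"
    using to_half_upper_half(2) [OF pole(1) o(2)] to_half_of_half(1) [OF z p_nz] by simp
  finally show ?thesis .
qed

lemma of_half_f: "z \<in> upper_half \<Longrightarrow> of_half p (f z) = G (of_half p z)"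
  unfolding f_def using of_half_in [of z] G_ne_p(1) [of "of_half p z"] of_half_to_half p_nz by blast

lemma of_half_funpow: "z \<in> upper_half \<Longrightarrow> of_half p ((f ^^ n) z) = (G ^^ n) (of_half p z)"
proof (induction n)
  case (Suc n)
  then show ?case
    using of_half_f [OF funpow_inverse(3) [OF f_homeomorphism Suc.prems, of n]] by simp
qed simp

lemma fixed_iff: "z \<in> upper_half \<Longrightarrow> f z = z \<longleftrightarrow> G (of_half p z) = of_half p z"
  using of_half_f [of z] to_half_of_half(1) [OF _ p_nz, of z] by (metis f_def)

lemma fixed_points_disc:
  "{w \<in> cball 0 1. G w = w} = insert p (of_half p ` {z \<in> upper_half. f z = z})"
proof (intro equalityI subsetI)
  fix w assume w: "w \<in> {w \<in> cball 0 1. G w = w}"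
  show "w \<in> insert p (of_half p ` {z \<in> upper_half. f z = z})"
  proof (cases "w = p")
    case False
    have t: "to_half p w \<in> upper_half" using to_half_in w False by blast
    have o: "of_half p (to_half p w) = w" by (rule of_half_to_half [OF False p_nz])
    then have "f (to_half p w) = to_half p w"
      using fixed_iff [OF t] w by simp
    then show ?thesis using t o by (metis (mono_tags, lifting) image_eqI insertCI mem_Collect_eq)
  qed simp
next
  fix w assume "w \<in> insert p (of_half p ` {z \<in> upper_half. f z = z})"
  then show "w \<in> {w \<in> cball 0 1. G w = w}"
    using fixed_iff of_half_in(1) p_in pole by (auto simp del: mem_cball)
qed

lemma openin_of_half:
  assumes "openin (top_of_set (cball 0 1)) V"
  shows "openin (top_of_set upper_half) {z \<in> upper_half. of_half p z \<in> V}"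
proof -
  have c: "continuous_on upper_half (of_half p)"
    using to_half_homeomorphism [OF pole(1)] by (simp add: homeomorphism_def)
  obtain T where T: "open T" "V = cball 0 1 \<inter> T"
    using assms by (auto simp: openin_open)
  have "{z \<in> upper_half. of_half p z \<in> V} = upper_half \<inter> of_half p -` T"
    using of_half_in(1) by (auto simp: T(2) simp del: mem_cball)
  then show ?thesis
    using continuous_openin_preimage_gen [OF c T(1)] by simp
qed

lemma openin_to_half:
  assumes "open V"
  shows "openin (top_of_set (cball 0 1)) {w \<in> cball 0 1. w \<noteq> p \<and> to_half p w \<in> V}"
proof -
  have c: "continuous_on (cball 0 1 - {p}) (to_half p)"
    using to_half_homeomorphism [OF pole(1)] by (simp add: homeomorphism_def)
  have "{w \<in> cball 0 1. w \<noteq> p \<and> to_half p w \<in> V} = (cball 0 1 - {p}) \<inter> to_half p -` V"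
    by auto
  then have "openin (top_of_set (cball 0 1 - {p})) {w \<in> cball 0 1. w \<noteq> p \<and> to_half p w \<in> V}"
    using continuous_openin_preimage_gen [OF c assms] by simp
  moreover have "openin (top_of_set (cball 0 1)) (cball 0 1 - {p})"
    by (auto simp: openin_open intro!: exI [of _ "- {p}"])
  ultimately show ?thesis
    using openin_trans by blast
qed

text \<open>Attraction is uniform on \<open>U\<close>, which controls all late iterates at once. The
  finitely many early ones are controlled by continuity at the fixed point.\<close>

lemma attracting_imp_attracts_discs:
  assumes att: "attracting_fixed_point (top_of_set (cball 0 1)) G (of_half p (complex_of_real x))"
  shows "attracts_discs f x"
  unfolding attracts_discs_def
proof (intro allI impI)
  fix R :: real assume R: "R > 0"
  let ?x = "complex_of_real x"
  obtain U where U: "openin (top_of_set (cball 0 1)) U" "of_half p ?x \<in> U"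
    and fx: "G (of_half p ?x) = of_half p ?x"
    and Uat: "\<And>V. \<lbrakk>openin (top_of_set (cball 0 1)) V; of_half p ?x \<in> V\<rbrakk> \<Longrightarrow>
      \<exists>N. \<forall>n\<ge>N. (G ^^ n) ` U \<subseteq> V"
    using att unfolding attracting_fixed_point_def by blast
  have late: "\<exists>N. \<forall>n\<ge>N. \<forall>z\<in>upper_half. of_half p z \<in> U \<longrightarrow> dist ?x ((f ^^ n) z) < s" if s: "s > 0"
    for s
  proof -
    have "of_half p ?x \<in> {w \<in> cball 0 1. w \<noteq> p \<and> to_half p w \<in> ball ?x s}"
      using of_half_in [of ?x] to_half_of_half(1) [of ?x p] p_nz s by simp
    then obtain N where N: "\<And>n. n \<ge> N \<Longrightarrow> (G ^^ n) ` U \<subseteq> {w \<in> cball 0 1. w \<noteq> p \<and>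
      to_half p w \<in> ball ?x s}"
      using Uat [OF openin_to_half [OF open_ball]] by blast
    have "dist ?x ((f ^^ n) z) < s" if n: "n \<ge> N" and z: "z \<in> upper_half" "of_half p z \<in> U" for n z
    proof -
      have "(G ^^ n) (of_half p z) \<in> {w \<in> cball 0 1. w \<noteq> p \<and> to_half p w \<in> ball ?x s}"
        using N [OF n] z(2) by blast
      moreover have "to_half p ((G ^^ n) (of_half p z)) = (f ^^ n) z"
        using of_half_funpow [OF z(1)] to_half_of_half(1)
          [OF funpow_inverse(3) [OF f_homeomorphism z(1)] p_nz] by metis
      ultimately show ?thesis by simp
    qed
    then show ?thesis by blast
  qed
  obtain N where N: "\<And>n z. \<lbrakk>n \<ge> N; z \<in> upper_half; of_half p z \<in> U\<rbrakk> \<Longrightarrow> dist ?x ((f ^^ n) z) < R"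
    using late [OF R] by blast
  have "f ?x = ?x" using fixed_iff [of ?x] fx by simp
  then have fn: "(f ^^ n) ?x = ?x" for n by (induction n) auto
  define S where "S = {z \<in> upper_half. of_half p z \<in> U} \<inter> (\<Inter>j\<in>{..<N}. {z \<in> upper_half. (f ^^ j) z \<in>
    ball ?x R}) \<inter> upper_half"
  have "openin (top_of_set upper_half) {z \<in> upper_half. (f ^^ j) z \<in> ball ?x R}" for j
  proof -
    have "continuous_on upper_half (f ^^ j)"
      using homeomorphism_funpow [OF f_homeomorphism, of j] by (simp add: homeomorphism_def)
    then show ?thesis
      using continuous_openin_preimage_gen [OF _ open_ball, of upper_half "f ^^ j" ?x R]
      by (simp add: vimage_def Int_def)
  qed
  then have "openin (top_of_set upper_half) S"
  proof (cases "N = 0")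
    case True
    then show ?thesis
      using openin_of_half [OF U(1)] by (auto simp: S_def)
  next
    case False
    then show ?thesis
      unfolding S_def using openin_of_half [OF U(1)]
        \<open>\<And>j. openin (top_of_set upper_half) {z \<in> upper_half. (f ^^ j) z \<in> ball ?x R}\<close>
      by (intro openin_Int openin_INT2) auto
  qed
  moreover have "?x \<in> S"
    using U(2) fn R by (simp add: S_def)
  ultimately obtain e where e: "e > 0" "ball ?x e \<inter> upper_half \<subseteq> S"
    using openin_contains_ball by metis
  \<comment> \<open>Halved, because \<open>disc_trapped\<close> speaks of closed discs.\<close>
  define s where "s = e / 2"
  have s: "s > 0" using e by (simp add: s_def)
  have inS: "z \<in> S" if "z \<in> upper_half" "dist ?x z \<le> s" for z
  proof -
    have "z \<in> ball ?x e" using that e(1) by (simp add: s_def)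
    then show ?thesis using e(2) that(1) by blast
  qed
  obtain N' where N': "\<And>n z. \<lbrakk>n \<ge> N'; z \<in> upper_half; of_half p z \<in> U\<rbrakk> \<Longrightarrow> dist ?x ((f ^^ n) z) <
    s / 2"
    using late [of "s / 2"] s by auto
  have "disc_trapped f x (s / 2) s (Suc N') R"
    unfolding disc_trapped_def
  proof (intro conjI ballI impI allI)
    fix z assume z: "z \<in> upper_half" "dist ?x z \<le> s"
    then have zS: "z \<in> S" using inS by blast
    then have zU: "of_half p z \<in> U" by (simp add: S_def)
    show "dist ?x ((f ^^ Suc N') z) < s / 2"
      by (rule N' [OF _ z(1) zU]) simp
    fix j
    show "dist ?x ((f ^^ j) z) < R"
    proof (cases "j < N")
      case True
      then show ?thesis using zS by (simp add: S_def)
    next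
      case False
      then show ?thesis using N z(1) zU by simp
    qed
  qed (use s in auto)
  then show "\<exists>\<rho>\<^sub>0 \<rho>\<^sub>1 m. disc_trapped f x \<rho>\<^sub>0 \<rho>\<^sub>1 m R" by blast
qed

text \<open>Near infinity the inverse pushes outwards: a point that is far out after
  \<open>m\<close> steps was even further out before. So \<open>f ^^ m\<close> pulls a large half
  disc into a smaller one.\<close>

lemma repelling_pole_imp_disc_trapped:
  assumes rep: "attracting_fixed_point (top_of_set (cball 0 1)) G' p" 
    and fin: "finite {z \<in> upper_half. f z = z}"
  obtains \<rho>\<^sub>0 \<rho>\<^sub>1 m R where "disc_trapped f 0 \<rho>\<^sub>0 \<rho>\<^sub>1 m R"
    "\<And>z. \<lbrakk>z \<in> upper_half; f z = z\<rbrakk> \<Longrightarrow> norm z \<le> \<rho>\<^sub>0"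
proof -
  obtain U where U: "openin (top_of_set (cball 0 1)) U" "p \<in> U"
    and Uat: "\<And>V. \<lbrakk>openin (top_of_set (cball 0 1)) V; p \<in> V\<rbrakk> \<Longrightarrow> \<exists>N. \<forall>n\<ge>N. (G' ^^ n) ` U \<subseteq> V"
    using rep unfolding attracting_fixed_point_def by blast
  obtain e where e: "e > 0" "ball p e \<inter> cball 0 1 \<subseteq> U"
    using U openin_contains_ball by metis
  obtain R1 where R1: "R1 > 0" "\<And>w. \<lbrakk>w \<in> cball 0 1; w \<noteq> p; R1 \<le> norm (to_half p w)\<rbrakk> \<Longrightarrow> dist p w < e"
    using near_pole_of_to_half [OF pole(1) e(1)] by blast
  obtain B where B: "\<And>z. \<lbrakk>z \<in> upper_half; f z = z\<rbrakk> \<Longrightarrow> norm z \<le> B"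
    using finite_imp_bounded [OF fin] by (auto simp: bounded_iff)
  define \<rho> where "\<rho> = max R1 B"
  have far: "of_half p z \<in> U" if "z \<in> upper_half" "\<rho> \<le> norm z" for z
  proof -
    have "dist p (of_half p z) < e"
      by (rule R1(2) [OF of_half_in [OF that(1)]])
        (use that to_half_of_half(1) [OF that(1) p_nz] in \<open>simp add: \<rho>_def\<close>)
    then show ?thesis using e(2) of_half_in(1) [OF that(1)] by auto
  qed
  \<comment> \<open>The pole is listed separately, since division by zero makes
    \<open>to_half p p\<close> equal to 0.\<close>
  let ?V = "{w \<in> cball 0 1. w = p \<or> \<rho> + 1 < norm (to_half p w)}"
  have "openin (top_of_set (cball 0 1)) ?V"
  proof -
    have "continuous_on upper_half (of_half p)"
      using to_half_homeomorphism [OF pole(1)] by (simp add: homeomorphism_def)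
    then have "compact (of_half p ` (upper_half \<inter> cball 0 (\<rho> + 1)))"
      by (intro compact_continuous_image closed_Int_compact closed_upper_half compact_cball)
         (auto intro: continuous_on_subset)
    then have cl: "closed (of_half p ` (upper_half \<inter> cball 0 (\<rho> + 1)))"
      by (rule compact_imp_closed)
    have "?V = cball 0 1 - of_half p ` (upper_half \<inter> cball 0 (\<rho> + 1))"
    proof (intro equalityI subsetI)
      fix w assume w: "w \<in> ?V"
      have "w \<notin> of_half p ` (upper_half \<inter> cball 0 (\<rho> + 1))"
      proof
        assume "w \<in> of_half p ` (upper_half \<inter> cball 0 (\<rho> + 1))"
        then obtain z where z: "z \<in> upper_half" "norm z \<le> \<rho> + 1" "w = of_half p z" by auto
        then show False
          using w of_half_in(2) [OF z(1)] to_half_of_half(1) [OF z(1) p_nz] by simp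
      qed
      then show "w \<in> cball 0 1 - of_half p ` (upper_half \<inter> cball 0 (\<rho> + 1))" using w by simp
    next
      fix w assume w: "w \<in> cball 0 1 - of_half p ` (upper_half \<inter> cball 0 (\<rho> + 1))"
      show "w \<in> ?V"
      proof (cases "w = p")
        case False
        have "to_half p w \<in> upper_half" using to_half_in w False by blast
        moreover have "w = of_half p (to_half p w)" using of_half_to_half [OF False p_nz] by simp
        ultimately have "\<not> norm (to_half p w) \<le> \<rho> + 1" using w by auto
        then show ?thesis using w by simp
      qed (use p_in in simp)
    qed
    then show ?thesis
      using cl by (auto simp: openin_open intro!: exI [of _
        "- of_half p ` (upper_half \<inter> cball 0 (\<rho> + 1))"])
  qed
  then obtain N where N: "\<And>n. n \<ge> N \<Longrightarrow> (G' ^^ n) ` U \<subseteq> ?V"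
    using Uat [of ?V] p_in by blast
  define m where "m = Suc N"
  have trap: "norm ((f ^^ m) z) < \<rho>" if z: "z \<in> upper_half" "norm z \<le> \<rho> + 1" for z
  proof (rule ccontr)
    assume "\<not> norm ((f ^^ m) z) < \<rho>"
    then have "of_half p ((f ^^ m) z) \<in> U"
      using far funpow_inverse(3) [OF f_homeomorphism z(1)] by simp
    then have "(G ^^ m) (of_half p z) \<in> U"
      using of_half_funpow [OF z(1)] by simp
    then have "(G' ^^ m) ((G ^^ m) (of_half p z)) \<in> ?V"
      using N [of m] by (auto simp: m_def simp del: funpow.simps)
    then have "of_half p z \<in> ?V"
      using funpow_inverse(1) [OF hom of_half_in(1) [OF z(1)]] by simp
    then show False
      using z(2) of_half_in(2) [OF z(1)] to_half_of_half(1) [OF z(1) p_nz] by simp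
  qed
  have "\<exists>R. \<forall>j<m. \<forall>z\<in>upper_half. norm z \<le> \<rho> + 1 \<longrightarrow> norm ((f ^^ j) z) < R"
  proof -
    have "bounded (\<Union>j<m. (f ^^ j) ` (upper_half \<inter> cball 0 (\<rho> + 1)))"
    proof (intro bounded_UN ballI)
      fix j
      have "continuous_on upper_half (f ^^ j)"
        using homeomorphism_funpow [OF f_homeomorphism, of j] by (simp add: homeomorphism_def)
      then have "compact ((f ^^ j) ` (upper_half \<inter> cball 0 (\<rho> + 1)))"
        by (intro compact_continuous_image closed_Int_compact closed_upper_half compact_cball)
           (auto intro: continuous_on_subset)
      then show "bounded ((f ^^ j) ` (upper_half \<inter> cball 0 (\<rho> + 1)))"
        by (rule compact_imp_bounded)
    qed simp
    then obtain B where B: "\<And>w. w \<in> (\<Union>j<m. (f ^^ j) ` (upper_half \<inter> cball 0 (\<rho> + 1))) \<Longrightarrow> norm w \<le> B"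
      unfolding bounded_iff by blast
    have "norm ((f ^^ j) z) < B + 1" if "j < m" "z \<in> upper_half" "norm z \<le> \<rho> + 1" for j z
    proof -
      have "(f ^^ j) z \<in> (\<Union>j<m. (f ^^ j) ` (upper_half \<inter> cball 0 (\<rho> + 1)))"
        using that by (intro UN_I [of j] imageI) auto
      then show ?thesis using B by fastforce
    qed
    then show ?thesis by blast
  qed
  then obtain R where R: "\<And>j z. \<lbrakk>j < m; z \<in> upper_half; norm z \<le> \<rho> + 1\<rbrakk> \<Longrightarrow> norm ((f ^^ j) z) < R"
    by blast
  have "\<rho> > 0" using R1(1) by (simp add: \<rho>_def)
  then have "disc_trapped f 0 \<rho> (\<rho> + 1) m R"
    using trap R by (simp add: disc_trapped_def m_def del: funpow.simps)
  moreover have "norm z \<le> \<rho>" if "z \<in> upper_half" "f z = z" for z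
    using B [OF that] by (simp add: \<rho>_def)
  ultimately show thesis by (rule that)
qed

end

text \<open>The action of \<open>g\<close> on the compactified flowspace, read in the unit disc:
  \<open>ep\<close> and \<open>em\<close> are the extended endpoint maps, \<open>a\<close> and
  \<open>r\<close> the attracting and the repelling point at infinity. \<open>differ\<close>
  expresses that flowlines have distinct ends, \<open>light\<close> that the fibres on the circle
  are totally disconnected.\<close>

locale disc_dynamics =
  fixes G G' :: "complex \<Rightarrow> complex" and ep em :: "complex \<Rightarrow> 'b::metric_space" and a r :: 'b
  assumes hom: "homeomorphism (cball 0 1) (cball 0 1) G G'"
    and circle: "\<And>w. w \<in> cball 0 1 \<Longrightarrow> norm (G w) = 1 \<longleftrightarrow> norm w = 1"
    and no_fixed: "\<And>w. norm w < 1 \<Longrightarrow> G w \<noteq> w"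
    and cont: "continuous_on (cball 0 1) ep" "continuous_on (cball 0 1) em"
    and agree: "\<And>w. norm w = 1 \<Longrightarrow> ep w = em w"
    and differ: "\<And>w. norm w < 1 \<Longrightarrow> ep w \<noteq> em w"
    and ar: "a \<noteq> r"
    and forward: "\<And>w. w \<in> cball 0 1 \<Longrightarrow> ep w \<noteq> r \<Longrightarrow> (\<lambda>n. ep ((G ^^ n) w)) \<longlonglongrightarrow> a"
      "\<And>w. w \<in> cball 0 1 \<Longrightarrow> em w \<noteq> r \<Longrightarrow> (\<lambda>n. em ((G ^^ n) w)) \<longlonglongrightarrow> a"
    and backward: "\<And>w. w \<in> cball 0 1 \<Longrightarrow> ep w \<noteq> a \<Longrightarrow> (\<lambda>n. ep ((G' ^^ n) w)) \<longlonglongrightarrow> r"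
      "\<And>w. w \<in> cball 0 1 \<Longrightarrow> em w \<noteq> a \<Longrightarrow> (\<lambda>n. em ((G' ^^ n) w)) \<longlonglongrightarrow> r"
    and light: "\<And>C z. \<lbrakk>connected C; C \<subseteq> sphere 0 1; \<And>w. w \<in> C \<Longrightarrow> ep w = z\<rbrakk> \<Longrightarrow> \<exists>x. C \<subseteq> {x}"
begin

text \<open>Passing to the inverse exchanges \<open>a\<close> and \<open>r\<close>, so each
  statement about one of them has a counterpart for the other.\<close>

lemma inverse: "disc_dynamics G' G ep em r a"
proof -
  have in': "G' w \<in> cball 0 1" "G (G' w) = w" if "w \<in> cball 0 1" for w
    using hom that by (auto simp: homeomorphism_def simp del: mem_cball)
  show ?thesis
  proof
    show "homeomorphism (cball 0 1) (cball 0 1) G' G"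
      using hom by (rule homeomorphism_symD)
    show "norm (G' w) = 1 \<longleftrightarrow> norm w = 1" if "w \<in> cball 0 1" for w
      using circle [OF in'(1) [OF that]] in'(2) [OF that] by simp
    show "G' w \<noteq> w" if "norm w < 1" for w
      using no_fixed [OF that] in'(2) [of w] that by auto
  qed (use cont agree differ ar forward backward light in auto)
qed

lemma fixed_on_circle:
  assumes "w \<in> cball 0 1" "G w = w"
  shows "norm w = 1" "ep w = a \<or> ep w = r"
proof -
  show "norm w = 1"
    using no_fixed [of w] assms by force
  have "(G ^^ n) w = w" for n
    by (induction n) (auto simp: assms)
  then show "ep w = a \<or> ep w = r"
    using forward(1) [OF assms(1)] LIMSEQ_unique [of "\<lambda>n. ep w" a "ep w"] by auto
qed

text \<open>It suffices that \<open>p\<close> alone has its backward orbit in a neighbourhood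
  \<open>W\<close> where both endpoint maps stay away from \<open>r\<close>. With \<open>p\<close>
  at infinity the circle becomes the real line, whose order lets a trapped orbit drag generic points
  along.\<close>

lemma attracting:
  assumes p: "norm p = 1" "G p = p" "ep p = a"
  shows "attracting_fixed_point (top_of_set (cball 0 1)) G p"
proof -
  interpret disc_pole G G' p
    by unfold_locales (use hom circle p in auto)
  have emp: "em p = a" using agree p by simp
  define \<delta> where "\<delta> = dist a r / 2"
  have \<delta>: "\<delta> > 0" "\<delta> < dist a r" using ar by (simp_all add: \<delta>_def)
  obtain e1 where e1: "e1 > 0" "\<And>w. \<lbrakk>w \<in> cball 0 1; dist w p < e1\<rbrakk> \<Longrightarrow> dist (ep w) a < \<delta>"
    using cont(1) p_in \<delta>(1) p(3) unfolding continuous_on_iff by metis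
  obtain e2 where e2: "e2 > 0" "\<And>w. \<lbrakk>w \<in> cball 0 1; dist w p < e2\<rbrakk> \<Longrightarrow> dist (em w) a < \<delta>"
    using cont(2) p_in \<delta>(1) emp unfolding continuous_on_iff by metis
  have "min e1 e2 > 0" using e1(1) e2(1) by simp
  then obtain R0 where R0: "R0 > 0" "\<And>w. \<lbrakk>w \<in> cball 0 1; w \<noteq> p; R0 \<le> norm (to_half p w)\<rbrakk> \<Longrightarrow> dist p w
    < min e1 e2"
    using near_pole_of_to_half [OF p(1)] by blast
  have far: "\<delta> \<le> dist b r" if "dist b a < \<delta>" for b
    using that dist_triangle [of a r b] by (simp add: \<delta>_def dist_commute)
  have away: "\<delta> \<le> dist (ep w) r" "\<delta> \<le> dist (em w) r"
    if w: "w \<in> cball 0 1" "w = p \<or> R0 \<le> norm (to_half p w)" for w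
  proof -
    have "dist w p < min e1 e2"
      using R0(2) [OF w(1)] w(2) e1(1) e2(1) by (cases "w = p") (auto simp: dist_commute)
    then have d: "dist (ep w) a < \<delta>" "dist (em w) a < \<delta>"
      using e1(2) [OF w(1)] e2(2) [OF w(1)] by auto
    show "\<delta> \<le> dist (ep w) r" "\<delta> \<le> dist (em w) r"
      by (rule far [OF d(1)], rule far [OF d(2)])
  qed
  have fU: "f z \<in> upper_half" "f' z \<in> upper_half" "f' (f z) = z" "f (f' z) = z" if "z \<in> upper_half"
    for z
    using f_homeomorphism that by (auto simp: homeomorphism_def)
  have f'_real: "f' z \<in> \<real> \<longleftrightarrow> z \<in> \<real>" if "z \<in> upper_half" for z
    using f_real [OF fU(2) [OF that]] fU(4) [OF that] by simp
  define t where "t \<equiv> \<lambda>x. Re (f (complex_of_real x))"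
  define t' where "t' \<equiv> \<lambda>x. Re (f' (complex_of_real x))"
  have ft: "f (complex_of_real x) = complex_of_real (t x)" for x
    using f_real [of "complex_of_real x"] by (simp add: t_def)
  have ft': "f' (complex_of_real x) = complex_of_real (t' x)" for x
    using f'_real [of "complex_of_real x"] by (simp add: t'_def)
  have tt': "t (t' x) = x" "t' (t x) = x" for x
    using fU(3,4) [of "complex_of_real x"] by (simp_all add: ft ft')
  have "continuous_on UNIV t'"
    unfolding t'_def
    by (intro continuous_on_Re continuous_on_compose2 [OF homeomorphism_cont2 [OF f_homeomorphism],
      of UNIV complex_of_real]
        continuous_on_of_real continuous_on_id image_subsetI) simp
  moreover have "inj t'"
    using tt'(1) by (metis injI)
  ultimately have mono': "strict_mono t' \<or> strict_antimono_on UNIV t'"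
    using injective_eq_monotone_map [OF is_interval_univ, of t'] by blast
  \<comment> \<open>The second iterate of the inverse is increasing, whether \<open>G\<close>
    preserves or reverses the orientation of the circle.\<close>
  define h' where "h' \<equiv> \<lambda>x. t' (t' x)"
  have hinv: "h' (t (t x)) = x" for x
    by (simp add: h'_def tt')
  have hmono: "h' x \<le> h' y" if "x \<le> y" for x y
    using mono'
  proof
    assume "strict_mono t'"
    then show ?thesis using that by (simp add: h'_def strict_mono_less_eq)
  next
    assume "strict_antimono_on UNIV t'"
    then have anti: "t' v < t' u" if "u < v" for u v
      using that by (auto simp: monotone_on_def)
    have "t' v \<le> t' u" if "u \<le> v" for u v
      using anti [of u v] that by (cases "u = v") auto
    then show ?thesis using that by (simp add: h'_def)
  qed
  let ?q = "\<lambda>x. of_half p (complex_of_real x)"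
  have q: "?q x \<in> cball 0 1" "?q x \<noteq> p" "norm (?q x) = 1" "to_half p (?q x) = complex_of_real x"
    for x
  proof -
    show 1: "?q x \<in> cball 0 1" "?q x \<noteq> p" by (rule of_half_in, simp)+
    show 2: "to_half p (?q x) = complex_of_real x" by (rule to_half_of_half(1) [OF _ p_nz]) simp
    show "norm (?q x) = 1"
      using to_half_upper_half(2) [OF p(1) 1(2)] 2 by simp
  qed
  interpret inv: disc_pole G' G p by (rule disc_pole_inverse)
  have inv_f: "inv.f = f'" by (simp add: inv.f_def f'_def)
  have q_step: "?q (t' x) = G' (?q x)" for x
    using inv.of_half_f [of "complex_of_real x"] by (simp add: inv_f ft')
  have q_orbit: "?q ((h' ^^ n) x) = (G' ^^ (2 * n)) (?q x)" for n x
  proof (induction n)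
    case (Suc n)
    have "?q ((h' ^^ Suc n) x) = G' (G' (?q ((h' ^^ n) x)))"
      by (simp add: h'_def q_step)
    then show ?case using Suc by simp
  qed simp
  have dyn: "(\<lambda>n. ep (?q ((h' ^^ n) x))) \<longlonglongrightarrow> r" if "ep (?q x) \<noteq> a" for x
  proof -
    have "strict_mono (\<lambda>n::nat. 2 * n)" by (simp add: strict_mono_def)
    from LIMSEQ_subseq_LIMSEQ [OF backward(1) [OF q(1) that] this]
    show ?thesis by (simp add: q_orbit o_def)
  qed
  \<comment> \<open>By \<open>light\<close>, \<open>ep\<close> is not constant on any nondegenerate
    interval of the circle.\<close>
  have generic: "\<exists>x\<in>S. ep (?q x) \<noteq> a" if S: "connected S" "u \<in> S" "v \<in> S" "u \<noteq> v" for S u v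
  proof (rule ccontr)
    assume neg: "\<not> ?thesis"
    have "continuous_on S ?q"
      by (intro continuous_on_compose2 [OF homeomorphism_cont2 [OF to_half_homeomorphism [OF p(1)]],
        of S complex_of_real]
          continuous_on_of_real continuous_on_id image_subsetI) simp
    then have "connected (?q ` S)"
      using S(1) by (rule connected_continuous_image)
    then have "\<exists>x. ?q ` S \<subseteq> {x}"
      by (rule light [of _ a]) (use neg q(3) in auto)
    then have "?q u = ?q v" using S(2,3) by auto
    then show False using q(4) S(4) by (metis of_real_eq_iff)
  qed
  \<comment> \<open>\<open>h'\<close> is increasing and takes \<open>t (t 0)\<close> to 0, so it
    cannot carry a point beyond \<open>\<bar>t (t 0)\<bar>\<close> across 0. An orbit in
    \<open>W\<close> thus stays on one side of the line.\<close>
  define R1 where "R1 = max (R0 + 1) (\<bar>t (t 0)\<bar> + 1)"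
  have R1: "R1 > R0" "R1 > \<bar>t (t 0)\<bar>" by (auto simp: R1_def)
  define W where "W = {w \<in> cball 0 1. w = p \<or> R1 \<le> norm (to_half p w)}"
  have awayW: "\<delta> \<le> dist (ep w) r" "\<delta> \<le> dist (em w) r" if "w \<in> W" for w
    using away [of w] that R1(1) by (auto simp: W_def)
  define K where "K = of_half p ` (upper_half \<inter> cball 0 R1)"
  have cof: "continuous_on upper_half (of_half p)"
    using to_half_homeomorphism [OF p(1)] by (simp add: homeomorphism_def)
  have "compact K"
    unfolding K_def
    by (intro compact_continuous_image closed_Int_compact closed_upper_half compact_cball)
       (auto intro: continuous_on_subset [OF cof])
  then have "open (- K)" by (intro open_Compl compact_imp_closed)
  have pK: "p \<notin> K"
    using of_half_in(2) unfolding K_def by (metis IntD1 imageE)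
  have KW: "cball 0 1 \<inter> (- K) \<subseteq> W"
  proof
    fix w assume w: "w \<in> cball 0 1 \<inter> (- K)"
    show "w \<in> W"
    proof (cases "w = p")
      case False
      have "to_half p w \<in> upper_half" using to_half_in w False by blast
      moreover have "w = of_half p (to_half p w)" using of_half_to_half [OF False p_nz] by simp
      ultimately have "\<not> norm (to_half p w) \<le> R1" using w by (auto simp: K_def)
      then show ?thesis using w by (simp add: W_def)
    qed (use p_in in \<open>simp add: W_def\<close>)
  qed
  have "closed W"
  proof -
    have "W = cball 0 1 - {w \<in> cball 0 1. w \<noteq> p \<and> to_half p w \<in> ball 0 R1}"
      by (auto simp: W_def)
    moreover have "closedin (top_of_set (cball 0 1)) (cball 0 1 - {w \<in> cball 0 1. w \<noteq> p \<and>
      to_half p w \<in> ball 0 R1})"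
    proof -
      let ?V = "{w \<in> cball 0 1. w \<noteq> p \<and> to_half p w \<in> ball 0 R1}"
      have "cball 0 1 - (cball 0 1 - ?V) = ?V" by auto
      then show ?thesis
        using openin_to_half [OF open_ball, of 0 R1] unfolding closedin_def by auto
    qed
    ultimately show ?thesis
      using closedin_closed_trans closed_cball by metis
  qed
  have iso: "y = p" if y: "y \<in> cball 0 1" "\<And>n. (G' ^^ n) y \<in> W" for y
  proof (rule ccontr)
    assume "y \<noteq> p"
    have contra: False if "u \<longlonglongrightarrow> r" "\<And>n. \<delta> \<le> dist (u n) r" for u :: "nat \<Rightarrow> 'b"
      using tendstoD [OF that(1) \<delta>(1)] that(2) by
        (auto simp: eventually_sequentially not_less [symmetric])
    have "ep y = a"
      using contra [OF backward(1) [OF y(1)]] awayW(1) y(2) by blast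
    moreover have "em y = a"
      using contra [OF backward(2) [OF y(1)]] awayW(2) y(2) by blast
    ultimately have "norm y = 1"
      using differ [of y] y(1) by force
    define x where "x = Re (to_half p y)"
    have x: "to_half p y = complex_of_real x"
      using to_half_upper_half(2) [OF p(1) \<open>y \<noteq> p\<close>] \<open>norm y = 1\<close> by (simp add: x_def)
    then have qx: "?q x = y"
      using of_half_to_half [OF \<open>y \<noteq> p\<close> p_nz] by simp
    have big: "R1 \<le> \<bar>(h' ^^ n) x\<bar>" for n
    proof -
      have "?q ((h' ^^ n) x) \<in> W"
        unfolding q_orbit qx by (rule y(2))
      then show ?thesis
        using q(2,4) by (simp add: W_def)
    qed
    have h0: "h' (t (t 0)) = 0" by (rule hinv)
    show False
    proof (cases "x > 0")
      case True
      have pos: "(h' ^^ n) x > 0" for n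
      proof (induction n)
        case (Suc n)
        then have "(h' ^^ n) x \<ge> t (t 0)" using big [of n] R1 by linarith
        then have "h' ((h' ^^ n) x) \<ge> 0" using hmono h0 by metis
        then show ?case using big [of "Suc n"] R1 R0(1) by simp
      qed (use True in simp)
      have "\<exists>n. (h' ^^ n) x \<le> R0"
      proof (rule backward_orbit_leaves [where e = "\<lambda>x. ep (?q x)" and r = r and a = a and \<delta> = \<delta>])
        show "mono h'" using hmono by (simp add: monoI)
        show "\<delta> > 0" by (rule \<delta>(1))
        show "\<delta> \<le> dist (ep (?q u)) r" if "u > R0" for u
        proof -
          have "R0 \<le> norm (to_half p (?q u))"
            unfolding q(4) norm_of_real using that by linarith
          then show ?thesis using away(1) [OF q(1)] by blast
        qed
        show "\<exists>u>x. ep (?q u) \<noteq> a"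
          using generic [of "{x<..}" "x + 1" "x + 2"] by auto
      qed (rule dyn)
      then obtain n where "(h' ^^ n) x \<le> R0" by blast
      then show False using big [of n] pos [of n] R1 by simp
    next
      case False
      then have "x < 0" using big [of 0] R1 R0(1) by simp
      have neg: "(h' ^^ n) x < 0" for n
      proof (induction n)
        case (Suc n)
        then have "(h' ^^ n) x \<le> t (t 0)" using big [of n] R1 by linarith
        then have "h' ((h' ^^ n) x) \<le> 0" using hmono h0 by metis
        then show ?case using big [of "Suc n"] R1 R0(1) by simp
      qed (use \<open>x < 0\<close> in simp)
      \<comment> \<open>Reflection reduces the negative side to the positive one.\<close>
      define k' where "k' \<equiv> \<lambda>x. - h' (- x)"
      have k': "(k' ^^ n) u = - (h' ^^ n) (- u)" for n u
        by (induction n) (auto simp: k'_def)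
      have "\<exists>n. (k' ^^ n) (- x) \<le> R0"
      proof (rule backward_orbit_leaves [where e = "\<lambda>x. ep (?q (- x))" and r = r and a = a and \<delta> =
        \<delta>])
        show "mono k'" using hmono by (simp add: monoI k'_def)
        show "\<delta> > 0" by (rule \<delta>(1))
        show "\<delta> \<le> dist (ep (?q (- u))) r" if "u > R0" for u
        proof -
          have "R0 \<le> norm (to_half p (?q (- u)))"
            unfolding q(4) norm_of_real using that by linarith
          then show ?thesis using away(1) [OF q(1)] by blast
        qed
        obtain u where "u < x" "ep (?q u) \<noteq> a"
          using generic [of "{..<x}" "x - 1" "x - 2"] by auto
        then show "\<exists>u>-x. ep (?q (- u)) \<noteq> a"
          by (intro exI [of _ "- u"]) auto
        show "(\<lambda>n. ep (?q (- (k' ^^ n) u))) \<longlonglongrightarrow> r" if "ep (?q (- u)) \<noteq> a" for u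
          using dyn [OF that] by (simp add: k')
      qed
      then obtain n where "- (h' ^^ n) x \<le> R0" by (auto simp: k')
      then show False using big [of n] neg [of n] R1 by simp
    qed
  qed
  show ?thesis
    by (rule isolated_backward_orbit_imp_attracting [OF compact_cball hom p_in p(2) \<open>closed W\<close>
      \<open>open (- K)\<close> _ KW iso])
       (use pK in auto)
qed

lemma repelling:
  assumes "norm p = 1" "G p = p" "ep p = r"
  shows "attracting_fixed_point (top_of_set (cball 0 1)) G' p"
proof -
  interpret inv: disc_dynamics G' G ep em r a by (rule inverse)
  have "G' p = p"
    using hom assms by (metis homeomorphism_apply1 mem_cball_0 order_refl)
  then show ?thesis
    using inv.attracting assms by blast
qed

text \<open>An accumulation point of fixed points would be a fixed point attracting for
  \<open>G\<close> or for \<open>G'\<close>, yet the other fixed points near it do not move towards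
  it.\<close>

lemma finite_fixed: "finite {w \<in> cball 0 1. G w = w}"
proof (rule ccontr)
  assume "infinite {w \<in> cball 0 1. G w = w}"
  then obtain p where p: "p \<in> cball 0 1" "p islimpt {w \<in> cball 0 1. G w = w}"
    using compact_eq_Bolzano_Weierstrass [of "cball (0::complex) 1"]
      by (metis (no_types, lifting) compact_cball mem_Collect_eq subsetI)
  have contG: "continuous_on (cball 0 1) G"
    using hom by (simp add: homeomorphism_def)
  have "closed {w \<in> cball 0 1. G w = w}"
  proof -
    have "{w \<in> cball 0 1. G w = w} = cball 0 1 \<inter> (\<lambda>w. G w - w) -` {0}"
      by auto
    moreover have "closed (cball 0 1 \<inter> (\<lambda>w. G w - w) -` {0})"
      by (intro continuous_closed_preimage continuous_intros contG) auto
    ultimately show ?thesis by simp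
  qed
  then have Gp: "G p = p"
  proof -
    have "p \<in> {w \<in> cball 0 1. G w = w}"
      using \<open>closed {w \<in> cball 0 1. G w = w}\<close> p(2) unfolding closed_limpt by blast
    then show ?thesis by simp
  qed
  note onc = fixed_on_circle [OF p(1) Gp]
  have fixn: "(G ^^ n) w = w" if "G w = w" for n w
    using that by (induction n) auto
  have fixn': "(G' ^^ n) w = w" if "w \<in> cball 0 1" "G w = w" for n w
  proof -
    have "G' w = w" using homeomorphism_apply1 [OF hom that(1)] that(2) by simp
    then show ?thesis by (induction n) auto
  qed
  have "\<exists>F. (\<forall>w n. w \<in> cball 0 1 \<longrightarrow> G w = w \<longrightarrow> (F ^^ n) w = w) \<and>
    attracting_fixed_point (top_of_set (cball 0 1)) F p"
    using onc(2) attracting [OF onc(1) Gp] repelling [OF onc(1) Gp] fixn fixn' by blast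
  then obtain F where F: "\<And>w n. \<lbrakk>w \<in> cball 0 1; G w = w\<rbrakk> \<Longrightarrow> (F ^^ n) w = w"
      "attracting_fixed_point (top_of_set (cball 0 1)) F p"
    by blast
  then obtain U where U: "openin (top_of_set (cball 0 1)) U" "p \<in> U"
      "\<forall>V. openin (top_of_set (cball 0 1)) V \<and> p \<in> V \<longrightarrow> (\<exists>N. \<forall>n\<ge>N. (F ^^ n) ` U \<subseteq> V)"
    unfolding attracting_fixed_point_def by blast
  obtain T where T: "open T" "U = cball 0 1 \<inter> T"
    using U(1) by (auto simp: openin_open)
  then obtain w where w: "w \<in> cball 0 1" "G w = w" "w \<in> T" "w \<noteq> p"
    using p(2) U(2) by (auto simp: islimpt_def simp del: mem_cball)
  have "openin (top_of_set (cball 0 1)) (cball 0 1 - {w})"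
    by (auto simp: openin_open intro!: exI [of _ "- {w}"])
  then obtain N where "\<And>n. n \<ge> N \<Longrightarrow> (F ^^ n) ` U \<subseteq> cball 0 1 - {w}"
    using spec [OF U(3), of "cball 0 1 - {w}"] p(1) w(4) by blast
  then have "(F ^^ N) w \<in> cball 0 1 - {w}"
    using w T(2) by blast
  then show False using F(1) [OF w(1,2)] by simp
qed

text \<open>With the pole at infinity a single fixed point remains. It cannot lie over
  \<open>r\<close>, because it would then repel.\<close>

lemma unique_attractor_of_repelling_pole:
  assumes p: "norm p = 1" "G p = p" "ep p = r"
  shows "\<exists>s. s \<noteq> p \<and> {w \<in> cball 0 1. G w = w} = {s, p} \<and> ep s = a"
proof -
  interpret disc_pole G G' p
    by unfold_locales (use hom circle p in auto)
  have fin: "finite {z \<in> upper_half. f z = z}"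
  proof (rule finite_imageD)
    show "finite (of_half p ` {z \<in> upper_half. f z = z})"
      using finite_fixed unfolding fixed_points_disc by simp
    show "inj_on (of_half p) {z \<in> upper_half. f z = z}"
      using to_half_of_half(1) [OF _ p_nz] by (metis (no_types, lifting) inj_onI mem_Collect_eq)
  qed
  have bdry: "norm (of_half p z) = 1" "ep (of_half p z) = a \<or> ep (of_half p z) = r"
    "G (of_half p z) = of_half p z"
    if "z \<in> upper_half" "f z = z" for z
  proof -
    show "G (of_half p z) = of_half p z" using fixed_iff that by blast
    then show "norm (of_half p z) = 1" "ep (of_half p z) = a \<or> ep (of_half p z) = r"
      using fixed_on_circle [OF of_half_in(1) [OF that(1)]] by auto
  qed
  obtain \<rho>\<^sub>0 \<rho>\<^sub>1 m R where tr: "disc_trapped f 0 \<rho>\<^sub>0 \<rho>\<^sub>1 m R"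
    "\<And>z. \<lbrakk>z \<in> upper_half; f z = z\<rbrakk> \<Longrightarrow> norm z \<le> \<rho>\<^sub>0"
    using repelling_pole_imp_disc_trapped [OF repelling [OF p] fin] by blast
  interpret inv: disc_pole G' G p by (rule disc_pole_inverse)
  have inv_f: "inv.f = f'" by (simp add: inv.f_def f'_def)
  have rep: "attracts_discs f' x" if "f (complex_of_real x) = complex_of_real x"
    "ep (of_half p (complex_of_real x)) = r" for x
    using inv.attracting_imp_attracts_discs repelling bdry [of "complex_of_real x"] that by
      (simp add: inv_f)
  have "\<exists>x. {z \<in> upper_half. f z = z} = {complex_of_real x} \<and> \<not> attracts_discs f' x"
  proof (rule half_plane_unique_fixed_point [OF f_homeomorphism f_real _ _ _ tr])
    have "finite (complex_of_real ` {x. f (complex_of_real x) = complex_of_real x})"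
      by (rule finite_subset [OF _ fin]) auto
    then show "finite {x. f (complex_of_real x) = complex_of_real x}"
      by (rule finite_imageD) (simp add: inj_on_def)
    show "z \<in> \<real>" if "z \<in> upper_half" "f z = z" for z
      using to_half_upper_half(2) [OF p(1) of_half_in(2) [OF that(1)]] bdry(1) [OF that]
        to_half_of_half(1) [OF that(1) p_nz] by simp
    show "attracts_discs f x \<or> attracts_discs f' x"
      if x: "f (complex_of_real x) = complex_of_real x" for x
      using bdry(2) [of "complex_of_real x"] rep [OF x]
        attracting_imp_attracts_discs attracting [OF bdry(1) bdry(3)] x by auto
  qed
  then obtain x where x: "{z \<in> upper_half. f z = z} = {complex_of_real x}" "\<not> attracts_discs f' x"
    by blast
  define s where "s = of_half p (complex_of_real x)"
  have "{w \<in> cball 0 1. G w = w} = {s, p}"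
    unfolding fixed_points_disc x(1) s_def by auto
  moreover have "s \<noteq> p"
    unfolding s_def by (rule of_half_in) simp
  moreover have fx: "f (complex_of_real x) = complex_of_real x"
    using x(1) by blast
  then have "ep s = a"
    using bdry(2) [of "complex_of_real x"] rep [OF fx] x(2) by (auto simp: s_def)
  ultimately show ?thesis by blast
qed

text \<open>Brouwer's theorem supplies a fixed point to serve as the pole. If it lies over
  \<open>a\<close>, the inverse dynamics is used instead.\<close>

theorem attracting_repelling_pair:
  "\<exists>s u. s \<noteq> u \<and> {w \<in> cball 0 1. G w = w} = {s, u} \<and> norm s = 1 \<and> norm u = 1 \<and>
    attracting_fixed_point (top_of_set (cball 0 1)) G s \<and>
    attracting_fixed_point (top_of_set (cball 0 1)) G' u"
proof -
  interpret inv: disc_dynamics G' G ep em r a by (rule inverse)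
  have hG: "G \<in> cball 0 1 \<rightarrow> cball 0 1" "continuous_on (cball 0 1) G"
    using hom by (auto simp: homeomorphism_def simp del: mem_cball)
  obtain p where p: "p \<in> cball 0 1" "G p = p"
    using brouwer [of "cball (0::complex) 1" G] hG by (auto simp del: mem_cball)
  note P = fixed_on_circle [OF p]
  have fixeq: "{w \<in> cball 0 1. G' w = w} = {w \<in> cball 0 1. G w = w}"
  proof -
    have "G' w = w \<longleftrightarrow> G w = w" if "w \<in> cball 0 1" for w
      using homeomorphism_apply1 [OF hom that] homeomorphism_apply2 [OF hom that] by metis
    then show ?thesis by blast
  qed
  have "\<exists>s u. s \<noteq> u \<and> {w \<in> cball 0 1. G w = w} = {s, u} \<and> ep s = a \<and> ep u = r"
  proof (cases "ep p = r")
    case True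
    then show ?thesis
      using unique_attractor_of_repelling_pole [OF P(1) p(2)] by blast
  next
    case False
    then have "ep p = a" using P(2) by blast
    moreover have "G' p = p" using p fixeq by blast
    ultimately obtain s where "s \<noteq> p" "{w \<in> cball 0 1. G' w = w} = {s, p}" "ep s = r"
      using inv.unique_attractor_of_repelling_pole [OF P(1)] by blast
    then show ?thesis
      using \<open>ep p = a\<close> unfolding fixeq by (metis insert_commute)
  qed
  then obtain s u where su: "s \<noteq> u" "{w \<in> cball 0 1. G w = w} = {s, u}" "ep s = a" "ep u = r"
    by blast
  then have "s \<in> cball 0 1" "G s = s" "u \<in> cball 0 1" "G u = u"
    by auto
  then show ?thesis
    using su attracting repelling fixed_on_circle(1) by blast
qed

end

section \<open>The action on the universal circle\<close>

text \<open>Attraction restricts to invariant subsets, so attraction in the whole disc yields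
  attraction on the circle. \<open>F\<close> has to correspond to \<open>G\<close> only on
  \<open>S\<close>, which admits an \<open>inv_into\<close>.\<close>

lemma attracting_fixed_point_transport:
  assumes h: "homeomorphic_map D Y h" and S: "S \<subseteq> topspace D" and p: "p \<in> S"
    and F: "\<And>d. d \<in> S \<Longrightarrow> F d \<in> S" "\<And>d. d \<in> S \<Longrightarrow> h (F d) = G (h d)"
    and att: "attracting_fixed_point Y G (h p)"
  shows "attracting_fixed_point (subtopology D S) F p"
proof -
  have inj: "inj_on h (topspace D)" and cont: "continuous_map D Y h" and op: "open_map D Y h"
    using h by (auto simp: homeomorphic_eq_everything_map)
  have ts: "topspace (subtopology D S) = S"
    using S by auto
  have Fn: "(F ^^ n) d \<in> S \<and> h ((F ^^ n) d) = (G ^^ n) (h d)" if "d \<in> S" for n d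
    using that by (induction n) (auto simp: F)
  obtain U where U: "openin Y U" "h p \<in> U" "G (h p) = h p"
    and Uat: "\<And>V. \<lbrakk>openin Y V; h p \<in> V\<rbrakk> \<Longrightarrow> \<exists>N. \<forall>n\<ge>N. (G ^^ n) ` U \<subseteq> V"
    using att unfolding attracting_fixed_point_def by blast
  have "F p = p"
    using F(1) [OF p] F(2) [OF p] U(3) S p inj by (metis inj_onD subsetD)
  define U' where "U' = {d \<in> topspace D. h d \<in> U} \<inter> S"
  have "openin (subtopology D S) U'"
    unfolding U'_def using openin_continuous_map_preimage [OF cont U(1)]
    by (rule openin_subtopology_Int)
  moreover have "p \<in> U'"
    using p S U(2) by (auto simp: U'_def)
  moreover have "\<exists>N. \<forall>n\<ge>N. (F ^^ n) ` U' \<subseteq> V" if V: "openin (subtopology D S) V" "p \<in> V" for V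
  proof -
    obtain V0 where V0: "openin D V0" "V = V0 \<inter> S"
      using V(1) by (auto simp: openin_subtopology)
    have "openin Y (h ` V0)"
      using op V0(1) by (simp add: open_map_def)
    then obtain N where N: "\<And>n. n \<ge> N \<Longrightarrow> (G ^^ n) ` U \<subseteq> h ` V0"
      using Uat [of "h ` V0"] V(2) V0(2) by blast
    have "(F ^^ n) d \<in> V" if "n \<ge> N" "d \<in> U'" for n d
    proof -
      have d: "d \<in> S" "h d \<in> U" using that(2) by (auto simp: U'_def)
      then have "h ((F ^^ n) d) \<in> h ` V0"
        using Fn [OF d(1), of n] N [OF that(1)] by auto
      then obtain v where "v \<in> V0" "h ((F ^^ n) d) = h v" by auto
      moreover have "v \<in> topspace D" using openin_subset [OF V0(1)] \<open>v \<in> V0\<close> by blast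
      ultimately have "(F ^^ n) d = v"
        using Fn [OF d(1), of n] S inj by (meson inj_onD subsetD)
      then show ?thesis using \<open>v \<in> V0\<close> Fn [OF d(1), of n] V0(2) by blast
    qed
    then show ?thesis by blast
  qed
  ultimately show ?thesis
    unfolding attracting_fixed_point_def ts using p \<open>F p = p\<close> by blast
qed

text \<open>Points of one flowline differ by a shift of time, which preserves the filter. So they
  share their limit, and the description in \<open>endpoint\<close> is well defined.\<close>

lemma endpoint_flowline:
  assumes flow: "continuous_flow_on hyp_space \<Psi>" and x: "x \<in> hyp_space"
    and F: "F \<noteq> bot" "\<And>s. filterlim (\<lambda>t. t + s) F F" and lim: "((\<lambda>t. \<Psi> t x) \<longlongrightarrow> z) F"
  shows "endpoint F \<Psi> (flowline \<Psi> x) = z"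
  unfolding endpoint_def
proof (rule the_equality)
  show "\<forall>y\<in>flowline \<Psi> x. ((\<lambda>t. \<Psi> t y) \<longlongrightarrow> z) F"
  proof
    fix y assume "y \<in> flowline \<Psi> x"
    then obtain s where "y = \<Psi> s x" by (auto simp: flowline_def)
    then have "(\<lambda>t. \<Psi> t y) = (\<lambda>t. \<Psi> (t + s) x)"
      using flow x unfolding continuous_flow_on_def by auto
    then show "((\<lambda>t. \<Psi> t y) \<longlongrightarrow> z) F"
      using filterlim_compose [OF lim F(2)] by simp
  qed
  have "x = \<Psi> 0 x" using flow x unfolding continuous_flow_on_def by simp
  then have "x \<in> flowline \<Psi> x" unfolding flowline_def by (metis rangeI)
  then show "w = z" if "\<forall>y\<in>flowline \<Psi> x. ((\<lambda>t. \<Psi> t y) \<longlongrightarrow> w) F" for w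
    using that lim tendsto_unique [OF F(1)] by blast
qed

lemma filterlim_shift_at_top: "filterlim (\<lambda>t::real. t + s) at_top at_top"
  by (rule filterlim_tendsto_add_at_top [OF tendsto_const filterlim_ident, of s, simplified
    add.commute])

lemma filterlim_shift_at_bot: "filterlim (\<lambda>t::real. t + s) at_bot at_bot"
  unfolding filterlim_at_bot eventually_at_bot_linorder by (metis le_diff_eq)

text \<open>Both sides, as functions of \<open>t\<close>, lift the same path in \<open>M\<close> and
  start at the same point.\<close>

lemma deck_flow_commute:
  assumes cov: "covering_space hyp_space q M" and lift: "lifted_flow q \<Phi> \<Psi>"
    and g: "g \<in> deck_transformations q" and x: "x \<in> hyp_space"
  shows "g (\<Psi> t x) = \<Psi> t (g x)"
proof -
  note gD = deck_transformationsD [OF g]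
  have flow: "continuous_flow_on hyp_space \<Psi>" and q: "\<And>t x. x \<in> hyp_space \<Longrightarrow> q (\<Psi> t x) = \<Phi> t (q x)"
    using lift unfolding lifted_flow_def by auto
  have \<Psi>: "\<Psi> t y \<in> hyp_space" "\<Psi> 0 y = y" if "y \<in> hyp_space" for t y
    using flow that unfolding continuous_flow_on_def by auto
  have cont: "continuous_on UNIV (\<lambda>t. \<Psi> t y)" if "y \<in> hyp_space" for y
  proof -
    have "continuous_on (UNIV \<times> hyp_space) (\<lambda>(t, x). \<Psi> t x)"
      using flow unfolding continuous_flow_on_def by blast
    then have "continuous_on UNIV (\<lambda>t. (\<lambda>(t, x). \<Psi> t x) (t, y))"
      by (rule continuous_on_compose2) (use that in \<open>auto intro!: continuous_intros\<close>)
    then show ?thesis by simp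
  qed
  have gx: "g x \<in> hyp_space" by (rule gD(2) [OF x])
  show ?thesis
  proof (rule covering_space_lift_unique [where ?g1.0 = "\<lambda>t. g (\<Psi> t x)" and ?g2.0 = "\<lambda>t. \<Psi> t (g x)"
        and a = 0 and T = UNIV and f = "\<lambda>t. q (\<Psi> t x)", OF cov])
    show "g (\<Psi> 0 x) = \<Psi> 0 (g x)" using \<Psi>(2) x gx by metis
    show "continuous_on UNIV (\<lambda>t. q (\<Psi> t x))"
      by (rule continuous_on_compose2 [OF covering_space_imp_continuous [OF cov] cont [OF x]])
        (use \<Psi>(1) x in blast)
    show "(\<lambda>t. q (\<Psi> t x)) \<in> UNIV \<rightarrow> M"
      using \<Psi>(1) [OF x] covering_space_imp_surjective [OF cov] by blast
    show "continuous_on UNIV (\<lambda>t. g (\<Psi> t x))"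
      by (rule continuous_on_compose2 [OF gD(1) cont [OF x]]) (use \<Psi>(1) x in blast)
    show "(\<lambda>t. g (\<Psi> t x)) \<in> UNIV \<rightarrow> hyp_space" using gD(2) \<Psi>(1) [OF x] by blast
    show "q (\<Psi> t x) = q (g (\<Psi> t x))" for t using gD(3) \<Psi>(1) [OF x] by simp
    show "continuous_on UNIV (\<lambda>t. \<Psi> t (g x))" by (rule cont [OF gx])
    show "(\<lambda>t. \<Psi> t (g x)) \<in> UNIV \<rightarrow> hyp_space" using \<Psi>(1) [OF gx] by blast
    show "q (\<Psi> t x) = q (\<Psi> t (g x))" for t using q [OF x] q [OF gx] gD(3) [OF x] by simp
  qed auto
qed

lemma deck_flowline:
  assumes "covering_space hyp_space q M" "lifted_flow q \<Phi> \<Psi>" "g \<in> deck_transformations q"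
    "x \<in> hyp_space"
  shows "g ` flowline \<Psi> x = flowline \<Psi> (g x)"
  unfolding flowline_def using deck_flow_commute [OF assms] by (simp add: image_image)

lemma topspace_flowspace: "topspace (flowspace \<Psi>) = flowline \<Psi> ` hyp_space"
  by (simp add: flowspace_def)

text \<open>Powers in the deck group are extensional, so they are compared with iterates on the ball
  only.\<close>

lemma deck_group_nat_pow_apply:
  assumes g: "g \<in> deck_transformations q" and y: "y \<in> hyp_space"
  shows "(g [^]\<^bsub>deck_group q\<^esub> (n::nat)) y = (g ^^ n) y"
  using y
proof (induction n arbitrary: y)
  case 0
  then show ?case
    by (simp add: deck_group_def BijGroup_def)
next
  case (Suc n)
  interpret K: group "deck_group q" by (rule group_deck_group)
  have gc: "g \<in> carrier (deck_group q)"
    using g by (simp add: deck_group_def)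
  then have gn: "g [^]\<^bsub>deck_group q\<^esub> n \<in> deck_transformations q"
    using K.nat_pow_closed [of g n] by (simp add: deck_group_def)
  have Bij: "g \<in> Bij hyp_space" "g [^]\<^bsub>deck_group q\<^esub> n \<in> Bij hyp_space"
    using deck_transformations_Bij g gn by auto
  have "g [^]\<^bsub>deck_group q\<^esub> Suc n = compose hyp_space (g [^]\<^bsub>deck_group q\<^esub> n) g"
    using Bij by (simp add: deck_group_def BijGroup_def)
  then have "(g [^]\<^bsub>deck_group q\<^esub> Suc n) y = (g [^]\<^bsub>deck_group q\<^esub> n) (g y)"
    using Suc.prems by (simp add: compose_def)
  also have "\<dots> = (g ^^ n) (g y)"
    by (rule Suc.IH [OF deck_transformationsD(2) [OF g Suc.prems]])
  finally show ?case
    by (simp add: funpow_swap1)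
qed

lemma group_action_nat_pow:
  assumes act: "group_action K E A" and g: "g \<in> carrier K" and x: "x \<in> E"
  shows "A (g [^]\<^bsub>K\<^esub> (n::nat)) x = (A g ^^ n) x"
  using x
proof (induction n arbitrary: x)
  case 0
  then show ?case
    by (simp flip: group_action.id_eq_one [OF act])
next
  case (Suc n)
  interpret K: group K using act by (simp add: group_action_def group_hom_def)
  have "A (g [^]\<^bsub>K\<^esub> Suc n) x = A (g [^]\<^bsub>K\<^esub> n) (A g x)"
    using group_action.composition_rule [OF act Suc.prems, of "g [^]\<^bsub>K\<^esub> n" g] g by simp
  also have "\<dots> = (A g ^^ n) (A g x)"
    by (rule Suc.IH [OF group_action.element_image [OF act g Suc.prems refl]])
  finally show ?case
    by (simp add: funpow_swap1)
qed

lemma group_action_inverse: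
  assumes act: "group_action K E A" and g: "g \<in> carrier K" and x: "x \<in> E"
  shows "A (inv\<^bsub>K\<^esub> g) (A g x) = x" "A g (A (inv\<^bsub>K\<^esub> g) x) = x"
proof -
  interpret K: group K using act by (simp add: group_action_def group_hom_def)
  have one: "A \<one>\<^bsub>K\<^esub> x = x"
    using x by (simp flip: group_action.id_eq_one [OF act])
  show "A (inv\<^bsub>K\<^esub> g) (A g x) = x"
    using group_action.composition_rule [OF act x, of "inv\<^bsub>K\<^esub> g" g] g one by simp
  show "A g (A (inv\<^bsub>K\<^esub> g) x) = x"
    using group_action.composition_rule [OF act x, of g "inv\<^bsub>K\<^esub> g"] g one by simp
qed

lemma deck_group_inverse_apply:
  assumes g: "g \<in> deck_transformations q" and x: "x \<in> hyp_space"
  shows "(inv\<^bsub>deck_group q\<^esub> g) (g x) = x" "g ((inv\<^bsub>deck_group q\<^esub> g) x) = x"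
proof -
  interpret K: group "deck_group q" by (rule group_deck_group)
  have gc: "g \<in> carrier (deck_group q)"
    using g by (simp add: deck_group_def)
  let ?i = "inv\<^bsub>deck_group q\<^esub> g"
  have "?i \<in> deck_transformations q"
    using K.inv_closed [OF gc] by (simp add: deck_group_def)
  then have Bij: "g \<in> Bij hyp_space" "?i \<in> Bij hyp_space"
    using deck_transformations_Bij g by auto
  have mult: "(u \<otimes>\<^bsub>deck_group q\<^esub> v) x = u (v x)" if "u \<in> Bij hyp_space" "v \<in> Bij hyp_space" for u v
    using that x by (simp add: deck_group_def BijGroup_def compose_def)
  have one: "\<one>\<^bsub>deck_group q\<^esub> x = x"
    using x by (simp add: deck_group_def BijGroup_def)
  show "?i (g x) = x"
    using mult [OF Bij(2,1)] one K.l_inv [OF gc] by simp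
  show "g (?i x) = x"
    using mult [OF Bij] one K.r_inv [OF gc] by simp
qed

theorem proposition9p6:
  fixes M :: "'m::t2_space set"
    and q :: "real^3 \<Rightarrow> 'm"
    and \<Phi> :: "real \<Rightarrow> 'm \<Rightarrow> 'm"
    and \<Psi> :: "real \<Rightarrow> real^3 \<Rightarrow> real^3"
    and D :: "'d topology"
    and \<iota> :: "(real^3) set \<Rightarrow> 'd"
    and A :: "(real^3 \<Rightarrow> real^3) \<Rightarrow> 'd \<Rightarrow> 'd"
    and E\<^sub>p E\<^sub>m :: "'d \<Rightarrow> real^3"
    and g :: "real^3 \<Rightarrow> real^3"
  assumes "closed_orientable_hyperbolic_3manifold M q"
    and "quasigeodesic_flow M q \<Phi>"
    and "lifted_flow q \<Phi> \<Psi>"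
    and "distinct_endpoints \<Psi>"
    and "orientation_preserving_action_on_plane q \<Psi>"
    and "compactified_flowspace q \<Psi> D \<iota> A E\<^sub>p E\<^sub>m"
    and "g \<in> carrier (deck_group q)"
    and "\<forall>l\<in>topspace (flowspace \<Psi>). g ` l \<noteq> l"
  shows "\<exists>a r. a \<noteq> r \<and>
           {x \<in> topspace (universal_circle \<Psi> D \<iota>). A g x = x} = {a, r} \<and>
           attracting_fixed_point (universal_circle \<Psi> D \<iota>) (A g) a \<and>
           repelling_fixed_point (universal_circle \<Psi> D \<iota>) (A g) r"
proof -
  let ?K = "deck_group q"
  define g' where "g' = inv\<^bsub>?K\<^esub> g"
  interpret K: group ?K by (rule group_deck_group)
  have cov: "covering_space hyp_space q M"
    using assms(1) by (simp add: closed_orientable_hyperbolic_3manifold_def)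
  have gc: "g \<in> carrier ?K" "g' \<in> carrier ?K"
    using assms(7) by (simp_all add: g'_def)
  then have gd: "g \<in> deck_transformations q" "g' \<in> deck_transformations q"
    by (simp_all add: deck_group_def)
  have inv: "g' (g x) = x" "g (g' x) = x" if "x \<in> hyp_space" for x
    using deck_group_inverse_apply [OF gd(1) that] by (simp_all add: g'_def)
  have flow: "continuous_flow_on hyp_space \<Psi>"
    using assms(3) by (simp add: lifted_flow_def)

  \<comment> \<open>The flowspace and its compactification\<close>
  define P where "P = topspace (flowspace \<Psi>)"
  have P: "P = flowline \<Psi> ` hyp_space"
    by (simp add: P_def topspace_flowspace)
  have gP: "h ` l \<in> P" if "h \<in> deck_transformations q" "l \<in> P" for h l
    using that deck_flowline [OF cov assms(3) that(1)] deck_transformationsD(2) [OF that(1)]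
      unfolding P by blast

  have emb: "embedding_map (flowspace \<Psi>) D \<iota>"
    and ex_h: "\<exists>h. homeomorphic_map D (top_of_set (cball (0::complex) 1)) h \<and> h ` \<iota> ` P = ball 0 1"
    and act: "group_action ?K (topspace D) A"
    and Ahom: "\<And>k. k \<in> carrier ?K \<Longrightarrow> homeomorphic_map D D (A k)"
    and A\<iota>: "\<And>k l. \<lbrakk>k \<in> carrier ?K; l \<in> P\<rbrakk> \<Longrightarrow> A k (\<iota> l) = \<iota> (k ` l)"
    and Econt: "continuous_map D (top_of_set sphere_inf) E\<^sub>p"
      "continuous_map D (top_of_set sphere_inf) E\<^sub>m"
    and Eend: "\<And>l. l \<in> P \<Longrightarrow> E\<^sub>p (\<iota> l) = endpoint at_top \<Psi> l"
      "\<And>l. l \<in> P \<Longrightarrow> E\<^sub>m (\<iota> l) = endpoint at_bot \<Psi> l"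
    and Eact: "\<And>k x. \<lbrakk>k \<in> carrier ?K; x \<in> topspace D\<rbrakk> \<Longrightarrow> E\<^sub>p (A k x) = boundary_action k (E\<^sub>p x)"
      "\<And>k x. \<lbrakk>k \<in> carrier ?K; x \<in> topspace D\<rbrakk> \<Longrightarrow> E\<^sub>m (A k x) = boundary_action k (E\<^sub>m x)"
    and Eagree: "\<And>x. x \<in> topspace (universal_circle \<Psi> D \<iota>) \<Longrightarrow> E\<^sub>p x = E\<^sub>m x"
    and Elight: "\<And>z. z \<in> sphere_inf \<Longrightarrow> totally_disconnectedin D {x \<in>
      topspace (universal_circle \<Psi> D \<iota>). E\<^sub>p x = z}"
    using assms(6) unfolding compactified_flowspace_def P_def by auto
  define S where "S = topspace D - \<iota> ` P"
  have UC: "universal_circle \<Psi> D \<iota> = subtopology D S"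
    and UCS: "topspace (universal_circle \<Psi> D \<iota>) = S"
    by (auto simp: universal_circle_def S_def P_def)
  have \<iota>P: "\<iota> ` P \<subseteq> topspace D" and \<iota>inj: "inj_on \<iota> P"
    using embedding_map_in_subtopology emb unfolding P_def
    by (auto simp: embedding_map_def homeomorphic_eq_everything_map continuous_map_def)
  have Edistinct: "E\<^sub>p (\<iota> l) \<noteq> E\<^sub>m (\<iota> l)" if "l \<in> P" for l
  proof -
    obtain x where x: "x \<in> hyp_space" "l = flowline \<Psi> x"
      using \<open>l \<in> P\<close> unfolding P by blast
    then obtain b c where bc: "b \<noteq> c" "((\<lambda>t. \<Psi> t x) \<longlongrightarrow> b) at_top" "((\<lambda>t. \<Psi> t x) \<longlongrightarrow> c) at_bot"
      using assms(4) unfolding distinct_endpoints_def by blast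
    have "endpoint at_top \<Psi> (flowline \<Psi> x) = b"
      by (rule endpoint_flowline [OF flow x(1) _ filterlim_shift_at_top bc(2)]) simp
    moreover have "endpoint at_bot \<Psi> (flowline \<Psi> x) = c"
      by (rule endpoint_flowline [OF flow x(1) _ filterlim_shift_at_bot bc(3)]) simp
    ultimately show ?thesis using bc(1) Eend [OF that] x(2) by simp
  qed

  \<comment> \<open>North-south dynamics of \<open>g\<close> at infinity\<close>
  have "g 0 \<noteq> 0"
  proof
    \<comment> \<open>A deck transformation fixing the centre is the identity and would preserve
      every flowline.\<close>
    assume g0: "g 0 = 0"
    note gD = deck_transformationsD [OF gd(1)]
    have id: "g x = x" if "x \<in> hyp_space" for x
      by (rule self_lift_unique [where f = g and g = "\<lambda>x. x", OF cov gD(1-3) continuous_on_id _ refl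
        _ g0 that]) auto
    have "flowline \<Psi> 0 \<subseteq> hyp_space"
      using flow unfolding continuous_flow_on_def flowline_def by auto
    then have "g ` flowline \<Psi> 0 = flowline \<Psi> 0"
      using id by force
    moreover have "flowline \<Psi> 0 \<in> P" unfolding P by simp
    ultimately show False using assms(8) by (simp add: P_def)
  qed
  obtain a r where ar: "a \<noteq> r"
    "\<And>z h. \<lbrakk>z \<in> sphere_inf; z \<noteq> r; \<And>n y. y \<in> hyp_space \<Longrightarrow> h n y = (g ^^ n) y\<rbrakk>
       \<Longrightarrow> (\<lambda>n. boundary_action (h n) z) \<longlonglongrightarrow> a"
    "\<And>z h. \<lbrakk>z \<in> sphere_inf; z \<noteq> a; \<And>n y. y \<in> hyp_space \<Longrightarrow> h n y = (g' ^^ n) y\<rbrakk>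
       \<Longrightarrow> (\<lambda>n. boundary_action (h n) z) \<longlonglongrightarrow> r"
  proof (rule deck_boundary_dynamics [OF assms(1) gd inv _ \<open>g 0 \<noteq> 0\<close>])
    fix a r assume 1: "a \<noteq> r"
      and 2: "\<And>z h. \<lbrakk>z \<in> sphere_inf; z \<noteq> r; \<And>n y. y \<in> hyp_space \<Longrightarrow> h n y = (g ^^ n) y\<rbrakk>
         \<Longrightarrow> (\<lambda>n. boundary_action (h n) z) \<longlonglongrightarrow> a"
      and 3: "\<And>z h. \<lbrakk>z \<in> sphere_inf; z \<noteq> a; \<And>n y. y \<in> hyp_space \<Longrightarrow> h n y = (g' ^^ n) y\<rbrakk>
         \<Longrightarrow> (\<lambda>n. boundary_action (h n) z) \<longlonglongrightarrow> r"
    show thesis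
    proof (rule that [OF 1])
      show "(\<lambda>n. boundary_action (h n) z) \<longlonglongrightarrow> a"
        if "z \<in> sphere_inf" "z \<noteq> r" "\<And>n y. y \<in> hyp_space \<Longrightarrow> h n y = (g ^^ n) y" for z h
        by (rule 2 [OF that])
      show "(\<lambda>n. boundary_action (h n) z) \<longlonglongrightarrow> r"
        if "z \<in> sphere_inf" "z \<noteq> a" "\<And>n y. y \<in> hyp_space \<Longrightarrow> h n y = (g' ^^ n) y" for z h
        by (rule 3 [OF that])
    qed
  qed auto
  have Esph: "E\<^sub>p x \<in> sphere_inf" "E\<^sub>m x \<in> sphere_inf" if "x \<in> topspace D" for x
    using Econt that by (auto simp: continuous_map_def simp del: mem_sphere)
  have powers: "E\<^sub>p ((A u ^^ n) x) = boundary_action (u [^]\<^bsub>?K\<^esub> n) (E\<^sub>p x)"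
      "E\<^sub>m ((A u ^^ n) x) = boundary_action (u [^]\<^bsub>?K\<^esub> n) (E\<^sub>m x)"
    if "u \<in> carrier ?K" "x \<in> topspace D" for u x n
    using Eact(1) [OF K.nat_pow_closed [OF that(1)] that(2), of n] Eact(2)
      [OF K.nat_pow_closed [OF that(1)] that(2), of n]
      group_action_nat_pow [OF act that, of n] by simp_all
  have forward: "(\<lambda>n. boundary_action (g [^]\<^bsub>?K\<^esub> n) z) \<longlonglongrightarrow> a" if "z \<in> sphere_inf" "z \<noteq> r" for z
    by (rule ar(2) [OF that deck_group_nat_pow_apply [OF gd(1)]])
  have backward: "(\<lambda>n. boundary_action (g' [^]\<^bsub>?K\<^esub> n) z) \<longlonglongrightarrow> r" if "z \<in> sphere_inf" "z \<noteq> a" for z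
    by (rule ar(3) [OF that deck_group_nat_pow_apply [OF gd(2)]])

  \<comment> \<open>Transfer to the closed unit disc\<close>
  let ?X = "cball (0::complex) 1"
  obtain h where h: "homeomorphic_map D (top_of_set ?X) h" "h ` \<iota> ` P = ball 0 1"
    using ex_h by blast
  then obtain k where hk: "homeomorphic_maps D (top_of_set ?X) h k"
    using homeomorphic_map_maps by blast
  have hc: "continuous_map D (top_of_set ?X) h" and kc: "continuous_map (top_of_set ?X) D k"
    using hk by (auto simp: homeomorphic_maps_def)
  have h1: "h d \<in> ?X" "k (h d) = d" if "d \<in> topspace D" for d
    using hk hc that by (auto simp: homeomorphic_maps_def continuous_map_def simp del: mem_cball)
  have k1: "k w \<in> topspace D" "h (k w) = w" if "w \<in> ?X" for w
    using hk kc that by (auto simp: homeomorphic_maps_def continuous_map_def simp del: mem_cball)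
  have AD: "A u d \<in> topspace D" if "u \<in> carrier ?K" "d \<in> topspace D" for u d
    using group_action.element_image [OF act that refl] .
  have Ainv: "A g' (A g d) = d" "A g (A g' d) = d" if "d \<in> topspace D" for d
    using group_action_inverse [OF act gc(1) that] by (simp_all add: g'_def)
  have normP: "norm (h d) < 1 \<longleftrightarrow> d \<in> \<iota> ` P" if "d \<in> topspace D" for d
  proof
    assume "norm (h d) < 1"
    then have "h d \<in> h ` \<iota> ` P" by (simp add: h(2))
    then obtain e where e: "e \<in> \<iota> ` P" "h d = h e" by blast
    then have "d = e" using h1(2) that \<iota>P by (metis subsetD)
    then show "d \<in> \<iota> ` P" using e(1) by simp
  next
    assume "d \<in> \<iota> ` P"
    then have "h d \<in> ball 0 1" unfolding h(2) [symmetric] by (rule imageI)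
    then show "norm (h d) < 1" by simp
  qed
  have normS: "norm (h d) = 1 \<longleftrightarrow> d \<in> S" if "d \<in> topspace D" for d
    using normP [OF that] h1(1) [OF that] that by (auto simp: S_def)
  have AP: "A u d \<in> \<iota> ` P" if "u \<in> carrier ?K" "d \<in> \<iota> ` P" for u d
  proof -
    have "u \<in> deck_transformations q" using that(1) by (simp add: deck_group_def)
    then show ?thesis using that A\<iota> gP by blast
  qed
  have AS: "A g d \<in> S \<longleftrightarrow> d \<in> S" if "d \<in> topspace D" for d
    using AP [OF gc(1)] AP [OF gc(2), of "A g d"] AD [OF gc(1) that] Ainv(1) [OF that] that
    by (auto simp: S_def)
  define G where "G \<equiv> \<lambda>w. h (A g (k w))"
  define G' where "G' \<equiv> \<lambda>w. h (A g' (k w))"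
  have hG: "h (A g d) = G (h d)" "h (A g' d) = G' (h d)" if "d \<in> topspace D" for d
    using h1(2) [OF that] by (simp_all add: G_def G'_def)
  have Gn: "k ((G ^^ n) w) = (A g ^^ n) (k w) \<and> (G ^^ n) w \<in> ?X" if "w \<in> ?X" for n w
  proof (induction n)
    case (Suc n)
    then have "(A g ^^ n) (k w) \<in> topspace D" using k1(1) by metis
    then show ?case
      using Suc h1 AD [OF gc(1)] by (simp add: G_def del: mem_cball)
  qed (use that in auto)
  have G'n: "k ((G' ^^ n) w) = (A g' ^^ n) (k w) \<and> (G' ^^ n) w \<in> ?X" if "w \<in> ?X" for n w
  proof (induction n)
    case (Suc n)
    then have "(A g' ^^ n) (k w) \<in> topspace D" using k1(1) by metis
    then show ?case
      using Suc h1 AD [OF gc(2)] by (simp add: G'_def del: mem_cball)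
  qed (use that in auto)
  have contA: "continuous_on ?X (\<lambda>w. h (A u (k w)))" if "u \<in> carrier ?K" for u
  proof -
    have "continuous_map (top_of_set ?X) (top_of_set ?X) (h \<circ> (A u \<circ> k))"
      by (rule continuous_map_compose [OF continuous_map_compose [OF kc
        homeomorphic_imp_continuous_map [OF Ahom [OF that]]] hc])
    then show ?thesis by (simp add: o_def)
  qed
  interpret disc_dynamics G G' "\<lambda>w. E\<^sub>p (k w)" "\<lambda>w. E\<^sub>m (k w)" a r
  proof
    show "homeomorphism ?X ?X G G'"
    proof (rule homeomorphismI)
      show "continuous_on ?X G" "continuous_on ?X G'"
        unfolding G_def G'_def by (rule contA [OF gc(1)], rule contA [OF gc(2)])
      show "G ` ?X \<subseteq> ?X" by (rule image_subsetI) (use Gn [of _ 1] in simp)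
      show "G' ` ?X \<subseteq> ?X" by (rule image_subsetI) (use G'n [of _ 1] in simp)
      show "G' (G w) = w" if "w \<in> ?X" for w
        using h1(2) [OF AD [OF gc(1) k1(1) [OF that]]] Ainv(1) [OF k1(1) [OF that]] k1(2) [OF that]
        by (simp add: G_def G'_def)
      show "G (G' w) = w" if "w \<in> ?X" for w
        using h1(2) [OF AD [OF gc(2) k1(1) [OF that]]] Ainv(2) [OF k1(1) [OF that]] k1(2) [OF that]
        by (simp add: G_def G'_def)
    qed
    show "norm (G w) = 1 \<longleftrightarrow> norm w = 1" if "w \<in> ?X" for w
      using normS [OF AD [OF gc(1) k1(1) [OF that]]] AS [OF k1(1) [OF that]] normS
        [OF k1(1) [OF that]] k1(2) [OF that]
      by (simp add: G_def)
    show "G w \<noteq> w" if "norm w < 1" for w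
    proof
      assume Gw: "G w = w"
      have w: "w \<in> ?X" using that by simp
      then have "k w \<in> \<iota> ` P" using normP [OF k1(1) [OF w]] k1(2) [OF w] that by simp
      then obtain l where l: "l \<in> P" "k w = \<iota> l" by blast
      have "A g (k w) = k w"
        using Gn [OF w, of 1] Gw by simp
      then have "\<iota> (g ` l) = \<iota> l"
        using l A\<iota> [OF gc(1)] by simp
      then have "g ` l = l"
        using \<iota>inj gP [OF gd(1) l(1)] l(1) by (meson inj_onD)
      then show False using assms(8) l(1) by (simp add: P_def)
    qed
    show "continuous_on ?X (\<lambda>w. E\<^sub>p (k w))" "continuous_on ?X (\<lambda>w. E\<^sub>m (k w))"
      using continuous_map_compose [OF kc Econt(1)] continuous_map_compose [OF kc Econt(2)] by
        (auto simp: o_def)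
    show "E\<^sub>p (k w) = E\<^sub>m (k w)" if "norm w = 1" for w
    proof -
      have w: "w \<in> ?X" using that by simp
      then have "k w \<in> S" using normS [OF k1(1) [OF w]] k1(2) [OF w] that by simp
      then show ?thesis using Eagree UCS by simp
    qed
    show "E\<^sub>p (k w) \<noteq> E\<^sub>m (k w)" if "norm w < 1" for w
    proof -
      have w: "w \<in> ?X" using that by simp
      then have "k w \<in> \<iota> ` P" using normP [OF k1(1) [OF w]] k1(2) [OF w] that by simp
      then obtain l where "l \<in> P" "k w = \<iota> l" by blast
      then show ?thesis using Edistinct [of l] by simp
    qed
    show "a \<noteq> r" by (rule ar(1))
    show "(\<lambda>n. E\<^sub>p (k ((G ^^ n) w))) \<longlonglongrightarrow> a" if "w \<in> ?X" "E\<^sub>p (k w) \<noteq> r" for w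
      using forward [OF Esph(1) [OF k1(1) [OF that(1)]] that(2)] Gn [OF that(1)] powers(1)
        [OF gc(1) k1(1) [OF that(1)]]
      by simp
    show "(\<lambda>n. E\<^sub>m (k ((G ^^ n) w))) \<longlonglongrightarrow> a" if "w \<in> ?X" "E\<^sub>m (k w) \<noteq> r" for w
      using forward [OF Esph(2) [OF k1(1) [OF that(1)]] that(2)] Gn [OF that(1)] powers(2)
        [OF gc(1) k1(1) [OF that(1)]]
      by simp
    show "(\<lambda>n. E\<^sub>p (k ((G' ^^ n) w))) \<longlonglongrightarrow> r" if "w \<in> ?X" "E\<^sub>p (k w) \<noteq> a" for w
      using backward [OF Esph(1) [OF k1(1) [OF that(1)]] that(2)] G'n [OF that(1)] powers(1)
        [OF gc(2) k1(1) [OF that(1)]]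
      by simp
    show "(\<lambda>n. E\<^sub>m (k ((G' ^^ n) w))) \<longlonglongrightarrow> r" if "w \<in> ?X" "E\<^sub>m (k w) \<noteq> a" for w
      using backward [OF Esph(2) [OF k1(1) [OF that(1)]] that(2)] G'n [OF that(1)] powers(2)
        [OF gc(2) k1(1) [OF that(1)]]
      by simp
    show "\<exists>x. C \<subseteq> {x}" if C: "connected C" "C \<subseteq> sphere 0 1" "\<And>w. w \<in> C \<Longrightarrow> E\<^sub>p (k w) = z" for C z
    proof (cases "C = {}")
      case False
      then obtain w where w: "w \<in> C" by blast
      have CX: "u \<in> ?X" "norm u = 1" if "u \<in> C" for u
        using C(2) that by auto
      have "z \<in> sphere_inf"
        using C(3) [OF w] Esph(1) [OF k1(1) [OF CX(1) [OF w]]] by simp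
      then have td: "totally_disconnectedin D {x \<in> S. E\<^sub>p x = z}"
        using Elight UCS by simp
      have "connectedin (top_of_set ?X) C"
        using C(1) CX(1) by (auto simp: connectedin_subtopology simp del: mem_cball)
      then have "connectedin D (k ` C)"
        by (rule connectedin_continuous_map_image [OF kc])
      moreover have "k ` C \<subseteq> {x \<in> S. E\<^sub>p x = z}"
      proof (rule image_subsetI)
        fix u assume u: "u \<in> C"
        then have "k u \<in> S"
          using normS [OF k1(1) [OF CX(1) [OF u]]] k1(2) [OF CX(1) [OF u]] CX(2) [OF u] by simp
        then show "k u \<in> {x \<in> S. E\<^sub>p x = z}" using C(3) [OF u] by simp
      qed
      ultimately obtain x where x: "k ` C \<subseteq> {x}"
        using td unfolding totally_disconnectedin_def by blast
      have "u = h x" if "u \<in> C" for u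
        using x that k1(2) [OF CX(1) [OF that]] by force
      then show ?thesis by blast
    qed simp
  qed

  \<comment> \<open>Return to the universal circle\<close>
  obtain s u where su: "s \<noteq> u" "{w \<in> ?X. G w = w} = {s, u}" "norm s = 1" "norm u = 1"
      "attracting_fixed_point (top_of_set ?X) G s" "attracting_fixed_point (top_of_set ?X) G' u"
    using attracting_repelling_pair by blast
  have suX: "s \<in> ?X" "u \<in> ?X" using su(3,4) by auto
  have suS: "k s \<in> S" "k u \<in> S"
    using normS [OF k1(1) [OF suX(1)]] normS [OF k1(1) [OF suX(2)]] k1(2) suX su(3,4) by auto
  have SD: "S \<subseteq> topspace D" by (auto simp: S_def)
  have "k s \<noteq> k u" using su(1) k1(2) suX by metis
  moreover have "{x \<in> S. A g x = x} = {k s, k u}"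
  proof (intro equalityI subsetI)
    fix x assume x: "x \<in> {x \<in> S. A g x = x}"
    then have xD: "x \<in> topspace D" using SD by blast
    have "h x \<in> {w \<in> ?X. G w = w}"
      using h1(1) [OF xD] hG(1) [OF xD] x by simp
    then have "h x = s \<or> h x = u" unfolding su(2) by simp
    then show "x \<in> {k s, k u}" using h1(2) [OF xD] by auto
  next
    fix x assume "x \<in> {k s, k u}"
    then obtain w where w: "w \<in> {s, u}" "x = k w" by blast
    then have "w \<in> {w \<in> ?X. G w = w}" unfolding su(2) by simp
    then have "A g (k w) = k w" using Gn [of w 1] by simp
    then show "x \<in> {x \<in> S. A g x = x}" using w suS by auto
  qed
  moreover have "attracting_fixed_point (subtopology D S) (A g) (k s)"
  proof (rule attracting_fixed_point_transport [OF h(1) SD suS(1)])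
    show "A g d \<in> S" "h (A g d) = G (h d)" if "d \<in> S" for d
      using AS hG(1) SD that by auto
    show "attracting_fixed_point (top_of_set ?X) G (h (k s))"
      using su(5) k1(2) [OF suX(1)] by simp
  qed
  moreover have "attracting_fixed_point (subtopology D S) (inv_into S (A g)) (k u)"
  proof (rule attracting_fixed_point_transport [OF h(1) SD suS(2)])
    have A'S: "A g' d \<in> S" if "d \<in> S" for d
      using AS [OF AD [OF gc(2)]] Ainv(2) SD that by (metis subsetD)
    have inj: "inj_on (A g) S"
      by (rule inj_on_inverseI [of _ "A g'"]) (use Ainv(1) SD in blast)
    \<comment> \<open>Repelling is defined through the inverse on the circle alone, which is the
      restriction of the action of \<open>g'\<close>.\<close>
    have "inv_into S (A g) d = A g' d" if "d \<in> S" for d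
      using inv_into_f_eq [OF inj A'S [OF that]] Ainv(2) SD that by blast
    then show "inv_into S (A g) d \<in> S" "h (inv_into S (A g) d) = G' (h d)" if "d \<in> S" for d
      using A'S hG(2) SD that by auto
    show "attracting_fixed_point (top_of_set ?X) G' (h (k u))"
      using su(6) k1(2) [OF suX(2)] by simp
  qed
  ultimately show ?thesis
    unfolding repelling_fixed_point_def UCS UC [symmetric]
    by blast
qed

end
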